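(* Let $p$ be a prime and suppose there exists a (nontrivial) $(p^3,m,k,\lambda)$-SEDF $\{D_1,\dots,D_m\}$ with $m>2$ in a finite abelian group $G$ of order $p^3$. Then $G\cong C_p^3$. Furthermore: (a) $\lambda=\frac{p^2(p-1)}{3(m-1)}$ and $k=\frac{p(p-1)}{m-1}\sqrt{\frac{p^2+p+1}{3}}$. In particular, $(p-1)\nmid k$, $\frac{p^2+p+1}{3}$ is a perfect square, and $p\equiv 1\pmod{12}$. (b) $a=\frac{p^2(p-1)}{3(m-1)(m-3)}$, $a\mid\lambda$, and $3(m-1)(m-3)\mid(p-1)$.
   Context: A $(v,m,k,\lambda)$-SEDF in a finite abelian group $G$ of order $v$ (written multiplicatively) is a collection $\{D_1,\dots,D_m\}$ of mutually disjoint $k$-subsets of $G$ such that for each $j$ and each non-identity $g\in G$, the number of pairs $(x,y)$ with $x\in D_j$, $y\in\bigcup_{i\ne j}D_i$, $xy^{-1}=g$ equals $\lambda$ ($\lambda\ge1$); nontrivial means $k>1$. $G^*$ is the group of complex characters of $G$; for $S\subseteq G$, $\chi(S)=\sum_{g\in S}\chi(g)$. For $\chi\in G^*$, $a_\chi=\min_{1\le i\le m}|\chi(D_i)|^2$, and $a=\min\{a_\chi:\chi\in G^*\}$. $C_p$ is the cyclic group of order $p$. *)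

theory Defs
  imports Complex_Main "HOL-Algebra.Elementary_Groups" "HOL-Algebra.Product_Groups"
    "HOL-Number_Theory.Cong" "HOL-Library.Disjoint_Sets"
begin

definition SEDF :: "('a, 'b) monoid_scheme \<Rightarrow> nat \<Rightarrow> nat \<Rightarrow> nat \<Rightarrow> nat \<Rightarrow> (nat \<Rightarrow> 'a set) \<Rightarrow> bool"
  where "SEDF G v m k l D \<longleftrightarrow>
    comm_group G \<and> finite (carrier G) \<and> order G = v \<and> l \<ge> 1 \<and>
    (\<forall>i\<in>{1..m}. D i \<subseteq> carrier G \<and> card (D i) = k) \<and>
    disjoint_family_on D {1..m} \<and>
    (\<forall>j\<in>{1..m}. \<forall>g\<in>carrier G - {\<one>\<^bsub>G\<^esub>}.
       card {(x, y). x \<in> D j \<and> y \<in> (\<Union>i\<in>{1..m} - {j}. D i) \<and> x \<otimes>\<^bsub>G\<^esub> inv\<^bsub>G\<^esub> y = g} = l)"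

definition nonzero_complex_group :: "complex monoid"
  where "nonzero_complex_group = \<lparr>carrier = UNIV - {0}, monoid.mult = (*), one = 1\<rparr>"

(* Characters are made extensional (undefined outside the carrier), so that they are determined by
   their values on the group and a finite group has only finitely many of them. *)
definition character_group :: "('a, 'b) monoid_scheme \<Rightarrow> ('a \<Rightarrow> complex) monoid"
  where "character_group G =
    \<lparr>carrier = hom G nonzero_complex_group \<inter> extensional (carrier G),
     monoid.mult = (\<lambda>\<chi> \<psi>. \<lambda>g\<in>carrier G. \<chi> g * \<psi> g),
     one = (\<lambda>g\<in>carrier G. 1)\<rparr>"

definition char_sum :: "('a \<Rightarrow> complex) \<Rightarrow> 'a set \<Rightarrow> complex"
  where "char_sum \<chi> S = (\<Sum>g\<in>S. \<chi> g)"

definition a_char :: "nat \<Rightarrow> (nat \<Rightarrow> 'a set) \<Rightarrow> ('a \<Rightarrow> complex) \<Rightarrow> real"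
  where "a_char m D \<chi> = Min ((\<lambda>i. (cmod (char_sum \<chi> (D i)))\<^sup>2) ` {1..m})"

definition a_min :: "('a, 'b) monoid_scheme \<Rightarrow> nat \<Rightarrow> (nat \<Rightarrow> 'a set) \<Rightarrow> real"
  where "a_min G m D = Min (a_char m D ` carrier (character_group G))"

end

theory Submission
  imports Defs "HOL-Computational_Algebra.Polynomial_Factorial" "HOL-Algebra.FiniteProduct"
begin

text \<open>
  Let \<open>U\<close> be the union of the \<open>D\<^sub>i\<close>. For a nontrivial character \<open>\<chi>\<close> the definition of an SEDF says
  \<open>\<chi>(D\<^sub>i) cnj(\<chi>(U) - \<chi>(D\<^sub>i)) = -\<lambda>\<close>. So if \<open>\<chi>(U) \<noteq> 0\<close>, then the ratio \<open>\<chi>(D\<^sub>i) / \<chi>(U)\<close> is one of the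
  two real roots of a quadratic, and summing over \<open>i\<close> makes these roots rational. Hence all
  \<open>\<chi>(D\<^sub>i) cnj(\<chi>(D\<^sub>j))\<close> are rational, and being algebraic integers they are integers, congruent to \<open>k\<^sup>2\<close>
  modulo \<open>p\<close>. As they are Galois invariant, their sum over the nontrivial characters, which
  Parseval's identity evaluates, is divisible by \<open>p - 1\<close>; with \<open>i = j\<close> this gives \<open>p - 1 | k(k - 1)\<close>.

  If \<open>p\<close> does not divide \<open>k\<close>, then \<open>\<chi>(U) \<noteq> 0\<close> for all \<open>\<chi>\<close>, so the case \<open>i \<noteq> j\<close> gives \<open>p - 1 | k\<^sup>2\<close> and
  hence \<open>p - 1 | k\<close>, whereas \<open>p | m - 2\<close>. Together with \<open>k\<^sup>2(m - 1) = \<lambda>(p\<^sup>3 - 1)\<close>, \<open>m k \<le> p\<^sup>3\<close> and, when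
  \<open>k m\<close> is small, a character attaining \<open>a\<^sub>\<chi> = \<lambda> / (m - 3)\<close>, this is impossible. So \<open>p | k\<close>,
  whence \<open>p\<^sup>2 | \<lambda>\<close>, and the same equations determine \<open>k\<close> and \<open>\<lambda>\<close>. They also show that all
  \<open>|\<chi>(D\<^sub>i)|\<^sup>2\<close> are nonzero multiples of \<open>p\<^sup>2\<close>, and this makes \<open>\<chi>(D\<^sub>i)\<close> divisible by \<open>p\<close>.

  Suppose finally that \<open>z = h\<^sup>p \<noteq> 1 = z\<^sup>p\<close>. If \<open>\<chi>(z) \<noteq> 1\<close>, then \<open>|ker \<chi>| = p\<close>, and by the divisibility of
  \<open>\<chi>(D\<^sub>i)\<close> one of the \<open>p\<close> sets \<open>{x \<in> D\<^sub>i. x\<^sup>p = z\<^sup>r}\<close> is invariant under \<open>ker \<chi>\<close> and has a nonzero character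
  sum. For \<open>\<chi> = \<chi>\<^sub>0 \<psi>\<^sup>j\<close> with \<open>\<psi>(z) = 1\<close> and \<open>\<psi> \<noteq> 1\<close> on \<open>ker \<chi>\<^sub>0\<close>, different \<open>j\<close> give different \<open>r\<close>, so every such set
  is invariant under some \<open>ker (\<chi>\<^sub>0 \<psi>\<^sup>j)\<close>, on which \<open>\<psi>\<close> is nontrivial. Thus \<open>\<psi>(D\<^sub>i) = 0\<close>, a contradiction.
\<close>

section \<open>Integer polynomials at roots of unity of prime power order\<close>

text \<open>Elements of the ring Z[z] are handled through integer polynomials representing them. For
  z of order \<open>p ^ Suc s\<close> the value of a representative at 1 is determined modulo
  \<open>p\<close>: it is the residue modulo the prime z - 1.\<close>

definition ipoly :: "int poly \<Rightarrow> complex \<Rightarrow> complex"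
  where "ipoly f z = poly (map_poly of_int f) z"

lemma ipoly_0 [simp]: "ipoly 0 z = 0"
  by (simp add: ipoly_def)

lemma ipoly_pCons [simp]: "ipoly (pCons a f) z = of_int a + z * ipoly f z"
  by (simp add: ipoly_def map_poly_pCons)

lemma ipoly_1 [simp]: "ipoly 1 z = 1"
  by (simp add: one_pCons)

lemma ipoly_add [simp]: "ipoly (f + g) z = ipoly f z + ipoly g z"
proof -
  have "map_poly of_int (f + g) = map_poly of_int f + (map_poly of_int g :: complex poly)"
    by (intro poly_eqI) (simp add: coeff_map_poly)
  then show ?thesis by (simp add: ipoly_def)
qed

lemma ipoly_smult [simp]: "ipoly (smult a f) z = of_int a * ipoly f z"
  by (induction f rule: pCons_induct) (simp_all add: algebra_simps)

lemma ipoly_mult [simp]: "ipoly (f * g) z = ipoly f z * ipoly g z"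
  by (induction f rule: pCons_induct) (simp_all add: algebra_simps)

lemma ipoly_uminus [simp]: "ipoly (- f) z = - ipoly f z"
  using ipoly_smult[of "-1" f z] by simp

lemma ipoly_diff [simp]: "ipoly (f - g) z = ipoly f z - ipoly g z"
  using ipoly_add[of f "-g" z] by simp

lemma ipoly_power [simp]: "ipoly (f ^ n) z = ipoly f z ^ n"
  by (induction n) simp_all

lemma ipoly_monom [simp]: "ipoly (monom a n) z = of_int a * z ^ n"
  by (simp add: ipoly_def map_poly_monom poly_monom)

lemma ipoly_sum [simp]: "ipoly (\<Sum>i\<in>A. f i) z = (\<Sum>i\<in>A. ipoly (f i) z)"
  by (induction A rule: infinite_finite_induct) simp_all

lemma ipoly_pcompose [simp]: "ipoly (pcompose f g) z = ipoly f (ipoly g z)"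
  by (induction f rule: pCons_induct) (simp_all add: pcompose_pCons)

section \<open>Congruences between integer polynomials\<close>

lemma pCons_const_mult_eq_smult: "[:a:] * f = smult a f"
  by simp

text \<open>Modulo \<open>q\<close> the product is constant. If \<open>v\<close> did not vanish
  modulo \<open>q\<close>, its top surviving coefficient, multiplied by the unit leading coefficient
  of \<open>u\<close>, would survive in positive degree. As a unit is cancelled, composite
  \<open>q\<close> is covered too.\<close>

lemma unit_lead_coeff_mult_cong_const:
  fixes u v w :: "int poly"
  assumes lead: "\<bar>lead_coeff u\<bar> = 1" and deg: "degree u > 0"
    and eq: "u * v = smult q w + [:a:]"
  shows "q dvd a"
proof (cases "\<forall>i. q dvd coeff v i")
  case True
  then have "[:q:] dvd v" by (simp add: const_poly_dvd_iff)
  then have "[:q:] dvd u * v" by (rule dvd_mult)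
  then have "q dvd coeff (u * v) 0" by (simp add: const_poly_dvd_iff)
  then show ?thesis by (simp add: eq dvd_add_right_iff)
next
  case False
  \<comment> \<open>\<open>d\<close> is the degree of \<open>v\<close> modulo
    \<open>q\<close>.\<close>
  define d where "d = (GREATEST i. \<not> q dvd coeff v i)"
  have bound: "\<And>i. \<not> q dvd coeff v i \<Longrightarrow> i \<le> degree v"
    by (auto intro: le_degree)
  have d: "\<not> q dvd coeff v d"
    unfolding d_def by (rule GreatestI_ex_nat[OF _ bound]) (use False in blast)
  have above: "q dvd coeff v i" if "i > d" for i
  proof (rule ccontr)
    assume "\<not> q dvd coeff v i"
    then have "i \<le> d" unfolding d_def using bound by (rule Greatest_le_nat)
    with that show False by simp
  qed
  have "q dvd coeff (u * v) (degree u + d) - lead_coeff u * coeff v d"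
  proof -
    have "coeff (u * v) (degree u + d)
        = (\<Sum>i\<le>degree u + d. coeff u i * coeff v (degree u + d - i))"
      by (simp add: coeff_mult)
    also have "\<dots> = coeff u (degree u) * coeff v d
        + (\<Sum>i\<in>{..degree u + d} - {degree u}. coeff u i * coeff v (degree u + d - i))"
      by (subst sum.remove[of _ "degree u"]) auto
    finally have "coeff (u * v) (degree u + d) - lead_coeff u * coeff v d
      = (\<Sum>i\<in>{..degree u + d} - {degree u}. coeff u i * coeff v (degree u + d - i))" by simp
    also have "q dvd \<dots>"
    proof (rule dvd_sum)
      fix i assume i: "i \<in> {..degree u + d} - {degree u}"
      show "q dvd coeff u i * coeff v (degree u + d - i)"
      proof (cases "i < degree u")
        case True
        then show ?thesis using above[of "degree u + d - i"] by simp
      next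
        case False
        then show ?thesis using i by (simp add: coeff_eq_0)
      qed
    qed
    finally show ?thesis .
  qed
  moreover have "q dvd coeff (u * v) (degree u + d)"
    using deg by (simp add: eq coeff_pCons split: nat.splits)
  ultimately have "q dvd lead_coeff u * coeff v d" by (metis dvd_diff_right_iff)
  then have "q dvd coeff v d" using lead by (metis abs_mult dvd_abs_iff mult_1)
  with d show ?thesis by simp
qed

lemma prime_dvd_add_power_diff:
  fixes x y :: "'a::comm_ring_1"
  assumes "prime p"
  shows "of_nat p dvd (x + y) ^ p - x ^ p - y ^ p"
proof -
  have p: "p > 0" using assms prime_gt_0_nat by blast
  have "(x + y) ^ p = (\<Sum>k\<le>p. of_nat (p choose k) * x ^ k * y ^ (p - k))"
    by (rule binomial_ring)
  also have "{..p} = insert 0 (insert p {0<..<p})" using p by auto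
  finally have "(x + y) ^ p - x ^ p - y ^ p
      = (\<Sum>k\<in>{0<..<p}. of_nat (p choose k) * x ^ k * y ^ (p - k))"
    using p by simp
  also have "of_nat p dvd \<dots>"
  proof (rule dvd_sum)
    fix k assume "k \<in> {0<..<p}"
    then have "p dvd p choose k"
      using assms by (intro dvd_choose_prime) auto
    then have "(of_nat p :: 'a) dvd of_nat (p choose k)" by (auto elim!: dvdE)
    then show "of_nat p dvd of_nat (p choose k) * x ^ k * y ^ (p - k)"
      by (simp add: dvd_mult2)
  qed
  finally show ?thesis .
qed

lemma dvd_power_diff_power:
  fixes a b :: "'a::comm_ring_1"
  assumes "d dvd a - b"
  shows "d dvd a ^ n - b ^ n"
  using assms by (metis dvd_mult2 power_diff_sumr2)

lemma prime_dvd_diff_one_power: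
  fixes x :: "'a::comm_ring_1"
  assumes "prime p"
  shows "of_nat p dvd (x - 1) ^ (p ^ s) - (x ^ (p ^ s) - 1)"
proof (induction s)
  case 0
  then show ?case by simp
next
  case (Suc s)
  define y where "y = x ^ (p ^ s)"
  have 1: "of_nat p dvd ((x - 1) ^ (p ^ s)) ^ p - (y - 1) ^ p"
    using Suc unfolding y_def by (rule dvd_power_diff_power)
  have 2: "of_nat p dvd (y + (- 1)) ^ p - y ^ p - (- 1) ^ p"
    using assms by (rule prime_dvd_add_power_diff)
  \<comment> \<open>The signs also agree for \<open>p = 2\<close>, where -1 and 1 coincide modulo
    \<open>p\<close>.\<close>
  have 3: "(of_nat p :: 'a) dvd (- 1) ^ p + 1"
  proof (cases "p = 2")
    case True
    then show ?thesis by simp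
  next
    case False
    then have "odd p" using assms primes_dvd_imp_eq two_is_prime_nat by blast
    then show ?thesis by simp
  qed
  have "(x - 1) ^ (p ^ Suc s) - (x ^ (p ^ Suc s) - 1) =
    (((x - 1) ^ (p ^ s)) ^ p - (y - 1) ^ p) + ((y + (- 1)) ^ p - y ^ p - (- 1) ^ p) + ((- 1) ^ p + 1)"
    by (simp add: y_def power_mult[symmetric] mult.commute)
  then show ?case using 1 2 3 by (metis dvd_add)
qed

section \<open>The cyclotomic polynomial of prime power order and arithmetic in Z[z]\<close>

locale prime_power_root =
  fixes p s :: nat and z :: complex
  assumes prime: "prime p"
    and root: "z ^ (p ^ Suc s) = 1"
    and primitive: "z ^ (p ^ s) \<noteq> 1"
begin

abbreviation M :: nat where "M \<equiv> p ^ s"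
abbreviation N :: nat where "N \<equiv> p ^ Suc s"

text \<open>This is the cyclotomic polynomial of order \<open>N\<close>, the quotient of X^N - 1 by
  X^M - 1.\<close>

definition cyc :: "int poly" where "cyc = (\<Sum>i<p. monom 1 (i * M))"

lemma p_ge_2: "p \<ge> 2"
  using prime prime_ge_2_nat by blast

lemma M_pos: "M > 0" using p_ge_2 by simp

lemma M_less_N: "M < N"
  using p_ge_2 by simp

lemma cyc_mult: "(monom 1 M - 1) * cyc = monom 1 N - 1"
proof -
  have "(monom 1 M - 1 :: int poly) * (\<Sum>i<p. monom 1 M ^ i) = monom 1 M ^ p - 1"
    by (simp add: power_diff_1_eq)
  then show ?thesis by (simp add: cyc_def monom_power mult.commute)
qed

lemma poly_cyc_1: "poly cyc 1 = int p"
  by (simp add: cyc_def poly_sum poly_monom)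

lemma ipoly_cyc: "ipoly cyc z = 0"
proof -
  have "(z ^ M - 1) * ipoly cyc z = 0"
    using arg_cong[OF cyc_mult, of "\<lambda>f. ipoly f z"] root by simp
  with primitive show ?thesis by simp
qed

lemma degree_X_pow_minus_1: "n > 0 \<Longrightarrow> degree (monom 1 n - 1 :: int poly) = n"
  by (rule antisym[OF degree_le le_degree]) (auto simp: coeff_1)

lemma lead_coeff_X_pow_minus_1: "n > 0 \<Longrightarrow> lead_coeff (monom 1 n - 1 :: int poly) = 1"
  by (simp only: degree_X_pow_minus_1) (simp add: coeff_1)

lemma X_pow_minus_1_nonzero: "n > 0 \<Longrightarrow> monom 1 n - 1 \<noteq> (0 :: int poly)"
  using degree_X_pow_minus_1[of n] by (metis degree_0 less_numeral_extra(3))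

lemma cyc_nonzero: "cyc \<noteq> 0"
  using cyc_mult X_pow_minus_1_nonzero[of N] p_ge_2 by auto

lemma degree_cyc: "degree cyc = N - M"
proof -
  have "monom 1 M - 1 \<noteq> (0 :: int poly)"
    using M_pos by (rule X_pow_minus_1_nonzero)
  then have "degree ((monom 1 M - 1) * cyc) = M + degree cyc"
    using cyc_nonzero by (simp only: degree_mult_eq degree_X_pow_minus_1 M_pos simp_thms)
  then show ?thesis
    unfolding cyc_mult using degree_X_pow_minus_1[of N] M_less_N by simp
qed

lemma lead_coeff_cyc: "lead_coeff cyc = 1"
proof -
  have "lead_coeff (monom 1 M - 1 :: int poly) * lead_coeff cyc = 1"
    unfolding lead_coeff_mult[symmetric] cyc_mult
    using lead_coeff_X_pow_minus_1[of N] p_ge_2 by simp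
  then show ?thesis by (simp only: lead_coeff_X_pow_minus_1[OF M_pos] mult_1)
qed

text \<open>Modulo \<open>p\<close> the polynomials X^M - 1 and X^N - 1 become powers of X - 1, and
  (X - 1)^M may be cancelled because \<open>p\<close> is a prime element of Z[X] not dividing it.
  Together with the value \<open>p\<close> of \<open>cyc\<close> at 1 this is the input of
  Eisenstein's criterion.\<close>

lemma cyc_Eisenstein: "\<exists>H. cyc = [:- 1, 1:] ^ (N - M) + smult (int p) H"
proof -
  define X where "X = (monom 1 1 :: int poly)"
  have X: "X ^ n = monom 1 n" for n by (simp add: X_def monom_power)
  have a: "of_nat p dvd (X - 1) ^ M - (monom 1 M - 1)"
    using prime_dvd_diff_one_power[OF prime, of X s] by (simp add: X)
  have b: "of_nat p dvd (X - 1) ^ N - (monom 1 N - 1)"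
    using prime_dvd_diff_one_power[OF prime, of X "Suc s"] unfolding X .
  have "(X - 1) ^ M * (cyc - (X - 1) ^ (N - M))
      = ((X - 1) ^ M - (monom 1 M - 1)) * cyc - ((X - 1) ^ N - (monom 1 N - 1))"
  proof -
    have "(X - 1) ^ M * (X - 1) ^ (N - M) = (X - 1) ^ N"
      using M_less_N by (simp flip: power_add)
    then show ?thesis using cyc_mult by (simp add: algebra_simps)
  qed
  also have "of_nat p dvd \<dots>" using dvd_diff[OF dvd_mult2[OF a] b] .
  finally have "[:int p:] dvd (X - 1) ^ M * (cyc - (X - 1) ^ (N - M))"
    by (simp add: of_nat_poly)
  moreover have pr: "prime_elem [:int p:]"
    using prime by (simp add: prime_elem_const_poly_iff)
  moreover have "\<not> [:int p:] dvd (X - 1) ^ M"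
  proof
    assume "[:int p:] dvd (X - 1) ^ M"
    then have "[:int p:] dvd X - 1" using pr prime_elem_dvd_power by blast
    then have "int p dvd coeff (X - 1) 0" by (simp only: const_poly_dvd_iff)
    then show False using p_ge_2 by (simp add: X_def)
  qed
  ultimately have "[:int p:] dvd cyc - (X - 1) ^ (N - M)"
    using prime_elem_dvd_mult_iff by blast
  then obtain H where "cyc - (X - 1) ^ (N - M) = [:int p:] * H" by (elim dvdE)
  moreover have "X - 1 = [:- 1, 1:]" by (simp add: X_def monom_Suc one_pCons)
  ultimately have "cyc = [:- 1, 1:] ^ (N - M) + smult (int p) H"
    by (simp add: algebra_simps)
  then show ?thesis by blast
qed


text \<open>Modulo \<open>u\<close> the constant u(1) is a multiple of X - 1. Its power of exponent
  \<open>N - M\<close> is then a multiple of (X - 1)^(N - M), which modulo \<open>u\<close> is a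
  multiple of \<open>p\<close> because \<open>u\<close> divides \<open>cyc\<close>. So
  \<open>p\<close> divides a power of u(1).\<close>

lemma cyc_factor_dvd_at_1:
  assumes dvd: "u dvd cyc" and lead: "\<bar>lead_coeff u\<bar> = 1" and deg: "degree u > 0"
  shows "int p dvd poly u 1"
proof -
  define c where "c = poly u 1"
  define A where "A = [:- 1, 1 :: int:]"
  define u1 where "u1 = synthetic_div u 1"
  obtain H where H: "cyc = A ^ (N - M) + smult (int p) H"
    using cyc_Eisenstein by (auto simp: A_def)
  obtain h where h: "cyc = u * h" using dvd by (elim dvdE)
  have "A * u1 + [:c:] = u"
    unfolding A_def u1_def c_def by (rule synthetic_div_correct')
  then have "[:c:] - (- u1) * A = u" by (simp add: mult.commute add.commute)
  then have "u dvd [:c:] - (- u1) * A" by simp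
  then have "u dvd [:c:] ^ (N - M) - ((- u1) * A) ^ (N - M)" by (rule dvd_power_diff_power)
  then obtain v where v: "[:c:] ^ (N - M) - ((- u1) * A) ^ (N - M) = u * v" by (elim dvdE)
  have "((- u1) * A) ^ (N - M) = (- u1) ^ (N - M) * (u * h - smult (int p) H)"
    unfolding power_mult_distrib using H h by (metis add_diff_cancel_right')
  then have "u * (v + (- u1) ^ (N - M) * h)
      = smult (int p) ((- u1) ^ (N - M) * H) + [:c ^ (N - M):]"
    using v by (simp add: poly_const_pow algebra_simps)
  then have "int p dvd c ^ (N - M)" by (rule unit_lead_coeff_mult_cong_const[OF lead deg])
  then show ?thesis unfolding c_def using prime prime_dvd_power[of "int p"] by simp
qed

text \<open>The primitive part \<open>g\<close> of an annihilating polynomial of least degree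
  divides all the others by Gauss's lemma. If its cofactor in \<open>cyc\<close> were not constant,
  both factors would have values at 1 divisible by \<open>p\<close>, whereas their product is
  \<open>p\<close>.\<close>

lemma ipoly_zero_imp_cyc_dvd:
  assumes "ipoly f z = 0"
  shows "cyc dvd f"
proof -
  define P where "P = (\<lambda>g. g \<noteq> 0 \<and> ipoly g z = 0)"
  obtain f0 where f0: "P f0" and min: "\<And>f. P f \<Longrightarrow> degree f0 \<le> degree f"
    using ex_has_least_nat[of P cyc degree] cyc_nonzero ipoly_cyc by (auto simp: P_def)
  define g where "g = primitive_part f0"
  have f0_eq: "f0 = smult (content f0) g" by (simp add: g_def)
  have g0: "g \<noteq> 0" using f0 by (simp add: g_def P_def)
  have "ipoly f0 z = of_int (content f0) * ipoly g z"
    using ipoly_smult[of "content f0" g z] f0_eq by simp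
  moreover have "ipoly f0 z = 0" "content f0 \<noteq> 0" using f0 by (simp_all add: P_def)
  ultimately have gz: "ipoly g z = 0" by simp
  have deg: "degree g = degree f0" using f0_eq f0 by (simp add: g_def)
  have cont: "content g = 1" using f0 by (simp add: g_def P_def)
  have g_dvd: "g dvd f" if fz: "ipoly f z = 0" for f
  proof -
    \<comment> \<open>Pseudo-division stays inside Z[X] at the price of the factor \<open>a\<close>.
      Since \<open>g\<close> has content 1, that factor divides the quotient and cancels.\<close>
    obtain a q where a: "a \<noteq> 0" and eq: "smult a f = g * q + pseudo_mod f g"
      using pseudo_mod(1)[OF g0] by blast
    have "ipoly (pseudo_mod f g) z = 0"
      using arg_cong[OF eq, of "\<lambda>f. ipoly f z"] fz gz by simp
    then have "pseudo_mod f g = 0"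
      using pseudo_mod(2)[OF g0, of f] min[of "pseudo_mod f g"] deg by (fastforce simp: P_def not_less[symmetric])
    with eq have eq: "smult a f = g * q" by simp
    have "[:a:] dvd g * q" unfolding eq[symmetric] by (metis dvd_triv_left pCons_const_mult_eq_smult)
    then have "a dvd content q" using cont by (simp add: const_poly_dvd_iff_dvd_content content_mult)
    then have "[:a:] dvd q" by (simp add: const_poly_dvd_iff_dvd_content)
    then obtain q' where "q = smult a q'" by (auto elim!: dvdE)
    with eq have "smult a f = smult a (g * q')" by simp
    with a have "f = g * q'" by (metis smult_cancel)
    then show ?thesis by simp
  qed
  have dg: "degree g > 0"
  proof (rule ccontr)
    assume "\<not> degree g > 0"
    then obtain c where "g = [:c:]" using degree_eq_zeroE by blast
    with g0 gz show False by simp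
  qed
  obtain h where h: "cyc = g * h" using g_dvd[OF ipoly_cyc] by (elim dvdE)
  have "lead_coeff g * lead_coeff h = 1"
    using lead_coeff_cyc h by (simp add: lead_coeff_mult)
  then have leads: "\<bar>lead_coeff g\<bar> = 1" "\<bar>lead_coeff h\<bar> = 1"
    by (auto simp: zmult_eq_1_iff)
  have "degree h = 0"
  proof (rule ccontr)
    assume "degree h \<noteq> 0"
    then have "int p dvd poly h 1" using leads h by (intro cyc_factor_dvd_at_1) auto
    moreover have "int p dvd poly g 1" using leads h dg by (intro cyc_factor_dvd_at_1) auto
    ultimately have "int p * int p dvd poly g 1 * poly h 1" by (simp add: mult_dvd_mono)
    then have "int p * int p dvd int p" using poly_cyc_1 h by simp
    then have "int p dvd 1" using p_ge_2 by simp
    then show False using p_ge_2 by simp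
  qed
  then obtain c where c: "h = [:c:]" using degree_eq_zeroE by blast
  then have "c * c = 1" using leads(2) by (auto simp: abs_if split: if_splits)
  then have "g = cyc * h" by (simp add: h c)
  then have "cyc dvd g" by (rule dvdI)
  with g_dvd[OF assms] show ?thesis by (rule dvd_trans[rotated])
qed

text \<open>Rational elements of Z[z] are integers: the relation is a multiple of the monic
  polynomial \<open>cyc\<close>, and a constant that is such a multiple modulo \<open>b\<close> is 0
  modulo \<open>b\<close>.\<close>

lemma ipoly_rational_imp_dvd:
  assumes "of_int b * ipoly f z = of_int a"
  shows "b dvd a"
proof -
  have "cyc dvd smult b f - [:a:]" using assms by (intro ipoly_zero_imp_cyc_dvd) simp
  then obtain v where "smult b f - [:a:] = cyc * v" by (elim dvdE)
  then have "cyc * v = smult b f + [:- a:]" by (simp add: algebra_simps)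
  then have "b dvd - a"
    using lead_coeff_cyc degree_cyc M_less_N by (intro unit_lead_coeff_mult_cong_const[of cyc v b f]) auto
  then show ?thesis by simp
qed

text \<open>Evaluation at 1 sends every multiple of \<open>cyc\<close> to a multiple of
  \<open>p\<close>. It serves as reduction modulo the prime above \<open>p\<close>.\<close>

lemma ipoly_int_imp_cong:
  assumes "ipoly f z = of_int a"
  shows "int p dvd poly f 1 - a"
proof -
  have "cyc dvd f - [:a:]" using assms by (intro ipoly_zero_imp_cyc_dvd) simp
  then obtain v where "f - [:a:] = cyc * v" by (elim dvdE)
  from arg_cong[OF this, of "\<lambda>f. poly f 1"]
  have "poly f 1 - a = int p * poly v 1" by (simp add: poly_cyc_1)
  then show ?thesis by simp
qed

text \<open>Galois invariance of the integers: the relation at z is a multiple of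
  \<open>cyc\<close>, which vanishes at every primitive root of the same order.\<close>

lemma ipoly_int_conjugate:
  assumes "ipoly f z = of_int a" and "prime_power_root p s w"
  shows "ipoly f w = of_int a"
proof -
  have "cyc dvd f - [:a:]" using assms by (intro ipoly_zero_imp_cyc_dvd) simp
  then obtain v where "f - [:a:] = cyc * v" by (elim dvdE)
  from arg_cong[OF this, of "\<lambda>f. ipoly f w"]
  have "ipoly f w - of_int a = ipoly cyc w * ipoly v w" by simp
  then show ?thesis using prime_power_root.ipoly_cyc[OF assms(2)] by simp
qed

lemma prime_power_root_inverse: "prime_power_root p s (z ^ (N - 1))"
proof
  have zN: "(z ^ (N - 1)) ^ n * z ^ n = 1" for n
  proof -
    have "(z ^ (N - 1)) ^ n * z ^ n = (z ^ (N - 1) * z) ^ n" by (simp add: power_mult_distrib)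
    also have "z ^ (N - 1) * z = z ^ N" using p_ge_2 by (intro power_minus_mult) simp
    finally show ?thesis using root by simp
  qed
  show "prime p" by (rule prime)
  show "(z ^ (N - 1)) ^ N = 1" using zN[of N] root by simp
  show "(z ^ (N - 1)) ^ M \<noteq> 1" using zN[of M] primitive by auto
qed

text \<open>
  Above \<open>p\<close> there is only one prime, generated by \<open>z - 1\<close>, and it is stable under complex
  conjugation; so half of the \<open>(z - 1)\<close>-adic valuation of \<open>p\<^sup>2\<close> comes from each factor.
\<close>
lemma ipoly_dvd_of_norm_dvd:
  assumes norm: "ipoly f z * ipoly f (z ^ (N - 1)) = of_int (int p ^ 2 * n)"
  shows "\<exists>g. ipoly f z = of_nat p * ipoly g z"
proof -
  define w where "w = z ^ (N - 1)"
  define W where "W = (monom 1 (N - 1) :: int poly)"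
  have Wz: "ipoly W z = w" and W1: "poly W 1 = 1"
    by (simp_all add: W_def w_def poly_monom)
  define A where "A = [:- 1, 1 :: int:]"
  interpret w: prime_power_root p s w
    unfolding w_def by (rule prime_power_root_inverse)
  have z1: "z - 1 \<noteq> 0" "w - 1 \<noteq> 0" using primitive w.primitive by auto
  obtain H where H: "cyc = A ^ (N - M) + smult (int p) H"
    using cyc_Eisenstein by (auto simp: A_def)
  have H1: "poly H 1 = 1"
  proof -
    have "int p = int p * poly H 1"
      using arg_cong[OF H, of "\<lambda>f. poly f 1"] M_less_N by (simp add: poly_cyc_1 A_def zero_power)
    then show ?thesis using p_ge_2 by simp
  qed
  have Hz: "(z - 1) ^ (N - M) = - of_nat p * ipoly H z"
    using arg_cong[OF H, of "\<lambda>f. ipoly f z"] ipoly_cyc by (simp add: A_def eq_neg_iff_add_eq_0)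
  have Hw: "(w - 1) ^ (N - M) = - of_nat p * ipoly H w"
    using arg_cong[OF H, of "\<lambda>f. ipoly f w"] w.ipoly_cyc by (simp add: A_def eq_neg_iff_add_eq_0)
  \<comment> \<open>Division of \<open>cyc\<close> by X - 1 exhibits \<open>p\<close> as a multiple
    of z - 1.\<close>
  obtain c where c: "cyc = A * c + [:int p:]"
    using synthetic_div_correct'[of 1 cyc] by (metis A_def poly_cyc_1)
  have cz: "of_nat p = - (z - 1) * ipoly c z"
    using arg_cong[OF c, of "\<lambda>f. ipoly f z"] ipoly_cyc by (simp add: A_def algebra_simps eq_neg_iff_add_eq_0)
  \<comment> \<open>Factors z - 1 are split off one at a time, up to the exponent
    \<open>N - M\<close>, where the power of z - 1 is \<open>p\<close> times
    \<open>- ipoly H z\<close>.\<close>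
  have "\<exists>g. ipoly f z = (z - 1) ^ j * ipoly g z" if "j \<le> N - M" for j
    using that
  proof (induction j)
    case 0
    then show ?case by auto
  next
    case (Suc j)
    then obtain g where g: "ipoly f z = (z - 1) ^ j * ipoly g z" by auto
    \<comment> \<open>The factorization at z is transported to the conjugate w, so that both factors
      of the norm lose the same power.\<close>
    have "ipoly (f - A ^ j * g) z = of_int 0" using g by (simp add: A_def)
    then have "ipoly (f - A ^ j * g) w = of_int 0"
      using w.prime_power_root_axioms by (rule ipoly_int_conjugate)
    then have gw: "ipoly f w = (w - 1) ^ j * ipoly g w" by (simp add: A_def)
    have split: "(x - 1) ^ (N - M) = (x - 1) ^ j * (x - 1) ^ (N - M - j)" for x :: complex
      using Suc.prems by (simp flip: power_add)
    have "((z - 1) ^ j * (w - 1) ^ j) * (ipoly g z * ipoly g w * (ipoly H z * ipoly H w))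
        = (ipoly f z * ipoly f w) * (ipoly H z * ipoly H w)"
      by (simp add: g gw algebra_simps)
    also have "\<dots> = of_int n * ((- of_nat p * ipoly H z) * (- of_nat p * ipoly H w))"
      using norm by (simp add: w_def power2_eq_square)
    also have "\<dots> = ((z - 1) ^ j * (w - 1) ^ j)
        * (of_int n * ((z - 1) ^ (N - M - j) * (w - 1) ^ (N - M - j)))"
      unfolding Hz[symmetric] Hw[symmetric] split by (simp add: algebra_simps)
    finally have eq: "ipoly g z * ipoly g w * (ipoly H z * ipoly H w)
        = of_int n * ((z - 1) ^ (N - M - j) * (w - 1) ^ (N - M - j))"
      using z1 by simp
    \<comment> \<open>\<open>F\<close> encodes the identity as a polynomial in z alone, with X^(N -
      1) substituted for w. At 1 the powers of X - 1 vanish and \<open>H\<close> has the value 1, so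
      only the square of g(1) remains.\<close>
    define F where "F = g * pcompose g W * (H * pcompose H W)
        - smult n (A ^ (N - M - j) * (pcompose A W) ^ (N - M - j))"
    have "ipoly F z = of_int 0"
      using eq by (simp add: F_def Wz A_def)
    then have "int p dvd poly F 1 - 0" by (rule ipoly_int_imp_cong)
    also have "poly F 1 - 0 = poly g 1 ^ 2"
      using Suc.prems by (simp add: F_def W1 A_def poly_pcompose H1 power2_eq_square zero_power)
    finally have "int p dvd poly g 1"
      using prime prime_dvd_power[of "int p"] by simp
    then obtain a where a: "poly g 1 = int p * a" by (elim dvdE)
    \<comment> \<open>g(z) is g(1) plus a multiple of z - 1, and g(1), being a multiple of
      \<open>p\<close>, is a multiple of z - 1 as well.\<close>
    define g1 where "g1 = synthetic_div g 1"
    have "g = A * g1 + [:int p * a:]"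
      unfolding A_def g1_def a[symmetric] by (rule synthetic_div_correct'[symmetric])
    from arg_cong[OF this, of "\<lambda>f. ipoly f z"]
    have "ipoly g z = (z - 1) * ipoly g1 z + of_nat p * of_int a" by (simp add: A_def algebra_simps)
    then have "ipoly g z = (z - 1) * ipoly (g1 - smult a c) z" by (simp add: cz algebra_simps)
    then have "ipoly f z = (z - 1) ^ Suc j * ipoly (g1 - smult a c) z" using g by simp
    then show ?case by blast
  qed
  from this[of "N - M"] obtain g where "ipoly f z = (z - 1) ^ (N - M) * ipoly g z" by blast
  then have "ipoly f z = of_nat p * ipoly (- H * g) z" unfolding Hz by simp
  then show ?thesis by blast
qed

lemma reduce_degree: "\<exists>g'. ipoly g' z = ipoly g z \<and> (\<forall>i\<ge>N. coeff g' i = 0)"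
proof -
  have N: "N > 0" using p_ge_2 by simp
  define g' where "g' = (\<Sum>i\<le>degree g. monom (coeff g i) (i mod N))"
  have z_mod: "z ^ (i mod N) = z ^ i" for i
  proof -
    have "z ^ i = z ^ (N * (i div N) + i mod N)" by simp
    also have "\<dots> = (z ^ N) ^ (i div N) * z ^ (i mod N)" by (simp only: power_add power_mult)
    finally show ?thesis using root by simp
  qed
  have "ipoly g z = ipoly (\<Sum>i\<le>degree g. monom (coeff g i) i) z" by (simp only: poly_as_sum_of_monoms)
  then have "ipoly g' z = ipoly g z" by (simp add: g'_def z_mod del: power_Suc)
  moreover have "\<forall>i\<ge>N. coeff g' i = 0"
  proof (intro allI impI)
    fix i assume "i \<ge> N"
    then have "j mod N \<noteq> i" for j using mod_less_divisor[OF N, of j] by linarith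
    then show "coeff g' i = 0" by (simp add: g'_def coeff_sum del: power_Suc)
  qed
  ultimately show ?thesis by blast
qed

text \<open>If \<open>g\<close> too is represented in degree below \<open>N\<close>, then f - p g is
  \<open>cyc\<close> times a polynomial of degree below \<open>M\<close>, and the coefficients of
  such a product are periodic with period \<open>M\<close>.\<close>

lemma coeff_cong_of_ipoly_dvd:
  assumes deg: "\<And>i. i \<ge> N \<Longrightarrow> coeff f i = 0"
    and eq: "ipoly f z = of_nat p * ipoly g z" and i: "i + M < N"
  shows "int p dvd coeff f i - coeff f (i + M)"
proof -
  obtain g' where g': "ipoly g' z = ipoly g z" "\<And>i. i \<ge> N \<Longrightarrow> coeff g' i = 0"
    using reduce_degree by blast
  define F where "F = f - smult (int p) g'"
  have F0: "coeff F i = 0" if "i \<ge> N" for i using that deg g'(2) by (simp add: F_def)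
  have "cyc dvd F" using eq g'(1) by (intro ipoly_zero_imp_cyc_dvd) (simp add: F_def)
  then obtain h where h: "F = cyc * h" by (elim dvdE)
  have h0: "coeff h i = 0" if "i \<ge> M" for i
  proof (cases "h = 0")
    case False
    then have "degree F = N - M + degree h" "F \<noteq> 0"
      using cyc_nonzero degree_cyc by (simp_all add: h degree_mult_eq)
    then have "degree h < M" using F0[of "degree F"] M_less_N
      by (metis leading_coeff_0_iff le_add_diff_inverse less_imp_le_nat nat_add_left_cancel_less not_less add.commute)
    then show ?thesis using that by (simp add: coeff_eq_0)
  qed simp
  \<comment> \<open>In the degrees from \<open>M\<close> to \<open>N - 1\<close> all coefficients of
    the right hand side vanish.\<close>
  have "monom 1 M * F - F = monom 1 N * h - h"
    using arg_cong[OF cyc_mult, of "\<lambda>f. f * h"] by (simp add: h algebra_simps)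
  from arg_cong[OF this, of "\<lambda>f. coeff f (i + M)"]
  have "coeff F i - coeff F (i + M) = 0"
    using i h0 by (simp add: coeff_monom_mult)
  then have "coeff f i - coeff f (i + M) = int p * (coeff g' i - coeff g' (i + M))"
    by (simp add: F_def algebra_simps)
  then show ?thesis by simp
qed

end

section \<open>Characters of finite abelian groups\<close>

locale finite_comm_group = comm_group G for G (structure) +
  assumes finite_carrier: "finite (carrier G)"
begin

abbreviation chars :: "('a \<Rightarrow> complex) set" where "chars \<equiv> carrier (character_group G)"

definition trivial_char :: "'a \<Rightarrow> complex" where "trivial_char = (\<lambda>x\<in>carrier G. 1)"

definition char_pow :: "('a \<Rightarrow> complex) \<Rightarrow> nat \<Rightarrow> 'a \<Rightarrow> complex"
  where "char_pow \<chi> n = (\<lambda>x\<in>carrier G. \<chi> x ^ n)"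

definition char_times :: "('a \<Rightarrow> complex) \<Rightarrow> ('a \<Rightarrow> complex) \<Rightarrow> 'a \<Rightarrow> complex"
  where "char_times \<chi> \<psi> = (\<lambda>x\<in>carrier G. \<chi> x * \<psi> x)"

lemma chars_iff: "\<chi> \<in> chars \<longleftrightarrow> \<chi> \<in> extensional (carrier G) \<and> (\<forall>x\<in>carrier G. \<chi> x \<noteq> 0) \<and>
    (\<forall>x\<in>carrier G. \<forall>y\<in>carrier G. \<chi> (x \<otimes> y) = \<chi> x * \<chi> y)"
  by (auto simp: character_group_def hom_def nonzero_complex_group_def)

lemma char_nonzero: "\<chi> \<in> chars \<Longrightarrow> x \<in> carrier G \<Longrightarrow> \<chi> x \<noteq> 0"
  and char_mult: "\<chi> \<in> chars \<Longrightarrow> x \<in> carrier G \<Longrightarrow> y \<in> carrier G \<Longrightarrow> \<chi> (x \<otimes> y) = \<chi> x * \<chi> y"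
  by (auto simp: chars_iff)

lemma pow_order_eq_1: "x \<in> carrier G \<Longrightarrow> x [^] Coset.order G = \<one>"
  using power_order_eq_one[OF finite_carrier] by (simp add: Coset.order_def)

lemma char_one [simp]: "\<chi> \<in> chars \<Longrightarrow> \<chi> \<one> = 1"
  using char_mult[of \<chi> \<one> \<one>] char_nonzero[of \<chi> \<one>] by simp

lemma char_nat_pow: "\<chi> \<in> chars \<Longrightarrow> x \<in> carrier G \<Longrightarrow> \<chi> (x [^] (n::nat)) = \<chi> x ^ n"
  by (induction n) (simp_all add: char_mult)

lemma char_order: "\<chi> \<in> chars \<Longrightarrow> x \<in> carrier G \<Longrightarrow> \<chi> x ^ Coset.order G = 1"
  using char_nat_pow[of \<chi> x "Coset.order G"] by (simp add: pow_order_eq_1)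

lemma order_pos: "Coset.order G > 0"
  using finite_carrier by (simp add: order_gt_0_iff_finite)

lemma char_norm: "\<chi> \<in> chars \<Longrightarrow> x \<in> carrier G \<Longrightarrow> norm (\<chi> x) = 1"
  using char_order[of \<chi> x] order_pos by (metis norm_one norm_power norm_ge_zero power_eq_1_iff less_imp_neq)

lemma char_cnj: "\<chi> \<in> chars \<Longrightarrow> x \<in> carrier G \<Longrightarrow> \<chi> x * cnj (\<chi> x) = 1"
  using char_norm[of \<chi> x] by (simp add: complex_norm_square[symmetric])

lemma char_inv: "\<chi> \<in> chars \<Longrightarrow> x \<in> carrier G \<Longrightarrow> \<chi> (inv x) = cnj (\<chi> x)"
proof -
  assume *: "\<chi> \<in> chars" "x \<in> carrier G"
  then have "\<chi> x * \<chi> (inv x) = \<chi> x * cnj (\<chi> x)"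
    using char_mult[of \<chi> x "inv x"] char_cnj[of \<chi> x] by simp
  then show ?thesis using char_nonzero[OF *] by simp
qed

lemma trivial_char [simp]: "trivial_char \<in> chars"
  by (simp add: chars_iff trivial_char_def)

lemma char_pow [simp]: "\<chi> \<in> chars \<Longrightarrow> char_pow \<chi> n \<in> chars"
  by (auto simp: chars_iff char_pow_def power_mult_distrib)

lemma char_times [simp]: "\<chi> \<in> chars \<Longrightarrow> \<psi> \<in> chars \<Longrightarrow> char_times \<chi> \<psi> \<in> chars"
  by (auto simp: chars_iff char_times_def)

lemma char_eqI: "\<chi> \<in> chars \<Longrightarrow> \<psi> \<in> chars \<Longrightarrow> (\<And>x. x \<in> carrier G \<Longrightarrow> \<chi> x = \<psi> x) \<Longrightarrow> \<chi> = \<psi>"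
  by (auto simp: chars_iff intro: extensionalityI)

lemma nontrivial_char: "\<chi> \<in> chars \<Longrightarrow> \<chi> \<noteq> trivial_char \<Longrightarrow> \<exists>x\<in>carrier G. \<chi> x \<noteq> 1"
  by (metis char_eqI trivial_char trivial_char_def restrict_apply')

lemma finite_chars: "finite chars"
proof (rule finite_subset)
  show "chars \<subseteq> (\<Pi>\<^sub>E x\<in>carrier G. {z. z ^ Coset.order G = 1})"
  proof
    fix \<chi> assume \<chi>: "\<chi> \<in> chars"
    then have "\<chi> \<in> extensional (carrier G)" by (simp add: chars_iff)
    with \<chi> show "\<chi> \<in> (\<Pi>\<^sub>E x\<in>carrier G. {z. z ^ Coset.order G = 1})"
      by (simp add: PiE_iff char_order)
  qed
  show "finite (\<Pi>\<^sub>E x\<in>carrier G. {z :: complex. z ^ Coset.order G = 1})"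
    using finite_carrier order_pos by (intro finite_PiE finite_roots_unity) auto
qed

section \<open>Extension of characters from subgroups\<close>

definition partial_char :: "'a set \<Rightarrow> ('a \<Rightarrow> complex) \<Rightarrow> bool"
  where "partial_char H f \<longleftrightarrow> subgroup H G \<and> (\<forall>a\<in>H. f a \<noteq> 0) \<and> (\<forall>a\<in>H. \<forall>b\<in>H. f (a \<otimes> b) = f a * f b)"

lemma partial_char_pow:
  assumes "partial_char H f" "a \<in> H"
  shows "a [^] (n::nat) \<in> H \<and> f (a [^] n) = f a ^ n"
proof -
  interpret H: subgroup H G using assms by (simp add: partial_char_def)
  have "f (\<one> \<otimes> \<one>) = f \<one> * f \<one>" "f \<one> \<noteq> 0"
    using assms H.one_closed unfolding partial_char_def by blast+
  then have "f \<one> = 1" by simp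
  then show ?thesis using assms by (induction n) (auto simp: partial_char_def)
qed

lemma partial_char_extend_step:
  assumes H: "partial_char H f" and x: "x \<in> carrier G"
    and n: "n > 0" "x [^] n \<in> H" and least: "\<And>r. 0 < r \<Longrightarrow> r < n \<Longrightarrow> x [^] r \<notin> H"
    and w: "w ^ n = f (x [^] n)"
  shows "\<exists>H' f'. partial_char H' f' \<and> H \<subseteq> H' \<and> x \<in> H' \<and> (\<forall>h\<in>H. f' h = f h) \<and> f' x = w"
proof -
  interpret H: subgroup H G using H by (simp add: partial_char_def)
  have f_mult: "f (a \<otimes> b) = f a * f b" if "a \<in> H" "b \<in> H" for a b
    using H that by (simp add: partial_char_def)
  have f_nz: "f a \<noteq> 0" if "a \<in> H" for a using H that by (simp add: partial_char_def)
  have f_one: "f \<one> = 1" using partial_char_pow[OF H H.one_closed, of 0] by simp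
  have w0: "w \<noteq> 0" using w n f_nz by (metis power_0_left less_imp_neq)
  have key: "f (x [^] d) = w ^ d" if d: "x [^] d \<in> H" for d :: nat
  proof -
    define q r where "q = d div n" and "r = d mod n"
    have d_eq: "d = n * q + r" by (simp add: q_def r_def)
    have *: "x [^] d = (x [^] n) [^] q \<otimes> x [^] r"
      using x by (simp add: d_eq nat_pow_pow nat_pow_mult)
    have **: "(x [^] n) [^] q \<in> H" using partial_char_pow[OF H n(2)] by blast
    have "x [^] r = inv ((x [^] n) [^] q) \<otimes> x [^] d"
      using x unfolding * by (simp add: m_assoc[symmetric])
    then have "x [^] r \<in> H" using ** d by simp
    then have "r = 0" using least[of r] n mod_less_divisor[of n d] by (auto simp: r_def)
    then have "f (x [^] d) = f (x [^] n) ^ q"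
      using * x partial_char_pow[OF H n(2), of q] by simp
    then show ?thesis by (simp add: w[symmetric] d_eq \<open>r = 0\<close> power_mult)
  qed
  have wd: "f h * w ^ i = f h' * w ^ j"
    if "h \<in> H" "h' \<in> H" "h \<otimes> x [^] i = h' \<otimes> x [^] j" "i \<le> j" for h h' and i j :: nat
  proof -
    have c: "h \<in> carrier G" "h' \<in> carrier G" using that by auto
    have "h' \<otimes> x [^] (j - i) \<otimes> x [^] i = h \<otimes> x [^] i"
      using that c x by (simp add: m_assoc nat_pow_mult)
    then have eq: "h' \<otimes> x [^] (j - i) = h" using c x by simp
    then have "x [^] (j - i) = inv h' \<otimes> h" using c x by (metis inv_solve_left m_comm nat_pow_closed)
    then have "x [^] (j - i) \<in> H" using that by simp
    then have "f h = f h' * w ^ (j - i)" using f_mult[of h' "x [^] (j - i)"] key eq that by simp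
    then show ?thesis using that by (simp flip: power_add)
  qed
  \<comment> \<open>Natural exponents suffice since x has finite order: the inverse of x^i is its
    power with exponent \<open>(Coset.order G - 1) * i\<close>.\<close>
  define H' where "H' = {h \<otimes> x [^] (i::nat) | h i. h \<in> H}"
  define f' where "f' y = (THE c. \<exists>h\<in>H. \<exists>i::nat. y = h \<otimes> x [^] i \<and> c = f h * w ^ i)" for y
  have f': "f' (h \<otimes> x [^] i) = f h * w ^ i" if "h \<in> H" for h and i :: nat
    unfolding f'_def
  proof (rule the_equality)
    show "\<exists>h'\<in>H. \<exists>j::nat. h \<otimes> x [^] i = h' \<otimes> x [^] j \<and> f h * w ^ i = f h' * w ^ j"
      using that by blast
  next
    fix c assume "\<exists>h'\<in>H. \<exists>j::nat. h \<otimes> x [^] i = h' \<otimes> x [^] j \<and> c = f h' * w ^ j"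
    then obtain h' j where *: "h' \<in> H" "h \<otimes> x [^] i = h' \<otimes> x [^] j" "c = f h' * w ^ j" by blast
    show "c = f h * w ^ i"
    proof (cases "i \<le> j")
      case True
      then show ?thesis using wd[OF that *(1,2)] *(3) by simp
    next
      case False
      then show ?thesis using wd[OF *(1) that *(2)[symmetric]] *(3) by simp
    qed
  qed
  have mult: "(h \<otimes> x [^] i) \<otimes> (h' \<otimes> x [^] j) = (h \<otimes> h') \<otimes> x [^] (i + j)"
    if "h \<in> H" "h' \<in> H" for h h' and i j :: nat
  proof -
    have "h \<in> carrier G" "h' \<in> carrier G" using that by auto
    then show ?thesis using x by (simp add: nat_pow_mult[symmetric] m_ac)
  qed
  have "subgroup H' G"
  proof (rule subgroupI)
    show "H' \<subseteq> carrier G" using x by (auto simp: H'_def)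
    show "H' \<noteq> {}" using H.one_closed unfolding H'_def by blast
    fix a assume "a \<in> H'"
    then obtain h i where a: "a = h \<otimes> x [^] (i::nat)" "h \<in> H" by (auto simp: H'_def)
    have "(inv h \<otimes> x [^] ((Coset.order G - 1) * i)) \<otimes> a = \<one>"
    proof -
      have e: "(Coset.order G - 1) * i + i = Coset.order G * i" using order_pos by (simp add: algebra_simps)
      have "(inv h \<otimes> x [^] ((Coset.order G - 1) * i)) \<otimes> a = (inv h \<otimes> h) \<otimes> x [^] ((Coset.order G - 1) * i + i)"
        using mult[of "inv h" h "(Coset.order G - 1) * i" i] a by simp
      also have "\<dots> = \<one>"
        unfolding e using a x by (simp add: nat_pow_pow[symmetric] pow_order_eq_1)
      finally show ?thesis .
    qed
    then have "inv a = inv h \<otimes> x [^] ((Coset.order G - 1) * i)" using a x by (intro inv_equality) auto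
    then show "inv a \<in> H'" using a by (auto simp: H'_def)
    fix b assume "b \<in> H'"
    then obtain h' j where b: "b = h' \<otimes> x [^] (j::nat)" "h' \<in> H" by (auto simp: H'_def)
    have "h \<otimes> h' \<in> H" using a b by simp
    then show "a \<otimes> b \<in> H'" using mult[of h h' i j] a b by (auto simp: H'_def)
  qed
  moreover have "\<forall>a\<in>H'. f' a \<noteq> 0" using f' f_nz w0 by (auto simp: H'_def)
  moreover have "\<forall>a\<in>H'. \<forall>b\<in>H'. f' (a \<otimes> b) = f' a * f' b"
  proof (intro ballI)
    fix a b assume "a \<in> H'" "b \<in> H'"
    then obtain h i h' j where a: "a = h \<otimes> x [^] (i::nat)" "h \<in> H" and b: "b = h' \<otimes> x [^] (j::nat)" "h' \<in> H"
      by (auto simp: H'_def)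
    then have "h \<otimes> h' \<in> H" by simp
    then show "f' (a \<otimes> b) = f' a * f' b"
      using mult[of h h' i j] a b f' f_mult by (simp add: power_add)
  qed
  ultimately have pc: "partial_char H' f'" by (simp add: partial_char_def)
  have sub: "h \<in> H' \<and> f' h = f h" if "h \<in> H" for h
  proof -
    have h: "h \<otimes> x [^] (0::nat) = h" using that by simp
    then have "h \<in> H'" unfolding H'_def using that by (intro CollectI exI[of _ h] exI[of _ 0]) simp
    then show ?thesis using f'[OF that, of 0] by (simp only: h) simp
  qed
  have x1: "\<one> \<otimes> x [^] (1::nat) = x" using x by simp
  then have "x \<in> H'" unfolding H'_def by (intro CollectI exI[of _ \<one>] exI[of _ 1]) simp
  moreover have "f' x = w" using f'[OF H.one_closed, of 1] f_one by (simp only: x1) simp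
  ultimately have "x \<in> H' \<and> f' x = w" by blast
  with pc sub show ?thesis by blast
qed

lemma ex_least_pow_in_subgroup:
  assumes "subgroup H G" "x \<in> carrier G"
  shows "\<exists>n>0. x [^] n \<in> H \<and> (\<forall>r. 0 < r \<and> r < n \<longrightarrow> x [^] (r::nat) \<notin> H)"
proof -
  define P where "P = (\<lambda>n::nat. n > 0 \<and> x [^] n \<in> H)"
  have "P (Coset.order G)" using assms order_pos by (simp add: P_def pow_order_eq_1 subgroup.one_closed)
  then have "P (LEAST n. P n)" by (rule LeastI)
  moreover have "\<And>r. r < (LEAST n. P n) \<Longrightarrow> \<not> P r" by (rule not_less_Least)
  ultimately show ?thesis unfolding P_def by blast
qed

lemma complex_root_exists:
  assumes "n > 0" shows "\<exists>w :: complex. w ^ n = c"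
proof -
  obtain r t where "c = rcis r t" "r \<ge> 0" by (metis rcis_cmod_Arg norm_ge_zero)
  then have "rcis (root n r) (t / n) ^ n = c"
    using assms by (simp add: DeMoivre2)
  then show ?thesis by blast
qed

text \<open>One element is adjoined at a time, complex roots being always available. The induction
  is on the number of elements outside \<open>H\<close>.\<close>

lemma partial_char_extend:
  assumes "partial_char H f"
  shows "\<exists>\<chi>\<in>chars. \<forall>h\<in>H. \<chi> h = f h"
  using assms
proof (induction "card (carrier G) - card H" arbitrary: H f rule: less_induct)
  case less
  interpret H: subgroup H G using less.prems by (simp add: partial_char_def)
  show ?case
  proof (cases "H = carrier G")
    case True
    then have "restrict f (carrier G) \<in> chars"
      using less.prems by (auto simp: chars_iff partial_char_def)
    then show ?thesis using True by (intro bexI[of _ "restrict f (carrier G)"]) auto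
  next
    case False
    then obtain x where x: "x \<in> carrier G" "x \<notin> H" using H.subset by blast
    obtain n where n: "n > 0" "x [^] n \<in> H" "\<And>r. 0 < r \<Longrightarrow> r < n \<Longrightarrow> x [^] (r::nat) \<notin> H"
      using ex_least_pow_in_subgroup[OF H.subgroup_axioms x(1)] by blast
    obtain w where w: "w ^ n = f (x [^] n)" using complex_root_exists[OF n(1)] by blast
    obtain H' f' where H': "partial_char H' f'" "H \<subseteq> H'" "x \<in> H'" "\<forall>h\<in>H. f' h = f h"
      using partial_char_extend_step[OF less.prems x(1) n w] by blast
    have sub: "H' \<subseteq> carrier G" using H'(1) by (simp add: partial_char_def subgroup.subset)
    have "card H < card H'"
      using H' x sub finite_carrier by (intro psubset_card_mono) (auto intro: finite_subset)
    moreover have "card H' \<le> card (carrier G)" using sub finite_carrier by (rule card_mono[rotated])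
    ultimately obtain \<chi> where "\<chi> \<in> chars" "\<forall>h\<in>H'. \<chi> h = f' h"
      using less.hyps[OF _ H'(1)] by (meson diff_less_mono2 less_le_trans)
    then show ?thesis using H' by (intro bexI[of _ \<chi>]) auto
  qed
qed

text \<open>Over the trivial subgroup the exponent \<open>n\<close> is the order of
  \<open>x\<close>. It is at least 2, so a root of unity \<open>w\<close> other than 1 can be
  prescribed as the value at \<open>x\<close>.\<close>

lemma separating_char:
  assumes x: "x \<in> carrier G" and ne: "x \<noteq> \<one>"
  shows "\<exists>\<chi>\<in>chars. \<chi> x \<noteq> 1"
proof -
  have H: "partial_char {\<one>} (\<lambda>_. 1)" by (simp add: partial_char_def triv_subgroup)
  obtain n where n: "n > 0" "x [^] n \<in> {\<one>}" "\<And>r. 0 < r \<Longrightarrow> r < n \<Longrightarrow> x [^] (r::nat) \<notin> {\<one>}"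
    using ex_least_pow_in_subgroup[OF triv_subgroup x] by blast
  have "n \<noteq> 1" using n(2) x ne by auto
  then have n2: "n \<ge> 2" using n(1) by simp
  have "card {z :: complex. z ^ n = 1} = n" using n(1) by (rule card_roots_unity_eq)
  moreover have "{z :: complex. z ^ n = 1} \<subseteq> {1} \<Longrightarrow> card {z :: complex. z ^ n = 1} \<le> card {1 :: complex}"
    by (intro card_mono) auto
  ultimately obtain w :: complex where w: "w ^ n = 1" "w \<noteq> 1" using n2 by force
  obtain H' f' where H': "partial_char H' f'" "x \<in> H'" "f' x = w"
    using partial_char_extend_step[OF H x n, of w] w by blast
  obtain \<chi> where "\<chi> \<in> chars" "\<forall>h\<in>H'. \<chi> h = f' h" using partial_char_extend[OF H'(1)] by blast
  then show ?thesis using H' w by (intro bexI[of _ \<chi>]) auto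
qed

section \<open>Orthogonality relations and Parseval's identity\<close>

lemma sum_char_group:
  assumes \<chi>: "\<chi> \<in> chars" "\<chi> \<noteq> trivial_char"
  shows "(\<Sum>x\<in>carrier G. \<chi> x) = 0"
proof -
  obtain y where y: "y \<in> carrier G" "\<chi> y \<noteq> 1" using nontrivial_char[OF \<chi>] by blast
  have "(\<Sum>x\<in>carrier G. \<chi> x) = (\<Sum>x\<in>carrier G. \<chi> (y \<otimes> x))"
    by (rule sum.reindex_bij_witness[of _ "\<lambda>x. y \<otimes> x" "\<lambda>x. inv y \<otimes> x"])
       (use y in \<open>auto simp: m_assoc[symmetric]\<close>)
  also have "\<dots> = \<chi> y * (\<Sum>x\<in>carrier G. \<chi> x)"
    using y \<chi> by (simp add: char_mult sum_distrib_left)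
  finally show ?thesis using y by simp
qed

lemma sum_chars_nonidentity:
  assumes x: "x \<in> carrier G" "x \<noteq> \<one>"
  shows "(\<Sum>\<chi>\<in>chars. \<chi> x) = 0"
proof -
  obtain \<psi> where \<psi>: "\<psi> \<in> chars" "\<psi> x \<noteq> 1" using separating_char[OF x] by blast
  have inj: "inj_on (char_times \<psi>) chars"
  proof (rule inj_onI)
    fix \<chi> \<chi>' assume *: "\<chi> \<in> chars" "\<chi>' \<in> chars" "char_times \<psi> \<chi> = char_times \<psi> \<chi>'"
    have "\<psi> y * \<chi> y = \<psi> y * \<chi>' y" if "y \<in> carrier G" for y
      using that fun_cong[OF *(3), of y] by (simp add: char_times_def)
    then show "\<chi> = \<chi>'" using * \<psi> char_nonzero by (intro char_eqI) auto
  qed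
  then have "char_times \<psi> ` chars = chars"
    using \<psi> finite_chars by (intro endo_inj_surj) auto
  then have "(\<Sum>\<chi>\<in>chars. \<chi> x) = (\<Sum>\<chi>\<in>char_times \<psi> ` chars. \<chi> x)" by simp
  also have "\<dots> = (\<Sum>\<chi>\<in>chars. \<psi> x * \<chi> x)"
    by (simp only: sum.reindex[OF inj] o_def) (simp add: x char_times_def)
  also have "\<dots> = \<psi> x * (\<Sum>\<chi>\<in>chars. \<chi> x)" by (simp add: sum_distrib_left)
  finally show ?thesis using \<psi> by simp
qed

text \<open>The double sum of all values of all characters is evaluated in both orders by the two
  orthogonality relations.\<close>

lemma card_chars: "card chars = Coset.order G"
proof -
  have "(\<Sum>x\<in>carrier G. \<Sum>\<chi>\<in>chars. \<chi> x) = (\<Sum>x\<in>{\<one>}. \<Sum>\<chi>\<in>chars. \<chi> x)"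
    using finite_carrier sum_chars_nonidentity by (intro sum.mono_neutral_right) auto
  also have "\<dots> = of_nat (card chars)" by simp
  finally have 1: "(\<Sum>x\<in>carrier G. \<Sum>\<chi>\<in>chars. \<chi> x) = of_nat (card chars)" .
  have "(\<Sum>\<chi>\<in>chars. \<Sum>x\<in>carrier G. \<chi> x) = (\<Sum>\<chi>\<in>{trivial_char}. \<Sum>x\<in>carrier G. \<chi> x)"
    using finite_chars sum_char_group by (intro sum.mono_neutral_right) auto
  also have "\<dots> = of_nat (Coset.order G)" by (simp add: trivial_char_def Coset.order_def)
  finally have "(of_nat (card chars) :: complex) = of_nat (Coset.order G)"
    unfolding 1[symmetric] by (subst sum.swap)
  then show ?thesis by simp
qed

lemma sum_chars: "x \<in> carrier G \<Longrightarrow> (\<Sum>\<chi>\<in>chars. \<chi> x) = (if x = \<one> then of_nat (Coset.order G) else 0)"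
  by (simp add: sum_chars_nonidentity card_chars)

lemma cnj_char_sum: "cnj (char_sum \<chi> A) = (\<Sum>y\<in>A. cnj (\<chi> y))"
  by (simp add: char_sum_def)

lemma Parseval:
  assumes A: "A \<subseteq> carrier G" and B: "B \<subseteq> carrier G"
  shows "(\<Sum>\<chi>\<in>chars. char_sum \<chi> A * cnj (char_sum \<chi> B)) = of_nat (Coset.order G * card (A \<inter> B))"
proof -
  have fin: "finite A" "finite B" using A B finite_carrier finite_subset by auto
  have "(\<Sum>\<chi>\<in>chars. char_sum \<chi> A * cnj (char_sum \<chi> B))
      = (\<Sum>\<chi>\<in>chars. \<Sum>x\<in>A. \<Sum>y\<in>B. \<chi> (x \<otimes> inv y))"
  proof (rule sum.cong[OF refl])
    fix \<chi> assume "\<chi> \<in> chars"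
    then have "\<chi> (x \<otimes> inv y) = \<chi> x * cnj (\<chi> y)" if "x \<in> A" "y \<in> B" for x y
      using that A B by (subst char_mult) (auto simp: char_inv subset_eq)
    then show "char_sum \<chi> A * cnj (char_sum \<chi> B) = (\<Sum>x\<in>A. \<Sum>y\<in>B. \<chi> (x \<otimes> inv y))"
      by (simp add: cnj_char_sum) (simp add: char_sum_def sum_product)
  qed
  also have "\<dots> = (\<Sum>x\<in>A. \<Sum>y\<in>B. \<Sum>\<chi>\<in>chars. \<chi> (x \<otimes> inv y))"
    by (subst sum.swap, rule sum.cong[OF refl], rule sum.swap)
  also have "\<dots> = (\<Sum>x\<in>A. \<Sum>y\<in>B. if y = x then of_nat (Coset.order G) else 0)"
  proof (intro sum.cong[OF refl])
    fix x y assume "x \<in> A" "y \<in> B"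
    then have c: "x \<in> carrier G" "y \<in> carrier G" using A B by auto
    then have "x \<otimes> inv y = \<one> \<longleftrightarrow> y = x"
      by (metis inv_closed inv_equality inv_inv r_inv)
    then show "(\<Sum>\<chi>\<in>chars. \<chi> (x \<otimes> inv y)) = (if y = x then of_nat (Coset.order G) else 0)"
      using c by (simp add: sum_chars)
  qed
  also have "\<dots> = (\<Sum>x\<in>A. if x \<in> B then of_nat (Coset.order G) else 0)"
    using fin by (simp add: sum.delta)
  also have "\<dots> = of_nat (Coset.order G * card (A \<inter> B))"
    using fin by (simp flip: sum.inter_restrict)
  finally show ?thesis .
qed

end

section \<open>Powers modulo a prime and modulo its powers\<close>

lemma cong_prime_power_lift:
  fixes u v :: int
  assumes p: "p > 0" and uv: "int p dvd u - v"
  shows "int p ^ Suc s dvd u ^ (p ^ s) - v ^ (p ^ s)"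
proof (induction s)
  case 0
  then show ?case using uv by simp
next
  case (Suc s)
  define a b where "a = u ^ (p ^ s)" and "b = v ^ (p ^ s)"
  have ab: "int p ^ Suc s dvd a - b" using Suc by (simp add: a_def b_def)
  then have p_ab: "int p dvd a - b" by (rule dvd_trans[rotated]) simp
  \<comment> \<open>This is the cofactor of a - b in a^p - b^p. Modulo \<open>p\<close> each of its
    \<open>p\<close> summands is b^(p - 1).\<close>
  have "int p dvd (\<Sum>i<p. b ^ (p - Suc i) * a ^ i)"
  proof -
    have "int p dvd (\<Sum>i<p. b ^ (p - Suc i) * (a ^ i - b ^ i))"
      using p_ab by (intro dvd_sum dvd_mult dvd_power_diff_power)
    moreover have "(\<Sum>i<p. b ^ (p - Suc i) * b ^ i) = (\<Sum>i<p. b ^ (p - 1))"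
      by (intro sum.cong refl) (simp flip: power_add)
    moreover have "(\<Sum>i<p. b ^ (p - Suc i) * a ^ i)
        = (\<Sum>i<p. b ^ (p - Suc i) * (a ^ i - b ^ i)) + (\<Sum>i<p. b ^ (p - Suc i) * b ^ i)"
      by (simp add: sum.distrib[symmetric] algebra_simps)
    ultimately show ?thesis by simp
  qed
  then have "int p ^ Suc s * int p dvd (a - b) * (\<Sum>i<p. b ^ (p - Suc i) * a ^ i)"
    using ab by (intro mult_dvd_mono)
  then have "int p ^ Suc (Suc s) dvd a ^ p - b ^ p"
    by (simp add: power_diff_sumr2 mult.commute)
  then show ?case by (simp add: a_def b_def power_mult[symmetric] mult.commute)
qed

lemma root_of_unity_coprime_power:
  fixes y :: complex
  assumes "y ^ a = 1" "y ^ b = 1" "coprime a b"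
  shows "y = 1"
proof (cases "b = 0")
  case True
  then show ?thesis using assms by simp
next
  case False
  then obtain u v where "b * u = a * v + 1"
    using bezout_nat[OF False, of a] assms(3) by (auto simp: gcd.commute)
  then have "y ^ (b * u) = y ^ (a * v) * y" by (simp add: power_add)
  then show ?thesis using assms by (simp add: power_mult)
qed

lemma Fermat_power:
  assumes "prime p"
  shows "int p dvd int a ^ (p ^ s) - int a"
proof (induction s)
  case (Suc s)
  have base: "int p dvd int b ^ p - int b" for b
  proof (induction b)
    case 0
    then show ?case using prime_gt_0_nat[OF assms] by (simp add: zero_power)
  next
    case (Suc b)
    have "int p dvd (int b + 1) ^ p - int b ^ p - 1 ^ p"
      using prime_dvd_add_power_diff[OF assms, of "int b" 1] by simp
    from dvd_add[OF this Suc] show ?case by (simp add: algebra_simps)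
  qed
  have "int p dvd (int a ^ (p ^ s)) ^ p - int a ^ (p ^ s)" using base[of "a ^ (p ^ s)"] by simp
  from dvd_add[OF this Suc] show ?case by (simp add: power_mult[symmetric] mult.commute)
qed simp

section \<open>Character sums of abelian p-groups as cyclotomic integers\<close>

locale finite_abelian_p_group = finite_comm_group G for G (structure) +
  fixes p s :: nat
  assumes prime_p: "prime p" and order_G: "Coset.order G = p ^ Suc s"
begin

definition zeta :: complex where "zeta = cis (2 * pi / real (p ^ Suc s))"

lemma p_ge2: "p \<ge> 2" using prime_p prime_ge_2_nat by blast

lemma zeta_order: "zeta ^ n = 1 \<longleftrightarrow> p ^ Suc s dvd n"
proof
  have N: "real (p ^ Suc s) > 0" using p_ge2 by simp
  assume "zeta ^ n = 1"
  then have "cis (2 * pi * real n / real (p ^ Suc s)) = 1"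
    by (simp add: zeta_def DeMoivre mult.commute)
  then obtain k :: int where "2 * pi * real n / real (p ^ Suc s) = 2 * pi * k"
    by (auto simp: complex_eq_iff cos_one_2pi_int)
  then have "real n = real_of_int k * real (p ^ Suc s)" using N by (simp add: field_simps del: power_Suc of_nat_power)
  then have "int n = k * int (p ^ Suc s)" by (metis of_int_eq_iff of_int_mult of_int_of_nat_eq)
  then show "p ^ Suc s dvd n" by (metis dvd_triv_right int_dvd_int_iff)
next
  assume "p ^ Suc s dvd n"
  then obtain k where "n = p ^ Suc s * k" by (auto elim: dvdE)
  then show "zeta ^ n = 1" using p_ge2
    by (simp add: zeta_def DeMoivre power_mult del: power_Suc) 
qed

sublocale zeta: prime_power_root p s zeta
proof
  show "prime p" by (rule prime_p)
  show "zeta ^ (p ^ Suc s) = 1" by (simp add: zeta_order)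
  have "p ^ s < p ^ Suc s" using p_ge2 by simp
  then show "zeta ^ (p ^ s) \<noteq> 1" unfolding zeta_order using p_ge2 by (auto dest: dvd_imp_le)
qed

abbreviation M :: nat where "M \<equiv> p ^ s"
abbreviation N :: nat where "N \<equiv> p ^ Suc s"

lemma root_of_unity_eq_zeta_power:
  assumes "y ^ N = 1"
  shows "\<exists>e<N. y = zeta ^ e"
proof -
  have N: "N > 0" using p_ge2 by simp
  have "y \<in> (\<lambda>k. cis (2 * pi * real k / real N)) ` {..<N}"
    using bij_betw_roots_unity[OF N] assms unfolding bij_betw_def by blast
  then obtain k where "k < N" "y = cis (2 * pi * real k / real N)" by auto
  moreover have "cis (2 * pi * real k / real N) = zeta ^ k"
    by (simp add: zeta_def DeMoivre mult.commute)
  ultimately show ?thesis by blast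
qed

lemma prime_power_root_power:
  assumes "\<not> p dvd t"
  shows "prime_power_root p s (zeta ^ t)"
proof
  show "prime p" by (rule prime_p)
  show "(zeta ^ t) ^ N = 1" by (simp add: zeta_order del: power_Suc flip: power_mult)
  show "(zeta ^ t) ^ M \<noteq> 1"
  proof
    assume "(zeta ^ t) ^ M = 1"
    then have "p ^ Suc s dvd t * p ^ s" by (simp add: zeta_order del: power_Suc flip: power_mult)
    then show False using assms p_ge2 by simp
  qed
qed

lemma char_exponent: "\<chi> \<in> chars \<Longrightarrow> \<exists>e. \<forall>x\<in>carrier G. e x < N \<and> \<chi> x = zeta ^ e x"
  using root_of_unity_eq_zeta_power[OF char_order[unfolded order_G]] by (intro bchoice) blast

text \<open>A single polynomial represents the product for all conjugates at once, since raising
  zeta to the power t raises the character to the power t. Its value at 1 gives the residue modulo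
  \<open>p\<close>.\<close>

lemma char_sum_product_poly:
  assumes \<chi>: "\<chi> \<in> chars" and A: "A \<subseteq> carrier G" and B: "B \<subseteq> carrier G"
  shows "\<exists>f. poly f 1 = int (card A * card B) \<and>
    (\<forall>t. ipoly f (zeta ^ t) = char_sum (char_pow \<chi> t) A * cnj (char_sum (char_pow \<chi> t) B))"
proof -
  obtain e where e: "\<And>x. x \<in> carrier G \<Longrightarrow> \<chi> x = zeta ^ e x" using char_exponent[OF \<chi>] by blast
  \<comment> \<open>Conjugation is written with the exponent \<open>(N - 1) * e y\<close> in place
    of a negative one.\<close>
  have cnj: "cnj (\<chi> y) = zeta ^ ((N - 1) * e y)" if "y \<in> carrier G" for y
  proof -
    have "zeta ^ e y * zeta ^ ((N - 1) * e y) = 1"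
    proof -
      have "e y + (N - 1) * e y = N * e y" using p_ge2 by (cases N) auto
      then show ?thesis by (simp add: zeta_order del: power_Suc flip: power_add)
    qed
    then have "\<chi> y * zeta ^ ((N - 1) * e y) = \<chi> y * cnj (\<chi> y)" using e that char_cnj[OF \<chi>] by metis
    then show ?thesis using char_nonzero[OF \<chi> that] by simp
  qed
  define f where "f = (\<Sum>x\<in>A. \<Sum>y\<in>B. monom (1::int) (e x + (N - 1) * e y))"
  have "poly f 1 = int (card A * card B)" by (simp add: f_def poly_sum poly_monom)
  moreover have "ipoly f (zeta ^ t) = char_sum (char_pow \<chi> t) A * cnj (char_sum (char_pow \<chi> t) B)" for t
  proof -
    have pow_comm: "(zeta ^ t) ^ u = (zeta ^ u) ^ t" for u
      by (simp add: mult.commute flip: power_mult)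
    have "ipoly f (zeta ^ t) = (\<Sum>x\<in>A. \<Sum>y\<in>B. \<chi> x ^ t * cnj (\<chi> y) ^ t)"
      unfolding f_def ipoly_sum ipoly_monom
    proof (intro sum.cong[OF refl])
      fix x y assume "x \<in> A" "y \<in> B"
      then have x: "x \<in> carrier G" and y: "y \<in> carrier G" using A B by auto
      show "of_int 1 * (zeta ^ t) ^ (e x + (N - 1) * e y) = \<chi> x ^ t * cnj (\<chi> y) ^ t"
        by (simp only: e[OF x] cnj[OF y] of_int_1 mult_1 power_add pow_comm)
    qed
    also have "\<dots> = (\<Sum>x\<in>A. \<chi> x ^ t) * (\<Sum>y\<in>B. cnj (\<chi> y) ^ t)" by (simp add: sum_product)
    also have "(\<Sum>x\<in>A. \<chi> x ^ t) = char_sum (char_pow \<chi> t) A"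
      using A by (auto simp: char_sum_def char_pow_def intro!: sum.cong)
    also have "(\<Sum>y\<in>B. cnj (\<chi> y) ^ t) = cnj (char_sum (char_pow \<chi> t) B)"
      using B by (auto simp: char_sum_def char_pow_def intro!: sum.cong)
    finally show ?thesis .
  qed
  ultimately show ?thesis by blast
qed

lemma char_pow_1: "\<chi> \<in> chars \<Longrightarrow> char_pow \<chi> 1 = \<chi>"
  by (rule char_eqI[OF char_pow]) (auto simp: char_pow_def)

lemma char_product_rational_imp_dvd:
  assumes "\<chi> \<in> chars" "A \<subseteq> carrier G" "B \<subseteq> carrier G"
    and "of_int b * (char_sum \<chi> A * cnj (char_sum \<chi> B)) = of_int a"
  shows "b dvd a"
proof -
  obtain f where "ipoly f zeta = char_sum \<chi> A * cnj (char_sum \<chi> B)"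
    using char_sum_product_poly[OF assms(1-3)] char_pow_1[OF assms(1)] by (metis power_one_right)
  then show ?thesis using assms(4) by (intro zeta.ipoly_rational_imp_dvd[of b f a]) simp
qed

lemma char_product_int_imp_cong:
  assumes "\<chi> \<in> chars" "A \<subseteq> carrier G" "B \<subseteq> carrier G"
    and "char_sum \<chi> A * cnj (char_sum \<chi> B) = of_int a"
  shows "int p dvd int (card A * card B) - a"
proof -
  obtain f where "ipoly f zeta = char_sum \<chi> A * cnj (char_sum \<chi> B)" "poly f 1 = int (card A * card B)"
    using char_sum_product_poly[OF assms(1-3)] char_pow_1[OF assms(1)] by (metis power_one_right)
  then show ?thesis using assms(4) zeta.ipoly_int_imp_cong[of f a] by simp
qed

lemma char_product_int_conjugate:
  assumes "\<chi> \<in> chars" "A \<subseteq> carrier G" "B \<subseteq> carrier G"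
    and "char_sum \<chi> A * cnj (char_sum \<chi> B) = of_int a" and t: "\<not> p dvd t"
  shows "char_sum (char_pow \<chi> t) A * cnj (char_sum (char_pow \<chi> t) B) = of_int a"
proof -
  obtain f where f: "\<And>t. ipoly f (zeta ^ t) = char_sum (char_pow \<chi> t) A * cnj (char_sum (char_pow \<chi> t) B)"
    using char_sum_product_poly[OF assms(1-3)] by blast
  have "ipoly f zeta = of_int a" using f[of 1] assms(4) by (simp only: char_pow_1[OF assms(1)] power_one_right)
  then show ?thesis using zeta.ipoly_int_conjugate prime_power_root_power[OF t] f by metis
qed

text \<open>If two of the powers agreed, a value other than 1 would be annihilated both by
  \<open>N\<close> and by b^M - a^M. So \<open>p\<close> would divide that difference, which is b -
  a modulo \<open>p\<close> by Fermat.\<close>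

lemma card_Teichmueller_class:
  assumes \<chi>: "\<chi> \<in> chars" "\<chi> \<noteq> trivial_char"
  shows "card ((\<lambda>a. char_pow \<chi> (a ^ M)) ` {1..<p}) = p - 1"
proof -
  have "inj_on (\<lambda>a. char_pow \<chi> (a ^ M)) {1..<p}"
  proof (rule linorder_inj_onI')
    fix a b assume ab: "a \<in> {1..<p}" "b \<in> {1..<p}" "a < b"
    show "char_pow \<chi> (a ^ M) \<noteq> char_pow \<chi> (b ^ M)"
    proof
      assume eq: "char_pow \<chi> (a ^ M) = char_pow \<chi> (b ^ M)"
      obtain x where x: "x \<in> carrier G" "\<chi> x \<noteq> 1" using nontrivial_char[OF \<chi>] by blast
      have le: "a ^ M \<le> b ^ M" using ab by (intro power_mono) auto
      have "\<chi> x ^ (a ^ M) = \<chi> x ^ (b ^ M)" using fun_cong[OF eq, of x] x by (simp add: char_pow_def)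
      also have "\<dots> = \<chi> x ^ (a ^ M) * \<chi> x ^ (b ^ M - a ^ M)" using le by (simp flip: power_add)
      finally have 1: "\<chi> x ^ (b ^ M - a ^ M) = 1" using char_nonzero[OF \<chi>(1) x(1)] by simp
      have "\<not> coprime (b ^ M - a ^ M) N"
        using root_of_unity_coprime_power[OF 1, of N] char_order[OF \<chi>(1) x(1)] x(2) unfolding order_G by blast
      then have "p dvd b ^ M - a ^ M"
        using prime_imp_coprime[OF prime_p] by (meson coprime_commute coprime_power_right_iff)
      then have "int p dvd int b ^ M - int a ^ M" using le by (metis int_dvd_int_iff of_nat_diff of_nat_power)
      from dvd_diff[OF dvd_diff[OF this Fermat_power[OF prime_p, of b s]] Fermat_power[OF prime_p, of a s]]
      have "int p dvd (int b ^ M - int a ^ M) - (int b ^ M - int b) + (int a ^ M - int a)"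
        by (metis \<open>int p dvd int b ^ M - int a ^ M\<close> Fermat_power[OF prime_p] dvd_add dvd_diff)
      then have "int p dvd int b - int a" by (simp add: algebra_simps)
      then have "int p \<le> int b - int a" using ab by (intro zdvd_imp_le) auto
      then show False using ab by simp
    qed
  qed
  then show ?thesis by (simp add: card_image)
qed

text \<open>A congruence modulo \<open>p\<close> lifts to one of M-th powers modulo
  \<open>N\<close>, and every character has order dividing \<open>N\<close>. Hence the exponents a^M
  compose like the residues of a modulo \<open>p\<close>.\<close>

lemma char_pow_cong:
  assumes \<chi>: "\<chi> \<in> chars" and ab: "int p dvd int a - int b"
  shows "char_pow \<chi> (a ^ M) = char_pow \<chi> (b ^ M)"
proof (rule char_eqI)
  fix x assume x: "x \<in> carrier G"
  have *: "\<chi> x ^ u = \<chi> x ^ v" if "int N dvd int u - int v" "v \<le> u" for u v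
  proof -
    have "int N dvd int (u - v)" using that by (simp add: of_nat_diff)
    then obtain k where k: "u - v = N * k" unfolding int_dvd_int_iff by (auto elim: dvdE)
    have "\<chi> x ^ u = \<chi> x ^ v * \<chi> x ^ (u - v)" using that by (simp flip: power_add)
    also have "\<chi> x ^ (u - v) = (\<chi> x ^ N) ^ k" unfolding k by (rule power_mult)
    also have "\<dots> = 1" using char_order[OF \<chi> x] by (simp only: order_G power_one)
    finally show ?thesis by simp
  qed
  have "int N dvd int (a ^ M) - int (b ^ M)"
    using cong_prime_power_lift[OF _ ab, of s] p_ge2 by simp
  moreover from this have "int N dvd int (b ^ M) - int (a ^ M)" by (simp only: dvd_diff_commute)
  ultimately have "\<chi> x ^ (a ^ M) = \<chi> x ^ (b ^ M)"
    using *[of "a ^ M" "b ^ M"] *[of "b ^ M" "a ^ M"] by (metis nat_le_linear)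
  then show "char_pow \<chi> (a ^ M) x = char_pow \<chi> (b ^ M) x" using x by (simp add: char_pow_def)
qed (use \<chi> in simp_all)

text \<open>
  The exponents \<open>a ^ M\<close> with \<open>1 \<le> a < p\<close> represent the subgroup of order \<open>p - 1\<close> of the units
  modulo \<open>N\<close>, which acts freely on the nontrivial characters.
\<close>
lemma dvd_sum_Galois_invariant:
  fixes F :: "('a \<Rightarrow> complex) \<Rightarrow> int"
  assumes inv: "\<And>\<chi> t. \<chi> \<in> chars \<Longrightarrow> \<chi> \<noteq> trivial_char \<Longrightarrow> \<not> p dvd t \<Longrightarrow> F (char_pow \<chi> t) = F \<chi>"
  shows "int (p - 1) dvd (\<Sum>\<chi>\<in>chars - {trivial_char}. F \<chi>)"
proof -
  define S where "S = chars - {trivial_char}"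
  have finS: "finite S" using finite_chars by (simp add: S_def)
  have pow_pow: "char_pow (char_pow \<chi> a) b = char_pow \<chi> (a * b)" for \<chi> a b
    by (auto simp: char_pow_def power_mult)
  have nd: "\<not> p dvd a ^ M" if "a \<in> {1..<p}" for a
  proof
    assume "p dvd a ^ M"
    then have "p dvd a" using prime_dvd_power[OF prime_p] by blast
    then show False using that by (auto dest: dvd_imp_le)
  qed
  have closed: "char_pow \<chi> (a ^ M) \<in> S" if mem: "\<chi> \<in> S" "a \<in> {1..<p}" for \<chi> a
  proof -
    obtain x where x: "x \<in> carrier G" "\<chi> x \<noteq> 1" using nontrivial_char[of \<chi>] mem(1) by (auto simp: S_def)
    have "\<chi> x ^ (a ^ M) \<noteq> 1"
    proof
      assume "\<chi> x ^ (a ^ M) = 1"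
      moreover have "\<chi> x ^ N = 1" using char_order[of \<chi> x] mem x unfolding order_G S_def by blast
      moreover have "coprime (a ^ M) N"
        using prime_imp_coprime[OF prime_p nd[OF mem(2)]]
        by (metis coprime_commute coprime_power_right_iff)
      ultimately show False using root_of_unity_coprime_power x(2) by blast
    qed
    then have "char_pow \<chi> (a ^ M) \<noteq> trivial_char"
      using x by (auto simp: char_pow_def trivial_char_def fun_eq_iff)
    then show ?thesis using mem by (simp add: S_def)
  qed
  \<comment> \<open>Each level set of \<open>F\<close> is a union of orbits, and every orbit has
    \<open>p - 1\<close> elements.\<close>
  have level: "p - 1 dvd card {\<chi>\<in>S. F \<chi> = c}" for c
  proof -
    define L where "L = {\<chi>\<in>S. F \<chi> = c}"
    define r where "r = {(\<chi>, \<psi>). \<chi> \<in> L \<and> (\<exists>a\<in>{1..<p}. \<psi> = char_pow \<chi> (a ^ M))}"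
    have L_closed: "char_pow \<chi> (a ^ M) \<in> L" if "\<chi> \<in> L" "a \<in> {1..<p}" for \<chi> a
      using that closed inv nd by (auto simp: L_def S_def)
    have "equiv L r"
    proof (rule equivI)
      show "r \<subseteq> L \<times> L" using L_closed by (auto simp: r_def)
      show "refl_on L r"
      proof (rule refl_onI)
        fix \<chi> assume "\<chi> \<in> L"
        then show "(\<chi>, \<chi>) \<in> r" using char_pow_1[of \<chi>] p_ge2
          by (auto simp: r_def L_def S_def intro!: bexI[of _ 1])
      qed
      show "sym r"
      proof (rule symI)
        fix \<chi> \<psi> assume "(\<chi>, \<psi>) \<in> r"
        then obtain a where a: "\<chi> \<in> L" "a \<in> {1..<p}" "\<psi> = char_pow \<chi> (a ^ M)" by (auto simp: r_def)
        have "coprime a p" using a(2) prime_p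
          by (metis atLeastLessThan_iff coprime_commute dvd_imp_le leD less_le_trans prime_imp_coprime zero_less_one)
        then obtain b0 where b0: "[a * b0 = 1] (mod p)" using cong_solve_coprime_nat by auto
        define b where "b = b0 mod p"
        have b: "[a * b = 1] (mod p)" using b0 by (simp add: b_def cong_def mod_mult_right_eq)
        have "b \<noteq> 0" using b p_ge2 by (intro notI) (simp add: cong_def)
        then have b_range: "b \<in> {1..<p}" using p_ge2 by (simp add: b_def)
        have "int p dvd int (a * b) - int 1" using b by (simp add: cong_iff_dvd_diff cong_int_iff[symmetric])
        then have "char_pow \<chi> ((a * b) ^ M) = char_pow \<chi> (1 ^ M)"
          using a by (intro char_pow_cong) (auto simp: L_def S_def)
        also have "\<dots> = \<chi>" using char_pow_1[of \<chi>] a by (simp add: L_def S_def)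
        finally have "\<chi> = char_pow \<psi> (b ^ M)" by (simp add: a pow_pow power_mult_distrib)
        moreover have "\<psi> \<in> L" using L_closed a by simp
        ultimately show "(\<psi>, \<chi>) \<in> r" using b_range by (auto simp: r_def)
      qed
      show "trans r"
      proof (rule transI)
        fix \<chi> \<psi> \<theta> assume "(\<chi>, \<psi>) \<in> r" "(\<psi>, \<theta>) \<in> r"
        then obtain a b where a: "\<chi> \<in> L" "a \<in> {1..<p}" "\<psi> = char_pow \<chi> (a ^ M)"
          and b: "b \<in> {1..<p}" "\<theta> = char_pow \<psi> (b ^ M)" by (auto simp: r_def)
        define c where "c = (a * b) mod p"
        have "\<not> p dvd a * b" using a b prime_p by (auto simp: prime_dvd_mult_iff dest: dvd_imp_le)
        then have "c \<in> {1..<p}" using p_ge2 by (auto simp: c_def dvd_eq_mod_eq_0)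
        moreover have "int p dvd int (a * b) - int c" by (simp add: c_def zmod_int minus_mod_eq_mult_div)
        then have "char_pow \<chi> ((a * b) ^ M) = char_pow \<chi> (c ^ M)"
          using a by (intro char_pow_cong) (auto simp: L_def S_def)
        then have "\<theta> = char_pow \<chi> (c ^ M)" by (simp add: a b pow_pow power_mult_distrib)
        ultimately show "(\<chi>, \<theta>) \<in> r" using a by (auto simp: r_def)
      qed
    qed
    moreover have "p - 1 dvd card X" if X: "X \<in> L // r" for X
    proof -
      obtain \<chi> where \<chi>: "\<chi> \<in> L" "X = r `` {\<chi>}" using X unfolding quotient_def by blast
      then have "X = (\<lambda>a. char_pow \<chi> (a ^ M)) ` {1..<p}" by (auto simp: r_def)
      then show ?thesis using card_Teichmueller_class[of \<chi>] \<chi> by (simp add: L_def S_def)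
    qed
    moreover have "finite L" using finS by (simp add: L_def)
    ultimately show ?thesis unfolding L_def[symmetric] by (metis equiv_imp_dvd_card)
  qed
  have "(\<Sum>\<chi>\<in>S. F \<chi>) = (\<Sum>c\<in>F ` S. \<Sum>\<chi>\<in>{\<chi>\<in>S. F \<chi> = c}. F \<chi>)"
    using finS by (intro sum.image_gen)
  also have "\<dots> = (\<Sum>c\<in>F ` S. c * int (card {\<chi>\<in>S. F \<chi> = c}))"
    by (intro sum.cong refl) simp
  also have "int (p - 1) dvd \<dots>" using level by (intro dvd_sum dvd_mult) simp
  finally show ?thesis by (simp add: S_def)
qed

text \<open>The norm condition makes the character sum divisible by \<open>p\<close> in Z[zeta]. Its
  natural representing polynomial has the fibre sizes as coefficients, so these are congruent at
  exponents differing by multiples of \<open>M\<close>, that is, at values differing by a p-th root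
  of unity.\<close>

lemma fibre_cong_of_norm_dvd:
  assumes \<chi>: "\<chi> \<in> chars" and A: "A \<subseteq> carrier G"
    and norm: "char_sum \<chi> A * cnj (char_sum \<chi> A) = of_int (int p ^ 2 * n)" and \<eta>: "\<eta> ^ p = 1"
  shows "int p dvd int (card {x\<in>A. \<chi> x = c}) - int (card {x\<in>A. \<chi> x = c * \<eta>})"
proof -
  have finA: "finite A" using A finite_carrier finite_subset by blast
  have N: "N > 0" using p_ge2 by simp
  obtain e where e: "\<And>x. x \<in> carrier G \<Longrightarrow> e x < N \<and> \<chi> x = zeta ^ e x" using char_exponent[OF \<chi>] by blast
  have inj: "i = j" if "zeta ^ i = zeta ^ j" "i < N" "j < N" for i j
  proof -
    have *: "i = j" if "zeta ^ i = zeta ^ j" "i \<le> j" "j < N" for i j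
    proof -
      have "zeta ^ i * zeta ^ (j - i) = zeta ^ j" using that(2) by (simp flip: power_add)
      then have "zeta ^ i * zeta ^ (j - i) = zeta ^ i" using that(1) by simp
      moreover have "zeta \<noteq> 0" by (simp add: zeta_def)
      ultimately have "zeta ^ (j - i) = 1" by simp
      then have "N dvd j - i" by (simp only: zeta_order)
      then have "\<not> 0 < j - i" using that(3) dvd_imp_le[of N "j - i"] by linarith
      then show ?thesis using that(2) by simp
    qed
    then show ?thesis using that by (metis nat_le_linear)
  qed
  \<comment> \<open>Because the exponents are below \<open>N\<close>, the coefficients are exactly
    the fibre sizes.\<close>
  define f where "f = (\<Sum>x\<in>A. monom (1::int) (e x))"
  have fz: "ipoly f zeta = char_sum \<chi> A"
    using A e by (auto simp: f_def char_sum_def intro!: sum.cong)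
  have "ipoly f (zeta ^ (N - 1)) = cnj (char_sum \<chi> A)"
    unfolding f_def ipoly_sum ipoly_monom cnj_char_sum
  proof (intro sum.cong[OF refl])
    fix x assume "x \<in> A"
    then have x: "x \<in> carrier G" using A by auto
    have "\<chi> x * \<chi> x ^ (N - 1) = \<chi> x ^ N" using N by (metis power_eq_if less_imp_neq)
    also have "\<dots> = \<chi> x * cnj (\<chi> x)" using char_order[OF \<chi> x] char_cnj[OF \<chi> x] by (simp only: order_G)
    finally have "\<chi> x ^ (N - 1) = cnj (\<chi> x)" using char_nonzero[OF \<chi> x] by simp
    then show "of_int 1 * (zeta ^ (N - 1)) ^ e x = cnj (\<chi> x)"
      using e[OF x] by (simp add: mult.commute del: power_Suc complex_cnj_power flip: power_mult)
  qed
  then obtain g where g: "ipoly f zeta = of_nat p * ipoly g zeta"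
    using zeta.ipoly_dvd_of_norm_dvd[of f n] norm fz by auto
  define F where "F i = int (card {x\<in>A. \<chi> x = zeta ^ i})" for i
  have coeff: "coeff f i = (if i < N then F i else 0)" for i
  proof -
    have "coeff f i = (\<Sum>x\<in>A. if e x = i then 1 else 0)" by (simp add: f_def coeff_sum)
    also have "\<dots> = int (card {x\<in>A. e x = i})" using finA by (simp add: sum.If_cases Int_def)
    also have "{x\<in>A. e x = i} = (if i < N then {x\<in>A. \<chi> x = zeta ^ i} else {})"
      using A e inj by (auto simp: subset_eq)
    finally show ?thesis by (simp add: F_def)
  qed
  have step: "int p dvd F i - F (i + M)" if "i + M < N" for i
    using zeta.coeff_cong_of_ipoly_dvd[OF _ g that] that coeff by simp
  have base: "int p dvd F i - F (i mod M)" if "i < N" for i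
    using that
  proof (induction i rule: less_induct)
    case (less i)
    show ?case
    proof (cases "i < M")
      case True
      then show ?thesis by simp
    next
      case False
      have "int p dvd F (i - M) - F ((i - M) mod M)"
      proof (rule less.IH)
        show "i - M < i" "i - M < N" using False zeta.M_pos less.prems by linarith+
      qed
      moreover have "int p dvd F (i - M) - F i" using step[of "i - M"] less.prems False by simp
      ultimately have "int p dvd (F (i - M) - F ((i - M) mod M)) - (F (i - M) - F i)" by (rule dvd_diff)
      then show ?thesis using False by (simp add: mod_if[of i] le_mod_geq)
    qed
  qed
  have F_mod: "F (i mod N) = F i" for i
  proof -
    have "zeta ^ i = zeta ^ (N * (i div N) + i mod N)" by simp
    also have "\<dots> = (zeta ^ N) ^ (i div N) * zeta ^ (i mod N)" by (simp only: power_add power_mult)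
    also have "\<dots> = zeta ^ (i mod N)" using zeta.root by simp
    finally show ?thesis by (simp add: F_def)
  qed
  have F_cong: "int p dvd F i - F (i mod M)" for i
  proof -
    have "i mod N mod M = i mod M" by (rule mod_mod_cancel) simp
    then show ?thesis using base[of "i mod N"] N by (simp only: F_mod mod_less_divisor)
  qed
  have "\<eta> ^ N = (\<eta> ^ p) ^ M" by (simp add: power_mult)
  then have \<eta>N: "\<eta> ^ N = 1" using \<eta> by simp
  then obtain j where j: "\<eta> = zeta ^ j" using root_of_unity_eq_zeta_power by blast
  have "zeta ^ (j * p) = 1" using \<eta> j by (simp add: power_mult)
  then have "p ^ s * p dvd j * p" by (simp add: zeta_order mult.commute)
  then obtain k where k: "j = M * k" using p_ge2 by (auto elim: dvdE)
  show ?thesis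
  proof (cases "c ^ N = 1")
    case True
    then obtain i where i: "c = zeta ^ i" using root_of_unity_eq_zeta_power by blast
    have "int p dvd (F i - F (i mod M)) - (F (i + M * k) - F ((i + M * k) mod M))"
      by (intro dvd_diff F_cong)
    then have "int p dvd F i - F (i + M * k)" by simp
    then show ?thesis by (simp add: F_def i j k power_add)
  next
    case False
    \<comment> \<open>Outside the N-th roots of unity both fibres are empty.\<close>
    have "\<chi> x \<noteq> c \<and> \<chi> x \<noteq> c * \<eta>" if "x \<in> A" for x
    proof -
      have "\<chi> x ^ N = 1" using that A char_order[OF \<chi>] unfolding order_G by blast
      moreover have "(c * \<eta>) ^ N = c ^ N" by (simp only: power_mult_distrib \<eta>N mult_1_right)
      ultimately show ?thesis using False by metis
    qed
    then have "{x\<in>A. \<chi> x = c} = {}" "{x\<in>A. \<chi> x = c * \<eta>} = {}" by auto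
    then show ?thesis by (simp only: card.empty) simp
  qed
qed

end

section \<open>The Diophantine equations for the parameters\<close>

text \<open>Here m = 2 + p y and k = (p - 1) c. With 3 l = (p - 1) t the equation becomes 3 c^2 (1 +
  p y) = t n. It yields an integer f with f (p y + 1) = t D, and sizes leave f = 1 or f = 2. Parity
  excludes 2; for f = 1 the product k (m - 1) is small, so m - 3 = p y - 1 divides l, which fails
  modulo 3 or by size.\<close>

lemma parameters_coprime_case:
  fixes p y c l :: int
  assumes p: "p \<ge> 3" "odd p" and y: "y \<ge> 1" and c: "c \<ge> 1"
    and eq: "(p - 1) * c\<^sup>2 * (1 + p * y) = l * (p\<^sup>2 + p + 1)"
    and le: "(2 + p * y) * ((p - 1) * c) \<le> p ^ 3"
    and l_less: "l < (p - 1) * c"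
    and dvd: "3 * ((p - 1) * c) * (1 + p * y) < 2 * p ^ 3 \<Longrightarrow> (p * y - 1) dvd l"
  shows False
proof -
  define n where "n = p\<^sup>2 + p + 1"
  have n: "n > 0" "odd n" using p by (auto simp: n_def add_pos_pos)
  have py: "p * y \<ge> p" using p y by simp
  have n_eq: "n = (p - 1) * (p + 2) + 3" by (simp add: n_def algebra_simps power2_eq_square)
  have "(p - 1) dvd l * n" using eq by (metis n_def dvd_triv_left mult.assoc)
  then have "(p - 1) dvd (p - 1) * (l * (p + 2)) + 3 * l" by (simp add: n_eq algebra_simps)
  then have "(p - 1) dvd 3 * l" by (meson dvd_add_right_iff dvd_triv_left)
  then obtain t where t: "3 * l = (p - 1) * t" by (auto elim: dvdE)
  have "(p - 1) * (3 * c\<^sup>2 * (1 + p * y)) = (p - 1) * (t * n)"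
    using eq t unfolding n_def[symmetric] by (metis (no_types, lifting) mult.assoc mult.left_commute)
  then have main: "3 * c\<^sup>2 * (1 + p * y) = t * n" using p by simp
  have "(p - 1) * t < (p - 1) * (3 * c)" using l_less t by (simp add: algebra_simps)
  then have t_less: "t < 3 * c" using p by (simp add: mult_less_cancel_left_pos)
  have "t * n > 0" unfolding main[symmetric] using c py p by (intro mult_pos_pos add_pos_pos) auto
  then have t_pos: "t > 0" using n by (simp add: zero_less_mult_iff)
  have yc: "y * c \<le> p"
  proof (rule ccontr)
    assume "\<not> y * c \<le> p"
    then have "p + 1 \<le> y * c" by simp
    then have "p * (p - 1) * (p + 1) \<le> p * (p - 1) * (y * c)"
      using p by (intro mult_left_mono) auto
    moreover have "2 * (p - 1) * 1 \<le> 2 * (p - 1) * c" using p c by (intro mult_left_mono) auto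
    moreover have "(2 + p * y) * ((p - 1) * c) = 2 * (p - 1) * c + p * (p - 1) * (y * c)"
      by (simp add: algebra_simps)
    ultimately have "2 * (p - 1) + p * (p - 1) * (p + 1) \<le> p ^ 3" using le by linarith
    then show False using p by (simp add: algebra_simps power3_eq_cube)
  qed
  \<comment> \<open>Division of y^2 n by p y + 1 has the quotient p y + y - 1 and the remainder
    \<open>D\<close>; so \<open>f\<close> arises from the main equation multiplied by y^2.\<close>
  define f where "f = 3 * c\<^sup>2 * y\<^sup>2 - t * (p * y + y - 1)"
  define s where "s = t + t * p - 3 * c\<^sup>2 * y"
  define D where "D = y\<^sup>2 - y + 1"
  have D: "D > 0" "odd D" "D \<le> y\<^sup>2"
  proof -
    show "odd D" by (simp add: D_def)
    show "D \<le> y\<^sup>2" using y by (simp add: D_def)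
    have "y * 1 \<le> y * y" using y by (intro mult_left_mono) auto
    then show "D > 0" by (simp add: D_def power2_eq_square)
  qed
  have fD: "f * (p * y + 1) = t * D"
  proof -
    have "f * (p * y + 1) = y\<^sup>2 * (3 * c\<^sup>2 * (1 + p * y)) - t * (p * y + y - 1) * (p * y + 1)"
      by (simp add: f_def algebra_simps)
    also have "\<dots> = t * D" unfolding main
      by (simp add: n_def D_def algebra_simps power2_eq_square)
    finally show ?thesis .
  qed
  have ys: "y * s = t - f" by (simp add: f_def s_def algebra_simps power2_eq_square)
  \<comment> \<open>The main equation modulo \<open>p\<close> says that 3 c^2 is congruent to
    \<open>t\<close>, and \<open>s\<close> is the quotient.\<close>
  have ps: "3 * c\<^sup>2 = t + p * s"
    using main by (simp add: s_def n_def algebra_simps power2_eq_square)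
  have fp: "f * p = f * (y - 1) + s * D"
  proof -
    have "y * (f * p) = (f + y * s) * D - f" using fD ys by (simp add: algebra_simps)
    also have "\<dots> = y * (f * (y - 1) + s * D)"
      by (simp add: D_def algebra_simps power2_eq_square)
    finally show ?thesis using y by simp
  qed
  have f_pos: "f > 0"
  proof -
    have "f * (p * y + 1) > 0" using fD t_pos D by simp
    then show ?thesis using py p by (simp add: zero_less_mult_iff)
  qed
  \<comment> \<open>With t < 3 c and y c at most p, the product t D stays below 3 (p y + 1).\<close>
  have f_less: "f < 3"
  proof -
    have "t * D \<le> t * y\<^sup>2" using t_pos D by simp
    also have "\<dots> \<le> 3 * c * y\<^sup>2" using t_less by (intro mult_right_mono) auto
    also have "\<dots> = 3 * y * (y * c)" by (simp add: power2_eq_square)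
    also have "\<dots> \<le> 3 * y * p" using yc y by (intro mult_left_mono) auto
    also have "\<dots> < 3 * (p * y + 1)" by simp
    finally have "f * (p * y + 1) < 3 * (p * y + 1)" using fD by simp
    then show ?thesis by (rule mult_right_less_imp_less) (use py p in linarith)
  qed
  consider "f = 1" | "f = 2" using f_pos f_less by linarith
  then show False
  proof cases
    \<comment> \<open>Parity: \<open>D\<close> is odd, so \<open>s\<close> is even and then
      \<open>c\<close> is even; hence \<open>s'\<close> is odd and \<open>y\<close> even, which
      would make \<open>p\<close> even.\<close>
    case 2
    have "even (s * D)" using fp 2 by (metis dvd_add_right_iff dvd_triv_left)
    then obtain s' where s': "s = 2 * s'" using D by auto
    have p_eq: "p = y - 1 + s' * D" using fp 2 s' by simp
    have c2: "3 * c\<^sup>2 = 2 * (1 + s' * (y + p))" using ps ys 2 s' by (simp add: algebra_simps)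
    then have "even (3 * c\<^sup>2)" by simp
    then have "even c" by simp
    then obtain c' where "c = 2 * c'" by auto
    then have "1 + s' * (y + p) = 2 * (3 * c'\<^sup>2)" using c2 by (simp add: power2_eq_square)
    then have "even (1 + s' * (y + p))" by simp
    then have "odd s'" "even y" using p by auto
    then have "even p" using p_eq D by simp
    then show False using p by simp
  next
    case 1
    have t_eq: "t = 1 + y * s" using ys 1 by simp
    have p_eq: "p = y - 1 + s * D" using fp 1 by simp
    \<comment> \<open>For f = 1 the relation t D = q eliminates \<open>t\<close> and
      \<open>c\<close> after squaring, and the claim becomes 3 (p^3 - 1) (p - 1) q^2 < 4 p^6
      D.\<close>
    have "3 * ((p - 1) * c) * (1 + p * y) < 2 * p ^ 3"
    proof -
      define q where "q = 1 + p * y"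
      have q: "q > 0" using py p unfolding q_def by linarith
      have tD: "t * D = q" using fD 1 by (simp add: q_def algebra_simps)
      have p3: "(p - 1) * n = p ^ 3 - 1"
        by (simp add: n_def algebra_simps power2_eq_square power3_eq_cube)
      have pos: "p ^ 3 > 0" using p by simp
      have "(3 * ((p - 1) * c) * q)\<^sup>2 * D = 3 * (p - 1)\<^sup>2 * q * (3 * c\<^sup>2 * q) * D"
        by (simp add: power2_eq_square)
      also have "\<dots> = 3 * ((p - 1) * n) * (p - 1) * q * (t * D)"
        unfolding main[folded q_def] by (simp add: power2_eq_square)
      also have "\<dots> = 3 * (p ^ 3 - 1) * ((p - 1) * q\<^sup>2)"
        unfolding tD p3 by (simp add: power2_eq_square)
      also have "\<dots> < 4 * p ^ 6 * D"
      proof (cases "y = 1")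
        case True
        have "3 * ((p - 1) * q\<^sup>2) = 3 * p ^ 3 + 3 * p\<^sup>2 - 3 * p - 3"
          by (simp add: True q_def algebra_simps power2_eq_square power3_eq_cube)
        also have "\<dots> \<le> 4 * p ^ 3"
        proof -
          have "3 * p\<^sup>2 \<le> p * p\<^sup>2" using p by (intro mult_right_mono) auto
          then have "3 * p\<^sup>2 \<le> p ^ 3" by (simp add: power2_eq_square power3_eq_cube)
          then show ?thesis using p by linarith
        qed
        finally have "(p ^ 3 - 1) * (3 * ((p - 1) * q\<^sup>2)) \<le> (p ^ 3 - 1) * (4 * p ^ 3)"
          using pos by (intro mult_left_mono) auto
        also have "\<dots> < p ^ 3 * (4 * p ^ 3)" using pos by (intro mult_strict_right_mono) auto
        also have "\<dots> = 4 * p ^ 6 * D" by (simp add: True D_def flip: power_add)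
        finally show ?thesis by (simp only: mult_ac)
      next
        case False
        then have y2: "y \<ge> 2" using y by simp
        have "(p - 1) * q\<^sup>2 \<le> y\<^sup>2 * (p ^ 3 - 1)"
        proof -
          have "2 * (p * y) + 1 \<le> y * (p * y) + y * y"
            using y2 p mult_mono[of 1 y 1 y] by (intro add_mono mult_right_mono) auto
          then have "q\<^sup>2 \<le> y\<^sup>2 * n"
            by (simp add: q_def n_def algebra_simps power2_eq_square)
          then have "(p - 1) * q\<^sup>2 \<le> (p - 1) * (y\<^sup>2 * n)" using p by (intro mult_left_mono) auto
          also have "(p - 1) * (y\<^sup>2 * n) = y\<^sup>2 * (p ^ 3 - 1)"
            unfolding p3[symmetric] by (rule mult.left_commute)
          finally show ?thesis .
        qed
        then have "3 * (p ^ 3 - 1) * ((p - 1) * q\<^sup>2) \<le> 3 * (p ^ 3 - 1) * (y\<^sup>2 * (p ^ 3 - 1))"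
          using pos by (intro mult_left_mono) auto
        also have "\<dots> = (p ^ 3 - 1)\<^sup>2 * (3 * y\<^sup>2)" by (simp add: power2_eq_square)
        also have "\<dots> < (p ^ 3)\<^sup>2 * (3 * y\<^sup>2)"
          using pos y by (intro mult_strict_right_mono power_strict_mono) auto
        also have "\<dots> \<le> (p ^ 3)\<^sup>2 * (4 * D)"
        proof -
          have "4 * D = 3 * y\<^sup>2 + (y - 2)\<^sup>2" by (simp add: D_def power2_eq_square algebra_simps)
          then show ?thesis by (intro mult_left_mono) auto
        qed
        finally show ?thesis by (simp add: algebra_simps flip: power_mult)
      qed
      finally have "(3 * ((p - 1) * c) * q)\<^sup>2 < (2 * p ^ 3)\<^sup>2"
        using D by (simp add: power_mult_distrib flip: power_mult)
      then show ?thesis unfolding q_def by (rule power_less_imp_less_base) (use pos in simp)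
    qed
    then have d: "(p * y - 1) dvd l" by (rule dvd)
    show False
    proof (cases "y = 1")
      case True
      then have s: "s = p" "t = 1 + p" using p_eq t_eq by (simp_all add: D_def)
      obtain w where "l = (p - 1) * w" using d True by auto
      then have "(p - 1) * (3 * w) = (p - 1) * (1 + p)" using t s by simp
      then have w: "3 * w = 1 + p" using p by simp
      \<comment> \<open>Since p is -1 modulo 3, the right hand side is 1 modulo 3.\<close>
      have "3 * c\<^sup>2 = 1 + p + p\<^sup>2" using ps s by (simp add: power2_eq_square)
      moreover have "p = 3 * w - 1" using w by simp
      ultimately have "3 * c\<^sup>2 = 3 * (w + 3 * w\<^sup>2 - 2 * w) + 1"
        by (simp add: power2_eq_square algebra_simps)
      then show False by presburger
    next
      case False
      then have y2: "y \<ge> 2" using y by simp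
      \<comment> \<open>Reduction of (p - 1) t modulo p y - 1 leaves p + s - 1 - y s, which will be
        shown to lie strictly between 0 and p y - 1.\<close>
      have "(p * y - 1) dvd (p - 1) * t" using d t by (metis dvd_mult)
      also have "(p - 1) * t = s * (p * y - 1) + (p + s - 1 - y * s)"
        by (simp add: t_eq algebra_simps)
      finally have dvd: "(p * y - 1) dvd p + s - 1 - y * s" by (simp add: dvd_add_right_iff)
      have s_pos: "s > 0"
      proof (rule ccontr)
        assume "\<not> s > 0"
        moreover have "s \<ge> 0"
        proof (rule ccontr)
          assume "\<not> s \<ge> 0"
          then have "y * s \<le> y * (- 1)" using y by (intro mult_left_mono) auto
          then show False using t_eq t_pos y2 by simp
        qed
        ultimately have "s = 0" by simp
        then have "3 * c\<^sup>2 = 1" using ps t_eq by simp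
        then show False by presburger
      qed
      have rem: "p + s - 1 - y * s = y - 2 + s * ((y - 1)\<^sup>2 + 1)"
        by (simp add: p_eq D_def algebra_simps power2_eq_square)
      have "s * ((y - 1)\<^sup>2 + 1) > 0" using s_pos by (simp add: add_nonneg_pos)
      then have pos: "p + s - 1 - y * s > 0" unfolding rem using y2 by linarith
      have "(p - 1) * (y - 1) > 0" "s * (y - 1) > 0" using p y2 s_pos by simp_all
      then have "p + s - 1 - y * s < p * y - 1" using y2 by (simp add: algebra_simps)
      with dvd pos show False by (simp add: zdvd_not_zless)
    qed
  qed
qed

lemma coprime_of_dvd_pred:
  fixes a b :: int
  assumes "b dvd a - 1"
  shows "coprime b a"
proof (rule coprimeI)
  fix d assume "d dvd b" "d dvd a"
  then have "d dvd a - (a - 1)" using assms by (blast intro: dvd_diff dvd_trans)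
  then show "is_unit d" by simp
qed

text \<open>Here k = p c, and p^2 l is the number of representations in the SEDF. With A = gcd(p -
  1, c) and p - 1 = A B, the factor B divides c - 1, so it is prime to c and divides m - 1 = B e.
  Also A divides 3 l = A t. The bound m l < p gives e t < 4, and only e = t = 1 survives parity and
  size.\<close>

lemma parameters_divisible_case:
  fixes p m c l :: int
  assumes m: "m \<ge> 3" and c: "c \<ge> 1" and l: "l \<ge> 1"
    and eq: "c\<^sup>2 * (m - 1) = l * (p ^ 3 - 1)" and ml: "m * l < p" and dvd: "(p - 1) dvd c * (c - 1)"
  shows "3 * l * (m - 1) = p - 1 \<and> (\<exists>n>0. c = 3 * l * n \<and> 3 * n\<^sup>2 = p\<^sup>2 + p + 1)"
proof -
  have p: "p > 3"
  proof -
    have "3 * 1 \<le> m * l" using m l by (intro mult_mono) auto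
    then show ?thesis using ml by simp
  qed
  define n where "n = p\<^sup>2 + p + 1"
  have n_odd: "odd n" by (simp add: n_def)
  have n_eq: "n = (p - 1) * (p + 2) + 3" by (simp add: n_def algebra_simps power2_eq_square)
  have p3: "p ^ 3 - 1 = (p - 1) * n"
    by (simp add: n_def algebra_simps power2_eq_square power3_eq_cube)
  define A where "A = gcd (p - 1) c"
  have A: "A > 0" using p by (simp add: A_def)
  obtain B where B: "p - 1 = A * B" unfolding A_def by (meson dvdE gcd_dvd1)
  obtain d where d: "c = A * d" unfolding A_def by (meson dvdE gcd_dvd2)
  have B_pos: "B > 0" using B A p by (metis diff_gt_0_iff_gt less_trans one_less_numeral_iff semiring_norm(77) zero_less_mult_pos)
  have d_pos: "d > 0" using d A c by (metis less_le_trans zero_less_mult_pos zero_less_one)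
  have "coprime B d"
  proof -
    have "A * gcd B d = gcd (A * B) (A * d)" using A gcd_mult_distrib_int[of A B d] by simp
    also have "\<dots> = A" unfolding B[symmetric] d[symmetric] by (simp add: A_def)
    finally have "gcd B d = 1" using A by simp
    then show ?thesis by (simp add: coprime_iff_gcd_eq_1)
  qed
  moreover have "A * B dvd A * (d * (c - 1))" using dvd B d by (simp add: mult.assoc)
  then have "B dvd d * (c - 1)" using A by simp
  ultimately have "B dvd c - 1" by (simp add: coprime_dvd_mult_right_iff)
  then have "coprime B c" by (rule coprime_of_dvd_pred)
  moreover have "B dvd c\<^sup>2 * (m - 1)" unfolding eq p3 B by simp
  ultimately have "B dvd m - 1" by (simp add: coprime_dvd_mult_right_iff)
  then obtain e where e: "m - 1 = B * e" by (auto elim: dvdE)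
  have e_pos: "e > 0" using e B_pos m by (metis diff_gt_0_iff_gt less_le_trans one_less_numeral_iff semiring_norm(77) zero_less_mult_pos)
  have "(A * B) * (A * d\<^sup>2 * e) = (A * B) * (l * n)"
    using eq unfolding p3 e d B by (simp add: power2_eq_square algebra_simps)
  then have main: "A * d\<^sup>2 * e = l * n" using A B_pos by simp
  \<comment> \<open>\<open>n\<close> is 3 modulo p - 1, hence modulo \<open>A\<close>.\<close>
  have "A dvd l * n" using main by (metis dvd_triv_left mult.assoc)
  then have "A dvd A * (B * (p + 2) * l) + 3 * l" by (simp add: n_eq B algebra_simps)
  then have "A dvd 3 * l" by (meson dvd_add_right_iff dvd_triv_left)
  then obtain t where t: "3 * l = A * t" by (auto elim: dvdE)
  have t_pos: "t > 0" using t A l by (metis less_le_trans mult_pos_pos zero_less_mult_pos zero_less_numeral zero_less_one)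
  have "A * (3 * (d\<^sup>2 * e)) = A * (t * n)" using main t by (metis (no_types, lifting) mult.assoc mult.left_commute)
  then have main': "3 * (d\<^sup>2 * e) = t * n" using A by simp
  have bound: "(p - 1) * (e * t) + A * t < 3 * p"
  proof -
    have "3 * (m * l) = (B * e + 1) * (A * t)" using e t by (simp add: algebra_simps)
    also have "\<dots> = (p - 1) * (e * t) + A * t" by (simp add: B algebra_simps)
    finally show ?thesis using ml by simp
  qed
  have et: "e * t < 4"
  proof (rule ccontr)
    assume "\<not> e * t < 4"
    then have "(p - 1) * 4 \<le> (p - 1) * (e * t)" using p by (intro mult_left_mono) auto
    moreover have "A * t > 0" using A t_pos by simp
    ultimately show False using bound p by simp
  qed
  have e_le: "e \<le> e * t" and t_le: "t \<le> e * t"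
    using e_pos t_pos by simp_all
  have "t = 1 \<and> e = 1 \<and> 3 dvd A"
  proof -
    consider "e = 1" "t = 1" | "e = 2" "t = 1" | "e = 1" "t = 2" | "e = 3" "t = 1" | "e = 1" "t = 3"
    proof -
      have "e < 4" "t < 4" using e_le t_le et by linarith+
      then have "e \<in> {1, 2, 3}" "t \<in> {1, 2, 3}" using e_pos t_pos by auto
      with et show thesis using that by auto
    qed
    then show ?thesis
    proof cases
      case 1
      then show ?thesis using t by (metis dvd_triv_left mult.right_neutral)
    next
      case 2
      then have "2 * (3 * d\<^sup>2) = n" using main' by simp
      then show ?thesis using n_odd by (metis dvd_triv_left)
    next
      case 3
      then have eq: "3 * d\<^sup>2 = 2 * n" using main' by simp
      then have "even (3 * d\<^sup>2)" by simp
      then have "even d" by simp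
      then obtain d' where "d = 2 * d'" by auto
      then have "n = 2 * (3 * d'\<^sup>2)" using eq by (simp add: power2_eq_square)
      then show ?thesis using n_odd by simp
    next
      case 4
      then have "A < 3" using bound by simp
      moreover have "3 dvd A" using 4 t by (metis dvd_triv_left mult.right_neutral)
      ultimately show ?thesis using A by (simp add: zdvd_not_zless)
    next
      case 5
      then have "3 * A < 3" using bound by simp
      then show ?thesis using A by simp
    qed
  qed
  then have te: "t = 1" "e = 1" by auto
  have "3 * l * (m - 1) = p - 1" using t e B te by simp
  moreover have "c = 3 * l * d" "3 * d\<^sup>2 = p\<^sup>2 + p + 1" using t d te main' by (simp_all add: n_def)
  ultimately show ?thesis using d_pos by blast
qed

text \<open>If p - 1 divided k, then m - 1 would divide n and so 3 n^2, which is 3 modulo p - 1 and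
  modulo m - 1; but m - 1 exceeds 3. Further, p is 1 modulo 3 by \<open>eq\<close>, and if p were 3
  modulo 4, then 3 n^2 would be 1 modulo 4.\<close>

lemma parameters_conclusions:
  fixes p m l n :: int
  assumes p: "p > 3" and m: "m \<ge> 5" and l: "l \<ge> 1" and prime: "prime p"
    and eq: "3 * l * (m - 1) = p - 1" and n: "3 * n\<^sup>2 = p\<^sup>2 + p + 1"
  shows "\<not> (p - 1) dvd p * (3 * l * n)" and "p mod 12 = 1"
proof -
  have n_eq: "3 * n\<^sup>2 = (p - 1) * (p + 2) + 3" unfolding n by (simp add: algebra_simps power2_eq_square)
  show "\<not> (p - 1) dvd p * (3 * l * n)"
  proof
    assume "(p - 1) dvd p * (3 * l * n)"
    then have "(3 * l) * (m - 1) dvd (3 * l) * (p * n)" by (simp add: eq mult.left_commute)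
    then have "(m - 1) dvd p * n" using l by (subst (asm) dvd_mult_cancel_left) auto
    moreover have m_dvd: "(m - 1) dvd p - 1" using eq by (metis dvd_triv_right)
    then have "coprime (m - 1) p" by (intro coprime_of_dvd_pred)
    ultimately have "(m - 1) dvd n" by (simp add: coprime_dvd_mult_right_iff)
    then have "(m - 1) dvd 3 * n\<^sup>2" by (simp add: power2_eq_square)
    then have "(m - 1) dvd (p - 1) * (p + 2) + 3" unfolding n_eq .
    then have "(m - 1) dvd 3" using m_dvd by (meson dvd_add_right_iff dvd_mult2)
    then have "m - 1 \<le> 3" by (rule zdvd_imp_le) simp
    then show False using m by simp
  qed
  have p3: "p mod 3 = 1"
  proof -
    have "p = 1 + 3 * (l * (m - 1))" using eq by simp
    then show ?thesis by presburger
  qed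
  have "odd p" using prime p by (simp add: prime_odd_int)
  moreover have "p mod 4 \<noteq> 3"
  proof
    assume "p mod 4 = 3"
    then obtain q where "p = 4 * q + 3" by (metis mult_div_mod_eq)
    then have "p\<^sup>2 + p + 1 = 4 * (4 * q\<^sup>2 + 7 * q + 3) + 1"
      by (simp add: algebra_simps power2_eq_square)
    moreover have "(4 * x + 1) mod 4 = 1" for x :: int by presburger
    ultimately have "(3 * n\<^sup>2) mod 4 = 1" unfolding n by (simp only:)
    then have "3 * (n\<^sup>2 mod 4) mod 4 = 1" by (simp only: mod_mult_right_eq)
    moreover have "n\<^sup>2 mod 4 = 0 \<or> n\<^sup>2 mod 4 = 1"
    proof (cases "even n")
      case True
      then obtain r where "n = 2 * r" by auto
      then show ?thesis by (simp add: power2_eq_square)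
    next
      case False
      then obtain r where "n = 2 * r + 1" by (auto elim: oddE)
      then have "n\<^sup>2 = 1 + 4 * (r\<^sup>2 + r)" by (simp add: power2_eq_square algebra_simps)
      moreover have "(1 + 4 * x) mod 4 = 1" for x :: int by presburger
      ultimately have "n\<^sup>2 mod 4 = 1" by (simp only:)
      then show ?thesis by blast
    qed
    ultimately show False by auto
  qed
  ultimately have "p mod 4 = 1" by presburger
  then obtain a where "p = 1 + 4 * a" by (metis mult_div_mod_eq add.commute)
  moreover obtain b where "p = 1 + 3 * b" using p3 by (metis mult_div_mod_eq add.commute)
  ultimately have "p = 1 + 12 * (b - a)" by simp
  then show "p mod 12 = 1" by presburger
qed

text \<open>This is the smallness condition of \<open>ex_extremal_char\<close>. Squaring allows n to
  be eliminated.\<close>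

lemma parameters_bound:
  fixes p m l n :: int
  assumes p: "p > 3" and n: "n > 0"
    and eq: "3 * l * (m - 1) = p - 1" and n2: "3 * n\<^sup>2 = p\<^sup>2 + p + 1"
  shows "3 * (p * (3 * l * n)) * (m - 1) < 2 * p ^ 3"
proof -
  have "(3 * (p - 1) * n)\<^sup>2 = 3 * (p - 1)\<^sup>2 * (3 * n\<^sup>2)"
    by (simp only: power_mult_distrib) simp
  also have "\<dots> = 3 * (p ^ 3 - 1) * (p - 1)"
    unfolding n2 by (simp add: algebra_simps power2_eq_square power3_eq_cube)
  also have "\<dots> < 4 * p ^ 3 * p" using p by (intro mult_strict_mono) auto
  also have "\<dots> = (2 * p\<^sup>2)\<^sup>2" by (simp add: power2_eq_square power3_eq_cube)
  finally have "3 * (p - 1) * n < 2 * p\<^sup>2" by (rule power_less_imp_less_base) simp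
  then have "p * (3 * (p - 1) * n) < p * (2 * p\<^sup>2)" using p by (intro mult_strict_left_mono) auto
  then show ?thesis by (simp add: algebra_simps power2_eq_square power3_eq_cube flip: eq)
qed

section \<open>Character values of an SEDF\<close>

text \<open>With T the total, the ratio z = X i / T satisfies z - |z|^2 = -l / |T|^2. So z is real
  and equals one of the roots \<open>\<rho>\<close> and 1 - \<open>\<rho>\<close> of a quadratic.
  The ratios add up to 1, which expresses \<open>\<rho>\<close> rationally by the multiplicities of
  the roots.\<close>

lemma two_valued_ratios:
  fixes X :: "'i \<Rightarrow> complex" and l :: real
  assumes fin: "finite I" and card: "card I \<ge> 3" and l: "l > 0"
    and eq: "\<And>i. i \<in> I \<Longrightarrow> X i * cnj ((\<Sum>j\<in>I. X j) - X i) = - of_real l"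
    and T0: "(\<Sum>j\<in>I. X j) \<noteq> 0"
  shows "\<exists>A B. A \<union> B = I \<and> A \<inter> B = {} \<and> card A \<ge> 2 \<and> card B > card A \<and>
    (\<forall>i\<in>A. X i = of_real ((real (card B) - 1) / (real (card B) - real (card A))) * (\<Sum>j\<in>I. X j)) \<and>
    (\<forall>i\<in>B. X i = of_real (- ((real (card A) - 1) / (real (card B) - real (card A)))) * (\<Sum>j\<in>I. X j)) \<and>
    (norm (\<Sum>j\<in>I. X j))\<^sup>2 * ((real (card A) - 1) * (real (card B) - 1)) = l * (real (card B) - real (card A))\<^sup>2"
proof -
  define T where "T = (\<Sum>j\<in>I. X j)"
  define n where "n = (norm T)\<^sup>2"
  have n: "n > 0" using T0 by (simp add: n_def T_def)
  have n_eq: "of_real n = T * cnj T" unfolding n_def by (rule complex_norm_square)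
  define \<delta> where "\<delta> = sqrt (1 / 4 + l / n)"
  have \<delta>2: "\<delta>\<^sup>2 = 1 / 4 + l / n" using l n by (simp add: \<delta>_def add_nonneg_nonneg)
  have \<delta>: "\<delta> > 1 / 2"
  proof (rule power_less_imp_less_base)
    show "(1 / 2)\<^sup>2 < \<delta>\<^sup>2" unfolding \<delta>2 using l n by (simp add: power2_eq_square)
    show "0 \<le> \<delta>" using l n by (simp add: \<delta>_def)
  qed
  define \<rho> where "\<rho> = 1 / 2 + \<delta>"
  have \<rho>: "\<rho> > 1" using \<delta> by (simp add: \<rho>_def)
  have two: "X i = of_real \<rho> * T \<or> X i = of_real (1 - \<rho>) * T" if "i \<in> I" for i
  proof -
    define z where "z = X i / T"
    have T: "T \<noteq> 0" using T0 by (simp add: T_def)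
    have z: "X i = z * T" using T by (simp add: z_def)
    have "z * of_real n - z * cnj z * of_real n = - of_real l"
      using eq[OF that] unfolding T_def[symmetric] z n_eq by (simp add: algebra_simps)
    then have "z * of_real n - of_real ((norm z)\<^sup>2) * of_real n = - of_real l"
      by (simp only: complex_norm_square)
    then have "(z - of_real ((norm z)\<^sup>2 - l / n)) * of_real n = 0"
      using n by (simp add: algebra_simps)
    then have z_eq: "z = of_real ((norm z)\<^sup>2 - l / n)" using n by simp
    define r where "r = (norm z)\<^sup>2 - l / n"
    have zr: "z = of_real r" using z_eq by (simp only: r_def)
    then have "(norm z)\<^sup>2 = r\<^sup>2" by simp
    then have "r = r\<^sup>2 - l / n" using r_def by simp
    then have "(r - 1 / 2)\<^sup>2 = \<delta>\<^sup>2" unfolding \<delta>2 by (simp add: power2_eq_square algebra_simps)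
    then have "r - 1 / 2 = \<delta> \<or> r - 1 / 2 = - \<delta>" by (simp add: power2_eq_iff)
    then have "r = \<rho> \<or> r = 1 - \<rho>" by (auto simp: \<rho>_def)
    then show ?thesis using z zr by auto
  qed
  define A where "A = {i\<in>I. X i = of_real \<rho> * T}"
  have A: "A \<subseteq> I" by (auto simp: A_def)
  define a b where "a = real (card A)" and "b = real (card (I - A))"
  have ab: "a + b = card I"
    using A fin by (simp add: a_def b_def card_Diff_subset finite_subset card_mono of_nat_diff)
  have "T = (\<Sum>i\<in>A. X i) + (\<Sum>i\<in>I - A. X i)"
    unfolding T_def using A fin by (simp add: sum.subset_diff add.commute)
  also have "(\<Sum>i\<in>A. X i) = (\<Sum>i\<in>A. of_real \<rho> * T)" by (intro sum.cong) (auto simp: A_def)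
  also have "(\<Sum>i\<in>I - A. X i) = (\<Sum>i\<in>I - A. of_real (1 - \<rho>) * T)"
    using two by (intro sum.cong) (auto simp: A_def)
  finally have "T = of_real (a * \<rho> + b * (1 - \<rho>)) * T" by (simp add: a_def b_def algebra_simps)
  then have "of_real (a * \<rho> + b * (1 - \<rho>)) = (1::complex)" using T0 by (simp add: T_def)
  then have "a * \<rho> + b * (1 - \<rho>) = 1" by (simp only: of_real_eq_1_iff)
  then have rel: "(a - 1) * \<rho> = (b - 1) * (\<rho> - 1)" by (simp add: algebra_simps)
  \<comment> \<open>If the root \<open>\<rho>\<close> did not occur, all ratios would be negative;
    if it occurred once, so would the other root, against at least three indices.\<close>
  have a_ge2: "card A \<ge> 2"
  proof (rule ccontr)
    assume "\<not> card A \<ge> 2"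
    then consider "card A = 0" | "card A = 1" by linarith
    then show False
    proof cases
      case 1
      then have "a = 0" "b \<ge> 3" using ab card by (simp_all add: a_def)
      then have "(b - 1) * (\<rho> - 1) \<ge> 0" "- \<rho> = (b - 1) * (\<rho> - 1)" using rel \<rho> by simp_all
      then show False using \<rho> by simp
    next
      case 2
      then have "a = 1" by (simp add: a_def)
      then have "b = 1" using rel \<rho> by simp
      then show False using \<open>a = 1\<close> ab card by simp
    qed
  qed
  have "(a - 1) * \<rho> > (a - 1) * (\<rho> - 1)" using a_ge2 by (simp add: a_def)
  then have "(a - 1) * (\<rho> - 1) < (b - 1) * (\<rho> - 1)" using rel by simp
  then have ba: "a < b" using \<rho> by simp
  have \<rho>_eq: "\<rho> = (b - 1) / (b - a)" using rel ba by (simp add: field_simps)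
  then have \<rho>1: "1 - \<rho> = - ((a - 1) / (b - a))" using ba by (simp add: field_simps)
  have "\<rho> * (\<rho> - 1) = l / n"
    using \<delta>2 by (simp add: \<rho>_def power2_eq_square algebra_simps)
  then have "n * (\<rho> * (\<rho> - 1)) = l" using n by simp
  moreover have "\<rho> - 1 = (a - 1) / (b - a)" using \<rho>1 by simp
  ultimately have "n * ((b - 1) / (b - a) * ((a - 1) / (b - a))) = l" by (simp add: \<rho>_eq)
  then have "n * ((a - 1) * (b - 1)) / (b - a)\<^sup>2 = l"
    by (simp add: power2_eq_square mult.commute)
  then have norm_eq: "n * ((a - 1) * (b - 1)) = l * (b - a)\<^sup>2"
    using ba by (simp add: divide_eq_eq)
  show ?thesis
  proof (rule exI[of _ A], rule exI[of _ "I - A"], intro conjI ballI)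
    show "A \<union> (I - A) = I" "A \<inter> (I - A) = {}" "card A \<ge> 2" using A a_ge2 by auto
    show "card (I - A) > card A" using ba by (simp add: a_def b_def)
    show "X i = of_real ((real (card (I - A)) - 1) / (real (card (I - A)) - real (card A))) * (\<Sum>j\<in>I. X j)"
      if "i \<in> A" for i
      using that unfolding a_def[symmetric] b_def[symmetric] \<rho>_eq[symmetric] T_def[symmetric] by (simp add: A_def)
    show "X i = of_real (- ((real (card A) - 1) / (real (card (I - A)) - real (card A)))) * (\<Sum>j\<in>I. X j)"
      if "i \<in> I - A" for i
      using that two unfolding a_def[symmetric] b_def[symmetric] \<rho>1[symmetric] T_def[symmetric] by (auto simp: A_def)
    show "(norm (\<Sum>j\<in>I. X j))\<^sup>2 * ((real (card A) - 1) * (real (card (I - A)) - 1))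
        = l * (real (card (I - A)) - real (card A))\<^sup>2"
      using norm_eq unfolding n_def T_def a_def b_def .
  qed
qed

locale sedf = finite_abelian_p_group G p s for G (structure) and p s +
  fixes m k l :: nat and D :: "nat \<Rightarrow> 'a set"
  assumes SEDF: "SEDF G (p ^ Suc s) m k l D" and m_ge: "m \<ge> 3" and k_ge: "k \<ge> 2"
begin

definition U :: "'a set" where "U = (\<Union>i\<in>{1..m}. D i)"

abbreviation X :: "('a \<Rightarrow> complex) \<Rightarrow> nat \<Rightarrow> complex" where "X \<chi> i \<equiv> char_sum \<chi> (D i)"
abbreviation T :: "('a \<Rightarrow> complex) \<Rightarrow> complex" where "T \<chi> \<equiv> char_sum \<chi> U"

lemma l_pos: "l \<ge> 1"
  and D_subset: "i \<in> {1..m} \<Longrightarrow> D i \<subseteq> carrier G"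
  and card_D: "i \<in> {1..m} \<Longrightarrow> card (D i) = k"
  and disjoint_D: "disjoint_family_on D {1..m}"
  and difference_count: "j \<in> {1..m} \<Longrightarrow> g \<in> carrier G - {\<one>} \<Longrightarrow>
    card {(x, y). x \<in> D j \<and> y \<in> (\<Union>i\<in>{1..m} - {j}. D i) \<and> x \<otimes> inv y = g} = l"
  using SEDF by (auto simp: SEDF_def)

lemma finite_D: "i \<in> {1..m} \<Longrightarrow> finite (D i)"
  using D_subset finite_carrier finite_subset by blast

lemma U_subset: "U \<subseteq> carrier G"
  unfolding U_def using D_subset by blast

lemma T_eq: "T \<chi> = (\<Sum>i\<in>{1..m}. X \<chi> i)"
  unfolding U_def char_sum_def
  using disjoint_D finite_D by (intro sum.UNION_disjoint) (auto simp: disjoint_family_on_def)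

lemma card_U: "card U = m * k"
proof -
  have "card U = (\<Sum>i\<in>{1..m}. card (D i))"
    unfolding U_def using disjoint_D finite_D
    by (intro card_UN_disjoint) (auto simp: disjoint_family_on_def)
  then show ?thesis using card_D by simp
qed

lemma mk_le: "m * k \<le> p ^ Suc s"
  using card_mono[OF finite_carrier U_subset] order_G by (simp add: card_U Coset.order_def)

text \<open>Expanding the product counts the quotients of x by y weighted by \<open>\<chi>\<close>.
  The identity does not occur, by disjointness, and every other element occurs \<open>l\<close>
  times. With the sum over the group kept explicit, the trivial character is covered as
  well.\<close>

lemma char_equation:
  assumes \<chi>: "\<chi> \<in> chars" and j: "j \<in> {1..m}"
  shows "X \<chi> j * cnj (T \<chi> - X \<chi> j) = of_nat l * ((\<Sum>g\<in>carrier G. \<chi> g) - 1)"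
proof -
  define V where "V = (\<Union>i\<in>{1..m} - {j}. D i)"
  have V: "V \<subseteq> carrier G" unfolding V_def using D_subset by blast
  have finV: "finite V" using V finite_carrier finite_subset by blast
  have "T \<chi> = X \<chi> j + (\<Sum>i\<in>{1..m} - {j}. X \<chi> i)"
    unfolding T_eq using j by (simp add: sum.remove)
  moreover have "char_sum \<chi> V = (\<Sum>i\<in>{1..m} - {j}. X \<chi> i)"
    unfolding V_def char_sum_def using disjoint_D finite_D
    by (intro sum.UNION_disjoint) (auto simp: disjoint_family_on_def)
  ultimately have "T \<chi> - X \<chi> j = char_sum \<chi> V" by simp
  then have "X \<chi> j * cnj (T \<chi> - X \<chi> j) = (\<Sum>x\<in>D j. \<Sum>y\<in>V. \<chi> x * cnj (\<chi> y))"
    by (simp only: cnj_char_sum) (simp add: char_sum_def sum_product)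
  also have "\<dots> = (\<Sum>x\<in>D j. \<Sum>y\<in>V. \<chi> (x \<otimes> inv y))"
  proof (intro sum.cong[OF refl])
    fix x y assume "x \<in> D j" "y \<in> V"
    then have "x \<in> carrier G" "y \<in> carrier G" using D_subset[OF j] V by auto
    then show "\<chi> x * cnj (\<chi> y) = \<chi> (x \<otimes> inv y)" using \<chi> by (simp add: char_mult char_inv)
  qed
  also have "\<dots> = (\<Sum>(x, y)\<in>D j \<times> V. \<chi> (x \<otimes> inv y))" by (simp add: sum.cartesian_product)
  also have "\<dots> = (\<Sum>g\<in>carrier G. \<Sum>z\<in>{z \<in> D j \<times> V. fst z \<otimes> inv (snd z) = g}. case z of (x, y) \<Rightarrow> \<chi> (x \<otimes> inv y))"
    using finite_D[OF j] finV finite_carrier D_subset[OF j] V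
    by (intro sum.group[symmetric]) (auto intro!: m_closed inv_closed)
  also have "\<dots> = (\<Sum>g\<in>carrier G. of_nat (card {z \<in> D j \<times> V. fst z \<otimes> inv (snd z) = g}) * \<chi> g)"
  proof (rule sum.cong[OF refl])
    fix g
    have "(\<Sum>z\<in>{z \<in> D j \<times> V. fst z \<otimes> inv (snd z) = g}. case z of (x, y) \<Rightarrow> \<chi> (x \<otimes> inv y))
        = (\<Sum>z\<in>{z \<in> D j \<times> V. fst z \<otimes> inv (snd z) = g}. \<chi> g)"
      by (intro sum.cong refl) auto
    then show "(\<Sum>z\<in>{z \<in> D j \<times> V. fst z \<otimes> inv (snd z) = g}. case z of (x, y) \<Rightarrow> \<chi> (x \<otimes> inv y))
        = of_nat (card {z \<in> D j \<times> V. fst z \<otimes> inv (snd z) = g}) * \<chi> g" by simp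
  qed
  also have "\<dots> = (\<Sum>g\<in>carrier G. (if g = \<one> then 0 else of_nat l * \<chi> g))"
  proof (rule sum.cong[OF refl])
    fix g assume g: "g \<in> carrier G"
    have set: "{z \<in> D j \<times> V. fst z \<otimes> inv (snd z) = g}
        = {(x, y). x \<in> D j \<and> y \<in> (\<Union>i\<in>{1..m} - {j}. D i) \<and> x \<otimes> inv y = g}"
      by (auto simp: V_def)
    show "of_nat (card {z \<in> D j \<times> V. fst z \<otimes> inv (snd z) = g}) * \<chi> g = (if g = \<one> then 0 else of_nat l * \<chi> g)"
    proof (cases "g = \<one>")
      case True
      have "x \<otimes> inv y \<noteq> \<one>" if xy: "x \<in> D j" "y \<in> V" for x y
      proof
        assume e: "x \<otimes> inv y = \<one>"
        have "x \<in> carrier G" "y \<in> carrier G" using xy D_subset[OF j] V by auto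
        then have "x = y" using e by (metis inv_closed inv_equality inv_inv)
        moreover obtain i where "i \<in> {1..m} - {j}" "y \<in> D i" using xy(2) unfolding V_def by blast
        moreover have "D i \<inter> D j = {}"
          using disjoint_D j \<open>i \<in> {1..m} - {j}\<close> by (intro disjoint_family_onD) auto
        ultimately show False using xy by blast
      qed
      then have "{z \<in> D j \<times> V. fst z \<otimes> inv (snd z) = g} = {}" using True by auto
      then show ?thesis using True by (simp only: card.empty) simp
    next
      case False
      then show ?thesis using difference_count[OF j, of g] g unfolding set by simp
    qed
  qed
  also have "\<dots> = (\<Sum>g\<in>carrier G - {\<one>}. of_nat l * \<chi> g)"
    using finite_carrier by (simp add: sum.If_cases Int_def Diff_eq Compl_eq conj_commute)
  also have "\<dots> = of_nat l * ((\<Sum>g\<in>carrier G. \<chi> g) - 1)"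
    using finite_carrier \<chi> by (simp add: sum_distrib_left[symmetric] sum_diff1)
  finally show ?thesis .
qed

lemma char_equation_nontrivial:
  assumes "\<chi> \<in> chars" "\<chi> \<noteq> trivial_char" "j \<in> {1..m}"
  shows "X \<chi> j * cnj (T \<chi> - X \<chi> j) = - of_nat l"
  using char_equation[OF assms(1,3)] sum_char_group[OF assms(1,2)] by simp

lemma char_sum_trivial: "A \<subseteq> carrier G \<Longrightarrow> char_sum trivial_char A = of_nat (card A)"
  by (auto simp: char_sum_def trivial_char_def subset_eq intro!: trans[OF sum.cong sum_constant])

text \<open>The trivial character turns \<open>char_equation\<close> into a count of pairs.\<close>

lemma count_equation: "(int k)\<^sup>2 * (int m - 1) = int l * (int p ^ Suc s - 1)"
proof -
  have 1: "1 \<in> {1..m}" using m_ge by simp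
  have "of_nat k * cnj (of_nat (m * k) - of_nat k) = of_nat l * (of_nat (p ^ Suc s) - (1 :: complex))"
    using char_equation[OF trivial_char 1] order_G
    unfolding char_sum_trivial[OF D_subset[OF 1]] char_sum_trivial[OF U_subset] card_U card_D[OF 1]
      char_sum_trivial[OF subset_refl, unfolded char_sum_def] Coset.order_def by simp
  then have "of_int (int k * (int m * int k - int k)) = (of_int (int l * (int p ^ Suc s - 1)) :: complex)"
    by simp
  then have "int k * (int m * int k - int k) = int l * (int p ^ Suc s - 1)"
    by (simp only: of_int_eq_iff)
  then show ?thesis by (simp add: power2_eq_square algebra_simps)
qed

text \<open>With v the group order, m k <= v turns the count into l (v - 1) <= k (v - k) < k (v -
  1).\<close>

lemma l_less_k: "l < k"
proof -
  have N: "int p ^ Suc s > 1" using zeta.p_ge_2 by (intro one_less_power) auto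
  have "int m * int k \<le> int p ^ Suc s"
    using mk_le by (metis of_nat_le_iff of_nat_mult of_nat_power)
  then have "int k * (int m * int k) \<le> int k * int p ^ Suc s" by (intro mult_left_mono) auto
  then have "int l * (int p ^ Suc s - 1) \<le> int k * (int p ^ Suc s - int k)"
    using count_equation by (simp add: algebra_simps power2_eq_square)
  also have "\<dots> < int k * (int p ^ Suc s - 1)" using k_ge by simp
  finally show ?thesis using N by (simp add: mult_less_cancel_right_disj)
qed

lemma type_zero:
  assumes "\<chi> \<in> chars" "\<chi> \<noteq> trivial_char" "T \<chi> = 0" "i \<in> {1..m}"
  shows "X \<chi> i * cnj (X \<chi> i) = of_nat l"
  using char_equation_nontrivial[OF assms(1,2,4)] assms(3) by simp

text \<open>
  The ratio with numerator \<open>q'\<close> occurs \<open>h q + 1\<close> times and the other one \<open>h q' + 1\<close> times;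
  the minimum \<open>a\<^sub>\<chi>\<close> is \<open>q\<^sup>2 w = l q / q'\<close>.
\<close>
definition nonzero_type :: "('a \<Rightarrow> complex) \<Rightarrow> nat \<Rightarrow> nat \<Rightarrow> nat \<Rightarrow> nat \<Rightarrow> bool"
  where "nonzero_type \<chi> q q' h w \<longleftrightarrow> 0 < q \<and> q < q' \<and> coprime q q' \<and> 0 < h \<and> 0 < w \<and>
    l = q * q' * w \<and> m = 2 + h * (q + q') \<and>
    T \<chi> * cnj (T \<chi>) = of_nat ((q' - q)\<^sup>2 * w) \<and>
    (\<forall>i\<in>{1..m}. X \<chi> i = of_real (real q' / (real q' - real q)) * T \<chi> \<or>
      X \<chi> i = of_real (- (real q / (real q' - real q))) * T \<chi>) \<and>
    (\<exists>i\<in>{1..m}. X \<chi> i = of_real (real q' / (real q' - real q)) * T \<chi>) \<and>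
    (\<exists>i\<in>{1..m}. X \<chi> i = of_real (- (real q / (real q' - real q))) * T \<chi>)"

text \<open>The multiplicities of the two ratios, less one, are divided by their gcd
  \<open>h\<close>. The squared norms l q' / q and l q / q' are rational algebraic integers, so the
  coprime numbers \<open>q\<close> and \<open>q'\<close> both divide \<open>l\<close>.\<close>

lemma ex_nonzero_type:
  assumes \<chi>: "\<chi> \<in> chars" "\<chi> \<noteq> trivial_char" and T0: "T \<chi> \<noteq> 0"
  shows "\<exists>q q' h w. nonzero_type \<chi> q q' h w"
proof -
  have eq: "X \<chi> i * cnj ((\<Sum>j\<in>{1..m}. X \<chi> j) - X \<chi> i) = - of_real (real l)" if "i \<in> {1..m}" for i
    using char_equation_nontrivial[OF \<chi> that] by (simp add: T_eq)
  have l0: "real l > 0" using l_pos by simp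
  have c3: "card {1..m} \<ge> 3" using m_ge by simp
  have S0: "(\<Sum>j\<in>{1..m}. X \<chi> j) \<noteq> 0" using T0 by (simp add: T_eq)
  obtain A B where AB: "A \<union> B = {1..m}" "A \<inter> B = {}" "card A \<ge> 2" "card B > card A"
    and plus: "\<forall>i\<in>A. X \<chi> i = of_real ((real (card B) - 1) / (real (card B) - real (card A))) * T \<chi>"
    and minus: "\<forall>i\<in>B. X \<chi> i = of_real (- ((real (card A) - 1) / (real (card B) - real (card A)))) * T \<chi>"
    and norm: "(norm (T \<chi>))\<^sup>2 * ((real (card A) - 1) * (real (card B) - 1)) = l * (real (card B) - real (card A))\<^sup>2"
    using two_valued_ratios[OF finite_atLeastAtMost c3 l0 eq S0] unfolding T_eq by blast
  define a b where "a = card A - 1" and "b = card B - 1"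
  have ab: "0 < a" "a < b" using AB by (auto simp: a_def b_def)
  have cA: "card A = a + 1" "card B = b + 1" using AB by (auto simp: a_def b_def)
  have "finite A" "finite B" using AB(1) by (metis finite_Un finite_atLeastAtMost)+
  then have "card A + card B = m" using AB by (metis card_Un_disjoint card_atLeastAtMost diff_Suc_1)
  then have m_eq: "m = 2 + (a + b)" by (simp only: cA)
  define h where "h = gcd a b"
  have h: "h > 0" using ab by (simp add: h_def)
  obtain q q' where q: "a = h * q" "b = h * q'" and cop: "coprime q q'"
    unfolding h_def using ab by (metis gcd_coprime_exists gcd_eq_0_iff less_numeral_extra(3) mult.commute)
  have qq: "0 < q" "q < q'" using ab h by (auto simp: q)
  have r1: "real b / (real b - real a) = real q' / (real q' - real q)"
    using h qq by (simp add: q flip: right_diff_distrib)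
  have r2: "real a / (real b - real a) = real q / (real q' - real q)"
    using h qq by (simp add: q flip: right_diff_distrib)
  have plus': "X \<chi> i = of_real (real q' / (real q' - real q)) * T \<chi>" if "i \<in> A" for i
    using bspec[OF plus that] r1 by (simp add: cA)
  have minus': "X \<chi> i = of_real (- (real q / (real q' - real q))) * T \<chi>" if "i \<in> B" for i
    using bspec[OF minus that] r2 by (simp add: cA)
  have nT: "(norm (T \<chi>))\<^sup>2 * (real q * real q') = l * (real q' - real q)\<^sup>2"
  proof -
    have "(norm (T \<chi>))\<^sup>2 * (real a * real b) = l * (real b - real a)\<^sup>2"
      using norm by (simp add: cA)
    then have "(real h)\<^sup>2 * ((norm (T \<chi>))\<^sup>2 * (real q * real q')) = (real h)\<^sup>2 * (l * (real q' - real q)\<^sup>2)"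
      by (simp add: q power2_eq_square algebra_simps)
    then show ?thesis using h by simp
  qed
  have T_cnj: "T \<chi> * cnj (T \<chi>) = of_real ((norm (T \<chi>))\<^sup>2)" by (rule complex_norm_square[symmetric])
  have d0: "real q' - real q \<noteq> 0" "real q \<noteq> 0" "real q' \<noteq> 0" using qq by auto
  have nT': "(norm (T \<chi>))\<^sup>2 = l * (real q' - real q)\<^sup>2 / (real q * real q')"
    using nT d0 by (simp add: field_simps)
  have "card A > 0" "card B > 0" using AB by simp_all
  then obtain i j where i: "i \<in> A" and j: "j \<in> B" by (metis card_gt_0_iff ex_in_conv)
  have ij: "i \<in> {1..m}" "j \<in> {1..m}" using i j AB(1) by blast+
  have "of_int (int q) * (X \<chi> i * cnj (X \<chi> i)) = of_int (int (l * q'))"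
  proof -
    have "of_int (int q) * (X \<chi> i * cnj (X \<chi> i))
        = of_real (real q * (real q' / (real q' - real q))\<^sup>2) * (T \<chi> * cnj (T \<chi>))"
      using plus'[OF i] qq by (simp add: power2_eq_square of_nat_diff)
    also have "\<dots> = of_real (real q * (real q' / (real q' - real q))\<^sup>2 * (l * (real q' - real q)\<^sup>2 / (real q * real q')))"
      unfolding T_cnj nT' by simp
    also have "real q * (real q' / (real q' - real q))\<^sup>2 * (l * (real q' - real q)\<^sup>2 / (real q * real q')) = real (l * q')"
      using d0 by (simp add: power2_eq_square)
    finally show ?thesis by simp
  qed
  then have "int q dvd int (l * q')"
    using ij by (intro char_product_rational_imp_dvd[OF \<chi>(1) D_subset D_subset])
  then have q_dvd: "q dvd l" using cop by (metis coprime_dvd_mult_left_iff int_dvd_int_iff)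
  have "of_int (int q') * (X \<chi> j * cnj (X \<chi> j)) = of_int (int (l * q))"
  proof -
    have "of_int (int q') * (X \<chi> j * cnj (X \<chi> j))
        = of_real (real q' * (real q / (real q' - real q))\<^sup>2) * (T \<chi> * cnj (T \<chi>))"
      using minus'[OF j] qq by (simp add: power2_eq_square of_nat_diff)
    also have "\<dots> = of_real (real q' * (real q / (real q' - real q))\<^sup>2 * (l * (real q' - real q)\<^sup>2 / (real q * real q')))"
      unfolding T_cnj nT' by simp
    also have "real q' * (real q / (real q' - real q))\<^sup>2 * (l * (real q' - real q)\<^sup>2 / (real q * real q')) = real (l * q)"
      using d0 by (simp add: power2_eq_square)
    finally show ?thesis by simp
  qed
  then have "int q' dvd int (l * q)"
    using ij by (intro char_product_rational_imp_dvd[OF \<chi>(1) D_subset D_subset])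
  then have "q' dvd l" using cop by (metis coprime_commute coprime_dvd_mult_left_iff int_dvd_int_iff)
  then have "q * q' dvd l" using q_dvd cop by (simp add: divides_mult)
  then obtain w where w: "l = q * q' * w" by (auto elim: dvdE)
  have w0: "w > 0" using l_pos w by (cases w) auto
  have "T \<chi> * cnj (T \<chi>) = of_nat ((q' - q)\<^sup>2 * w)"
  proof -
    have "l * (real q' - real q)\<^sup>2 / (real q * real q') = real ((q' - q)\<^sup>2 * w)"
      using d0 qq by (simp add: w of_nat_diff)
    then show ?thesis unfolding T_cnj nT' by simp
  qed
  moreover have "m = 2 + h * (q + q')" by (simp add: m_eq q algebra_simps)
  moreover have "\<forall>i\<in>{1..m}. X \<chi> i = of_real (real q' / (real q' - real q)) * T \<chi> \<or>
      X \<chi> i = of_real (- (real q / (real q' - real q))) * T \<chi>"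
    using plus' minus' AB(1) by blast
  moreover have "\<exists>i\<in>{1..m}. X \<chi> i = of_real (real q' / (real q' - real q)) * T \<chi>"
    using plus' i ij by blast
  moreover have "\<exists>i\<in>{1..m}. X \<chi> i = of_real (- (real q / (real q' - real q))) * T \<chi>"
    using minus' j ij by blast
  ultimately have "nonzero_type \<chi> q q' h w"
    unfolding nonzero_type_def using qq cop h w0 w by blast
  then show ?thesis by blast
qed

lemma nonzero_type_products:
  assumes type: "nonzero_type \<chi> q q' h w" and ij: "i \<in> {1..m}" "j \<in> {1..m}"
  shows "X \<chi> i * cnj (X \<chi> j) \<in> {of_nat (q'\<^sup>2 * w), of_nat (q\<^sup>2 * w), - of_nat l}"
proof -
  have qq: "0 < q" "q < q'" and l: "l = q * q' * w"
    and T: "T \<chi> * cnj (T \<chi>) = of_real ((real q' - real q)\<^sup>2 * w)"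
    using type by (auto simp: nonzero_type_def of_nat_diff)
  have d: "real q' - real q \<noteq> 0" using qq by simp
  have prod: "(of_real x * T \<chi>) * cnj (of_real y * T \<chi>) = of_real (x * y * ((real q' - real q)\<^sup>2 * w))" for x y
  proof -
    have "(of_real x * T \<chi>) * cnj (of_real y * T \<chi>) = of_real (x * y) * (T \<chi> * cnj (T \<chi>))" by simp
    then show ?thesis unfolding T by simp
  qed
  define u v where "u = real q' / (real q' - real q)" and "v = - (real q / (real q' - real q))"
  have cases: "X \<chi> i = of_real u * T \<chi> \<or> X \<chi> i = of_real v * T \<chi>" if "i \<in> {1..m}" for i
    using type that unfolding nonzero_type_def u_def v_def by blast
  have uu: "u * u * ((real q' - real q)\<^sup>2 * w) = real (q'\<^sup>2 * w)"
    and vv: "v * v * ((real q' - real q)\<^sup>2 * w) = real (q\<^sup>2 * w)"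
    and uv: "u * v * ((real q' - real q)\<^sup>2 * w) = - real l"
    using d by (simp_all add: u_def v_def l power2_eq_square)
  have vu: "v * u * ((real q' - real q)\<^sup>2 * w) = - real l" using uv by (simp add: mult.commute)
  show ?thesis using cases[OF ij(1)] cases[OF ij(2)]
    by (auto simp: prod uu vv uv vu simp del: complex_cnj_mult)
qed

lemma nonzero_type_attained:
  assumes type: "nonzero_type \<chi> q q' h w"
  shows "\<exists>i\<in>{1..m}. X \<chi> i * cnj (X \<chi> i) = of_nat (q\<^sup>2 * w)"
    and "\<exists>i\<in>{1..m}. \<exists>j\<in>{1..m}. X \<chi> i * cnj (X \<chi> j) = - of_nat l"
proof -
  have qq: "0 < q" "q < q'" and l: "l = q * q' * w"
    and T: "T \<chi> * cnj (T \<chi>) = of_real ((real q' - real q)\<^sup>2 * w)"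
    using type by (auto simp: nonzero_type_def of_nat_diff)
  have d: "real q' - real q \<noteq> 0" using qq by simp
  obtain i where i: "i \<in> {1..m}" "X \<chi> i = of_real (real q' / (real q' - real q)) * T \<chi>"
    using type unfolding nonzero_type_def by blast
  obtain j where j: "j \<in> {1..m}" "X \<chi> j = of_real (- (real q / (real q' - real q))) * T \<chi>"
    using type unfolding nonzero_type_def by blast
  have prod: "(of_real x * T \<chi>) * cnj (of_real y * T \<chi>) = of_real (x * y * ((real q' - real q)\<^sup>2 * w))" for x y
  proof -
    have "(of_real x * T \<chi>) * cnj (of_real y * T \<chi>) = of_real (x * y) * (T \<chi> * cnj (T \<chi>))" by simp
    then show ?thesis unfolding T by simp
  qed
  have "X \<chi> j * cnj (X \<chi> j) = of_real (real (q\<^sup>2 * w))"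
    unfolding j prod using d by (simp add: power2_eq_square)
  then show "\<exists>i\<in>{1..m}. X \<chi> i * cnj (X \<chi> i) = of_nat (q\<^sup>2 * w)"
    using j(1) by (metis of_real_of_nat_eq)
  have "X \<chi> i * cnj (X \<chi> j) = of_real (- real l)"
    unfolding i j prod using d by (simp add: l power2_eq_square)
  then show "\<exists>i\<in>{1..m}. \<exists>j\<in>{1..m}. X \<chi> i * cnj (X \<chi> j) = - of_nat l"
    using i(1) j(1) by (metis of_real_minus of_real_of_nat_eq)
qed

lemma norm_int:
  assumes "\<chi> \<in> chars" "\<chi> \<noteq> trivial_char" "i \<in> {1..m}"
  shows "\<exists>a. X \<chi> i * cnj (X \<chi> i) = of_int a"
proof (cases "T \<chi> = 0")
  case True
  then show ?thesis using type_zero[OF assms(1,2) True assms(3)] by (metis of_int_of_nat_eq)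
next
  case False
  then obtain q q' h w where "nonzero_type \<chi> q q' h w" using ex_nonzero_type[OF assms(1,2)] by blast
  then have "X \<chi> i * cnj (X \<chi> i) \<in> {of_nat (q'\<^sup>2 * w), of_nat (q\<^sup>2 * w), - of_nat l}"
    using assms(3) by (intro nonzero_type_products)
  then show ?thesis by (metis empty_iff insert_iff of_int_minus of_int_of_nat_eq)
qed

text \<open>Parseval's identity gives the sum over all characters, and the trivial one contributes
  k^2. What remains is a Galois invariant integer sum over the nontrivial characters.\<close>

lemma dvd_sum_products:
  assumes ij: "i \<in> {1..m}" "j \<in> {1..m}"
    and int: "\<And>\<chi>. \<chi> \<in> chars \<Longrightarrow> \<chi> \<noteq> trivial_char \<Longrightarrow> \<exists>a. X \<chi> i * cnj (X \<chi> j) = of_int a"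
  shows "int (p - 1) dvd int (p ^ Suc s * card (D i \<inter> D j)) - (int k)\<^sup>2"
proof -
  \<comment> \<open>The floor of the real part converts the product to type \<open>int\<close>; it
    is exact where the product is an integer.\<close>
  define F where "F \<chi> = \<lfloor>Re (X \<chi> i * cnj (X \<chi> j))\<rfloor>" for \<chi>
  have F: "X \<chi> i * cnj (X \<chi> j) = of_int (F \<chi>)" if \<chi>: "\<chi> \<in> chars" "\<chi> \<noteq> trivial_char" for \<chi>
  proof -
    obtain a where a: "X \<chi> i * cnj (X \<chi> j) = of_int a" using int[OF \<chi>] by blast
    show ?thesis unfolding F_def a by simp
  qed
  have dvd: "int (p - 1) dvd (\<Sum>\<chi>\<in>chars - {trivial_char}. F \<chi>)"
  proof (rule dvd_sum_Galois_invariant)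
    fix \<chi> t assume "\<chi> \<in> chars" "\<chi> \<noteq> trivial_char" "\<not> p dvd t"
    then have "X (char_pow \<chi> t) i * cnj (X (char_pow \<chi> t) j) = of_int (F \<chi>)"
      using ij by (intro char_product_int_conjugate D_subset F)
    then show "F (char_pow \<chi> t) = F \<chi>" by (simp add: F_def[of "char_pow \<chi> t"])
  qed
  have "(\<Sum>\<chi>\<in>chars. X \<chi> i * cnj (X \<chi> j))
      = X trivial_char i * cnj (X trivial_char j) + (\<Sum>\<chi>\<in>chars - {trivial_char}. X \<chi> i * cnj (X \<chi> j))"
    by (rule sum.remove[OF finite_chars trivial_char])
  also have "(\<Sum>\<chi>\<in>chars - {trivial_char}. X \<chi> i * cnj (X \<chi> j)) = of_int (\<Sum>\<chi>\<in>chars - {trivial_char}. F \<chi>)"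
    unfolding of_int_sum using F by (intro sum.cong) auto
  finally have "of_int (int (p ^ Suc s * card (D i \<inter> D j)) - (int k)\<^sup>2)
      = (of_int (\<Sum>\<chi>\<in>chars - {trivial_char}. F \<chi>) :: complex)"
    using Parseval[OF D_subset D_subset, OF ij] ij
    by (simp add: char_sum_trivial D_subset card_D order_G power2_eq_square del: of_int_sum power_Suc)
  then show ?thesis using dvd by (simp only: of_int_eq_iff)
qed

lemma T_Parseval: "(\<Sum>\<chi>\<in>chars. T \<chi> * cnj (T \<chi>)) = of_nat (p ^ Suc s * (m * k))"
  using Parseval[OF U_subset U_subset] by (simp only: Int_absorb card_U order_G)

lemma T_trivial: "T trivial_char = of_nat (m * k)"
  by (simp only: char_sum_trivial[OF U_subset] card_U)

lemma card_nontrivial_chars: "card (chars - {trivial_char}) = p ^ Suc s - 1"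
  using finite_chars by (simp add: card_chars order_G del: power_Suc)

lemma ex_nontrivial_char: "\<exists>\<chi>\<in>chars. \<chi> \<noteq> trivial_char"
proof -
  have "p ^ Suc s > 1" using zeta.p_ge_2 by (intro one_less_power) auto
  then have "card (chars - {trivial_char}) > 0" unfolding card_nontrivial_chars by simp
  then show ?thesis by (metis Diff_iff card_gt_0_iff ex_in_conv singletonI)
qed

text \<open>
  If \<open>a\<^sub>\<chi> > l / (m - 3)\<close> for all \<open>\<chi>\<close>, then all \<open>|\<chi>(U)|\<^sup>2\<close> are too small for Parseval's identity.
\<close>
lemma ex_extremal_char:
  assumes bound: "3 * int k * (int m - 1) < 2 * int p ^ Suc s"
  shows "\<exists>\<chi>\<in>chars. \<chi> \<noteq> trivial_char \<and> (\<exists>w. nonzero_type \<chi> 1 (m - 3) 1 w)"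
proof (rule ccontr)
  assume contra: "\<not> ?thesis"
  have small: "2 * (norm (T \<chi>))\<^sup>2 \<le> real l * (real m - 3)" if \<chi>: "\<chi> \<in> chars" "\<chi> \<noteq> trivial_char" for \<chi>
  proof (cases "T \<chi> = 0")
    case True
    then show ?thesis using m_ge by simp
  next
    case False
    then obtain q q' h w where type: "nonzero_type \<chi> q q' h w" using ex_nonzero_type[OF \<chi>] by blast
    then have q: "0 < q" "q < q'" "0 < h" and l: "l = q * q' * w" and m: "m = 2 + h * (q + q')"
      and T: "T \<chi> * cnj (T \<chi>) = of_nat ((q' - q)\<^sup>2 * w)"
      by (auto simp: nonzero_type_def)
    have ne: "\<not> (q = 1 \<and> h = 1)"
    proof
      assume *: "q = 1 \<and> h = 1"
      then have "q' = m - 3" using m by simp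
      then show False using contra \<chi> type * by blast
    qed
    \<comment> \<open>Outside the excluded type, \<open>h\<close> or \<open>q\<close> is at least 2,
      and either keeps the ratio of q' to q at most (m - 4) / 2.\<close>
    have "2 * q' + 4 * q \<le> q * m"
    proof (cases "h = 1")
      case True
      then have "q \<ge> 2" using ne q by simp
      then have "2 * (q' + (q - 2)) \<le> q * (q' + (q - 2))" by (rule mult_right_mono) simp
      moreover obtain r where "q = 2 + r" using le_Suc_ex[OF \<open>q \<ge> 2\<close>] by blast
      then have "q * m = q * (q' + (q - 2)) + 4 * q" using True m by (simp add: algebra_simps)
      ultimately show ?thesis by simp
    next
      case False
      then have "2 * (q + q') \<le> h * (q + q')" using q by (intro mult_right_mono) auto
      then have "2 * q' + 2 * q + 2 \<le> m" using m by simp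
      then have "q * (2 * q' + 2 * q + 2) \<le> q * m" by (rule mult_left_mono) simp
      moreover have "1 * (2 * q') + 4 * q \<le> q * (2 * q') + q * (2 * q + 2)"
        using q by (intro add_mono mult_right_mono) auto
      ultimately show ?thesis by (simp add: algebra_simps)
    qed
    then have "2 * real q' + 4 * real q \<le> real q * real m"
      by (metis (mono_tags, lifting) of_nat_add of_nat_le_iff of_nat_mult of_nat_numeral)
    then have "2 * real q' \<le> real q * (real m - 3)" using q by (simp add: algebra_simps)
    then have "real q' * (2 * real q') \<le> real q' * (real q * (real m - 3))" by (intro mult_left_mono) auto
    moreover have "(real (q' - q))\<^sup>2 \<le> (real q')\<^sup>2" by (intro power_mono) auto
    ultimately have "2 * (real (q' - q))\<^sup>2 \<le> real q * real q' * (real m - 3)"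
      by (simp add: power2_eq_square algebra_simps)
    then have "2 * (real (q' - q))\<^sup>2 * real w \<le> real q * real q' * (real m - 3) * real w"
      by (intro mult_right_mono) auto
    moreover have "(norm (T \<chi>))\<^sup>2 = (real (q' - q))\<^sup>2 * real w"
    proof -
      have "of_real ((norm (T \<chi>))\<^sup>2) = (of_real ((real (q' - q))\<^sup>2 * real w) :: complex)"
        unfolding complex_norm_square T by simp
      then show ?thesis by (simp only: of_real_eq_iff)
    qed
    ultimately show ?thesis by (simp add: l mult_ac)
  qed
  define v where "v = real p ^ Suc s"
  have v: "v > 0" using zeta.p_ge_2 by (simp add: v_def)
  have "of_real (\<Sum>\<chi>\<in>chars. (norm (T \<chi>))\<^sup>2) = (of_real (v * (real m * real k)) :: complex)"
    using T_Parseval by (simp only: of_real_sum complex_norm_square) (simp add: v_def)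
  then have "(\<Sum>\<chi>\<in>chars. (norm (T \<chi>))\<^sup>2) = v * (real m * real k)" by (simp only: of_real_eq_iff)
  moreover have "(\<Sum>\<chi>\<in>chars. (norm (T \<chi>))\<^sup>2) = (norm (T trivial_char))\<^sup>2 + (\<Sum>\<chi>\<in>chars - {trivial_char}. (norm (T \<chi>))\<^sup>2)"
    by (rule sum.remove[OF finite_chars trivial_char])
  moreover have "norm (T trivial_char) = real m * real k"
    unfolding T_trivial by (simp add: norm_mult)
  ultimately have sum: "(\<Sum>\<chi>\<in>chars - {trivial_char}. (norm (T \<chi>))\<^sup>2) = v * (real m * real k) - (real m * real k)\<^sup>2"
    by simp
  have "2 * (\<Sum>\<chi>\<in>chars - {trivial_char}. (norm (T \<chi>))\<^sup>2) = (\<Sum>\<chi>\<in>chars - {trivial_char}. 2 * (norm (T \<chi>))\<^sup>2)"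
    by (rule sum_distrib_left)
  also have "\<dots> \<le> (\<Sum>\<chi>\<in>chars - {trivial_char}. real l * (real m - 3))"
    using small by (intro sum_mono) auto
  also have "\<dots> = real (p ^ Suc s - 1) * (real l * (real m - 3))"
    by (simp only: sum_constant card_nontrivial_chars)
  also have "real (p ^ Suc s - 1) = v - 1"
    using zeta.p_ge_2 by (simp add: v_def of_nat_diff del: power_Suc)
  finally have le: "2 * (v * (real m * real k) - (real m * real k)\<^sup>2) \<le> (v - 1) * (real l * (real m - 3))"
    unfolding sum .
  have count: "(real k)\<^sup>2 * (real m - 1) = real l * (v - 1)"
    using arg_cong[OF count_equation, of real_of_int] by (simp add: v_def)
  \<comment> \<open>The count equation eliminates \<open>l\<close> from Parseval's inequality; what
    remains contradicts \<open>bound\<close> when m is at least 3.\<close>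
  have "(v - 1) * (real l * (real m - 3)) = (real k)\<^sup>2 * (real m - 1) * (real m - 3)"
    unfolding count by simp
  with le have "real k * (2 * real m * v) \<le> real k * (real k * (3 * (real m)\<^sup>2 - 4 * real m + 3))"
    by (simp add: power2_eq_square algebra_simps)
  then have "2 * real m * v \<le> real k * (3 * (real m)\<^sup>2 - 4 * real m + 3)"
    using k_ge by (simp add: mult_le_cancel_left_pos)
  then have "3 * (real m - 1) * (2 * real m * v) \<le> 3 * (real m - 1) * (real k * (3 * (real m)\<^sup>2 - 4 * real m + 3))"
    using m_ge by (intro mult_left_mono) auto
  also have "\<dots> = (3 * real k * (real m - 1)) * (3 * (real m)\<^sup>2 - 4 * real m + 3)" by simp
  also have "\<dots> < 2 * v * (3 * (real m)\<^sup>2 - 4 * real m + 3)"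
  proof (rule mult_strict_right_mono)
    have "real_of_int (3 * int k * (int m - 1)) < real_of_int (2 * int p ^ Suc s)"
      using bound by (simp only: of_int_less_iff)
    then show "3 * real k * (real m - 1) < 2 * v" by (simp add: v_def)
    have "(real m)\<^sup>2 \<ge> 3 * real m" using m_ge by (simp add: power2_eq_square)
    then show "0 < 3 * (real m)\<^sup>2 - 4 * real m + 3" using m_ge by linarith
  qed
  finally have "(2 * v) * (3 * real m * (real m - 1)) < (2 * v) * (3 * (real m)\<^sup>2 - 4 * real m + 3)"
    by (simp add: mult_ac)
  then have "3 * real m * (real m - 1) < 3 * (real m)\<^sup>2 - 4 * real m + 3"
    using v by (simp only: mult_less_cancel_left_pos)
  then have "real m < 3" by (simp add: power2_eq_square algebra_simps)
  then show False using m_ge by simp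
qed

text \<open>For i = j all products are integers, and the group order is 1 modulo p - 1.\<close>

lemma pred_p_dvd: "int p - 1 dvd int k * (int k - 1)"
proof -
  have 1: "1 \<in> {1..m}" using m_ge by simp
  have "int (p - 1) dvd int (p ^ Suc s * card (D 1 \<inter> D 1)) - (int k)\<^sup>2"
    using 1 norm_int by (intro dvd_sum_products) auto
  then have "int p - 1 dvd int p ^ Suc s * int k - (int k)\<^sup>2"
    using card_D[OF 1] zeta.p_ge_2 by (simp add: of_nat_diff)
  moreover have "int p - 1 dvd (int p ^ Suc s - 1 ^ Suc s) * int k"
    by (intro dvd_mult2 dvd_power_diff_power) simp
  ultimately have "int p - 1 dvd (int p ^ Suc s - 1 ^ Suc s) * int k - (int p ^ Suc s * int k - (int k)\<^sup>2)"
    by (rule dvd_diff[rotated])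
  then show ?thesis by (simp add: algebra_simps power2_eq_square)
qed

text \<open>Every integral product is k^2 modulo \<open>p\<close>. Both q^2 w and -l = -q q' w
  occur, so \<open>p\<close> divides q w (q + q'). It cannot divide q w, because k^2 is not 0 modulo
  \<open>p\<close>.\<close>

lemma p_dvd_sum_parameters:
  assumes \<chi>: "\<chi> \<in> chars" "\<chi> \<noteq> trivial_char" and type: "nonzero_type \<chi> q q' h w" and k: "\<not> p dvd k"
  shows "p dvd q + q'"
proof -
  obtain i where i: "i \<in> {1..m}" "X \<chi> i * cnj (X \<chi> i) = of_int (int (q\<^sup>2 * w))"
    using nonzero_type_attained(1)[OF type] by (metis of_int_of_nat_eq)
  have c1: "int p dvd int (k * k) - int (q\<^sup>2 * w)"
    using char_product_int_imp_cong[OF \<chi>(1) D_subset D_subset i(2)] i(1) card_D by simp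
  obtain i j where ij: "i \<in> {1..m}" "j \<in> {1..m}" "X \<chi> i * cnj (X \<chi> j) = of_int (- int l)"
    using nonzero_type_attained(2)[OF type] by (metis of_int_minus of_int_of_nat_eq)
  have c2: "int p dvd int (k * k) - (- int l)"
    using char_product_int_imp_cong[OF \<chi>(1) D_subset D_subset ij(3)] ij(1,2) card_D by simp
  have "int p dvd (int (k * k) - (- int l)) - (int (k * k) - int (q\<^sup>2 * w))" using dvd_diff[OF c2 c1] .
  also have "(int (k * k) - (- int l)) - (int (k * k) - int (q\<^sup>2 * w)) = int (q * w * (q + q'))"
    using type by (simp add: nonzero_type_def power2_eq_square algebra_simps)
  finally have "p dvd q * w * (q + q')" by (simp only: int_dvd_int_iff)
  moreover have "\<not> p dvd q * w"
  proof
    assume "p dvd q * w"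
    then have "p dvd q * (q * w)" by (rule dvd_mult)
    then have "p dvd q\<^sup>2 * w" by (simp only: power2_eq_square mult.assoc)
    then have "int p dvd int (q\<^sup>2 * w)" by (simp only: int_dvd_int_iff)
    from dvd_add[OF c1 this] have "p dvd k * k" by (simp only: diff_add_cancel int_dvd_int_iff)
    then show False using k prime_p by (simp add: prime_dvd_mult_iff)
  qed
  ultimately show ?thesis using prime_p by (simp add: prime_dvd_mult_iff)
qed

text \<open>One vanishing value makes \<open>p\<close> divide m, whereas a nonzero value at another
  nontrivial character makes m congruent to 2. So all nontrivial values would vanish, Parseval would
  give m k the full group order, and k, dividing a power of \<open>p\<close>, would be 1.\<close>

lemma T_nonzero_of_coprime:
  assumes k: "\<not> p dvd k" and p: "p \<noteq> 2" and \<chi>: "\<chi> \<in> chars" "\<chi> \<noteq> trivial_char"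
  shows "T \<chi> \<noteq> 0"
proof
  assume T0: "T \<chi> = 0"
  have "int p dvd int (card U * card U) - 0"
    using T0 by (intro char_product_int_imp_cong[OF \<chi>(1) U_subset U_subset]) simp
  then have "p dvd (m * k) * (m * k)" unfolding card_U by (simp only: diff_zero int_dvd_int_iff)
  then have pm: "p dvd m" using k prime_p by (simp add: prime_dvd_mult_iff)
  have all0: "T \<psi> = 0" if \<psi>: "\<psi> \<in> chars" "\<psi> \<noteq> trivial_char" for \<psi>
  proof (rule ccontr)
    assume "T \<psi> \<noteq> 0"
    then obtain q q' h w where type: "nonzero_type \<psi> q q' h w" using ex_nonzero_type[OF \<psi>] by blast
    then have "p dvd h * (q + q')" using p_dvd_sum_parameters[OF \<psi> type k] by simp
    moreover have "m = 2 + h * (q + q')" using type by (simp add: nonzero_type_def)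
    ultimately have "p dvd 2" using pm by (metis dvd_add_left_iff)
    then have "p = 2" using zeta.p_ge_2 by (auto dest: dvd_imp_le)
    then show False using p by simp
  qed
  have "(\<Sum>\<chi>\<in>chars. T \<chi> * cnj (T \<chi>)) = (\<Sum>\<chi>\<in>{trivial_char}. T \<chi> * cnj (T \<chi>))"
    using finite_chars all0 by (intro sum.mono_neutral_right) auto
  then have "of_nat (p ^ Suc s * (m * k)) = (of_nat ((m * k) * (m * k)) :: complex)"
    unfolding T_Parseval by (simp add: T_trivial)
  then have "p ^ Suc s * (m * k) = (m * k) * (m * k)" by (simp only: of_nat_eq_iff)
  then have "p ^ Suc s = m * k" using m_ge k_ge by simp
  then have "k dvd p ^ Suc s" by simp
  moreover have "coprime k (p ^ Suc s)"
    using prime_imp_coprime[OF prime_p k] by (metis coprime_commute coprime_power_right_iff)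
  ultimately have "k = 1" by (metis coprime_absorb_left nat_dvd_1_iff_1)
  then show False using k_ge by simp
qed

end

section \<open>The parameters of an SEDF in a group of order p^3\<close>

locale sedf_cube = sedf G p 2 m k l D for G (structure) and p m k l D
begin

lemma cube: "p ^ Suc 2 = p ^ 3" by (simp add: eval_nat_numeral)

lemma p_dvd_k: "p dvd k"
proof (rule ccontr)
  assume k: "\<not> p dvd k"
  \<comment> \<open>In a group of order 8 an odd k is at least 3, and m k is at least 9.\<close>
  have p2: "p \<noteq> 2"
  proof
    assume p: "p = 2"
    then have "odd k" using k by simp
    then have "k \<ge> 3" using k_ge by (cases "k = 2") auto
    then have "3 * 3 \<le> m * k" using m_ge by (intro mult_mono) auto
    then show False using mk_le p by simp
  qed
  then have odd: "odd p" using prime_p primes_dvd_imp_eq two_is_prime_nat by blast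
  have p3: "p \<ge> 3" using p2 zeta.p_ge_2 by simp
  obtain \<chi> where \<chi>: "\<chi> \<in> chars" "\<chi> \<noteq> trivial_char" using ex_nontrivial_char by blast
  obtain q q' h w where type: "nonzero_type \<chi> q q' h w"
    using ex_nonzero_type[OF \<chi> T_nonzero_of_coprime[OF k p2 \<chi>]] by blast
  have m_eq0: "m = 2 + h * (q + q')" using type by (simp add: nonzero_type_def)
  then have "p dvd m - 2" using p_dvd_sum_parameters[OF \<chi> type k] by simp
  then obtain y where "m - 2 = p * y" by (auto elim: dvdE)
  then have m_eq: "m = 2 + p * y" using m_ge by simp
  then have y: "y \<ge> 1" using m_ge by (cases y) auto
  have 12: "1 \<in> {1..m}" "2 \<in> {1..m}" using m_ge by auto
  \<comment> \<open>Since T never vanishes, products for different indices are integers too. The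
    sets being disjoint, p - 1 divides k^2.\<close>
  have "int (p - 1) dvd int (p ^ Suc 2 * card (D 1 \<inter> D 2)) - (int k)\<^sup>2"
  proof (rule dvd_sum_products[OF 12])
    fix \<psi> assume \<psi>: "\<psi> \<in> chars" "\<psi> \<noteq> trivial_char"
    then obtain q q' h w where "nonzero_type \<psi> q q' h w"
      using ex_nonzero_type[OF \<psi> T_nonzero_of_coprime[OF k p2 \<psi>]] by blast
    then have "X \<psi> 1 * cnj (X \<psi> 2) \<in> {of_nat (q'\<^sup>2 * w), of_nat (q\<^sup>2 * w), - of_nat l}"
      using 12 by (rule nonzero_type_products)
    then show "\<exists>a. X \<psi> 1 * cnj (X \<psi> 2) = of_int a"
      by (metis empty_iff insert_iff of_int_minus of_int_of_nat_eq)
  qed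
  moreover have "D 1 \<inter> D 2 = {}" using disjoint_D 12 by (intro disjoint_family_onD) auto
  ultimately have "int p - 1 dvd (int k)\<^sup>2" using p3 by (simp add: of_nat_diff)
  from dvd_diff[OF this pred_p_dvd] have "int p - 1 dvd int k"
    by (simp add: power2_eq_square algebra_simps)
  then obtain c where c: "int k = (int p - 1) * c" by (auto elim: dvdE)
  have c_pos: "c \<ge> 1"
  proof -
    have "(int p - 1) * c > 0" using c k_ge by simp
    then show ?thesis using p3 by (simp add: zero_less_mult_iff)
  qed
  show False
  proof (rule parameters_coprime_case[of "int p" "int y" c "int l"])
    show "3 \<le> int p" "odd (int p)" "1 \<le> int y" "1 \<le> c" using p3 odd y c_pos by simp_all
    have "(int p - 1) * ((int p - 1) * c\<^sup>2 * (1 + int p * int y)) = (int p - 1) * (int l * ((int p)\<^sup>2 + int p + 1))"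
      using count_equation unfolding c by (simp add: m_eq power2_eq_square power3_eq_cube algebra_simps)
    then show "(int p - 1) * c\<^sup>2 * (1 + int p * int y) = int l * ((int p)\<^sup>2 + int p + 1)"
      using p3 by simp
    have "int (m * k) \<le> int (p ^ Suc 2)" using mk_le by (simp only: of_nat_le_iff)
    then show "(2 + int p * int y) * ((int p - 1) * c) \<le> int p ^ 3"
      unfolding cube c[symmetric] by (simp add: m_eq algebra_simps)
    show "int l < (int p - 1) * c" using l_less_k unfolding c[symmetric] by simp
    assume "3 * ((int p - 1) * c) * (1 + int p * int y) < 2 * int p ^ 3"
    then have "3 * int k * (int m - 1) < 2 * int p ^ Suc 2"
      unfolding c[symmetric] by (simp add: m_eq eval_nat_numeral)
    then obtain \<psi> w where "nonzero_type \<psi> 1 (m - 3) 1 w" using ex_extremal_char by blast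
    then have "l = (m - 3) * w" by (simp add: nonzero_type_def)
    moreover have "int (m - 3) = int p * int y - 1" using m_eq m_ge by simp
    ultimately show "int p * int y - 1 dvd int l" by (metis dvd_triv_left of_nat_mult)
  qed
qed

text \<open>With k = p c the count equation makes p^2 divide l, as p is prime to p^3 - 1. From l < k
  and m k <= p^3 follows m l' < p, and p - 1 divides c (c - 1) because p is 1 modulo p - 1. Now
  \<open>parameters_divisible_case\<close> applies.\<close>

lemma parameters:
  "\<exists>l' n. l = p\<^sup>2 * l' \<and> 0 < l' \<and> 3 * l' * (m - 1) = p - 1 \<and> 0 < n \<and> k = p * (3 * l' * n) \<and>
    3 * n\<^sup>2 = p\<^sup>2 + p + 1 \<and> m * l' < p \<and> p > 3"
proof -
  obtain c where c: "k = p * c" using p_dvd_k by (auto elim: dvdE)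
  have p0: "p > 0" using zeta.p_ge_2 by simp
  have c0: "c > 0" using k_ge c by (cases c) auto
  have "int p ^ 2 dvd int l * (int p ^ 3 - 1)"
  proof -
    have "int p ^ Suc 2 = int p ^ 3" by (simp add: eval_nat_numeral)
    then have "int l * (int p ^ 3 - 1) = (int p)\<^sup>2 * ((int c)\<^sup>2 * (int m - 1))"
      using count_equation by (simp only: c of_nat_mult power_mult_distrib mult.assoc)
    then show ?thesis by simp
  qed
  moreover have "coprime (int p ^ 2) (int p ^ 3 - 1)"
  proof -
    have "coprime (int p) (int p ^ 3 - 1)"
    proof (rule coprimeI)
      fix d assume "d dvd int p" "d dvd int p ^ 3 - 1"
      then have "d dvd int p ^ 3" "d dvd int p ^ 3 - 1" by (simp_all add: power3_eq_cube)
      then have "d dvd int p ^ 3 - (int p ^ 3 - 1)" by (rule dvd_diff)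
      then show "is_unit d" by simp
    qed
    then show ?thesis by simp
  qed
  ultimately have "int p ^ 2 dvd int l" by (simp add: coprime_dvd_mult_left_iff)
  then have "p\<^sup>2 dvd l" by (metis int_dvd_int_iff of_nat_power)
  then obtain l' where l': "l = p\<^sup>2 * l'" by (auto elim: dvdE)
  have l'0: "l' > 0" using l_pos l' by (cases l') auto
  have "(int p)\<^sup>2 * ((int c)\<^sup>2 * (int m - 1)) = (int p)\<^sup>2 * (int l' * (int p ^ 3 - 1))"
    using count_equation unfolding c l' by (simp add: power2_eq_square power3_eq_cube algebra_simps eval_nat_numeral)
  then have eq: "(int c)\<^sup>2 * (int m - 1) = int l' * (int p ^ 3 - 1)" using p0 by simp
  have "p * (p * l') < p * c" using l_less_k unfolding c l' by (simp add: power2_eq_square)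
  then have "p * l' < c" using p0 by simp
  then have "m * (p * l') < m * c" using m_ge by simp
  also have "m * c \<le> p\<^sup>2"
  proof -
    have "p * (m * c) \<le> p * p\<^sup>2" using mk_le unfolding c cube by (simp add: power2_eq_square power3_eq_cube mult_ac)
    then show ?thesis using p0 by simp
  qed
  finally have "p * (m * l') < p * p" by (simp add: power2_eq_square mult_ac)
  then have ml: "m * l' < p" using p0 by simp
  have "int p - 1 dvd int p * int c * (int p * int c - 1) - (int p - 1) * (int c * ((int p + 1) * int c - 1))"
    using pred_p_dvd unfolding c by (intro dvd_diff) auto
  also have "\<dots> = int c * (int c - 1)" by (simp add: algebra_simps)
  finally have dvd: "int p - 1 dvd int c * (int c - 1)" .
  have "int m * int l' < int p" using ml by (metis of_nat_less_iff of_nat_mult)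
  then obtain n where n: "3 * int l' * (int m - 1) = int p - 1" "n > 0" "int c = 3 * int l' * n"
      "3 * n\<^sup>2 = (int p)\<^sup>2 + int p + 1"
    using parameters_divisible_case[of "int m" "int c" "int l'" "int p"] m_ge c0 l'0 eq dvd by auto
  have n': "int (nat n) = n" using n(2) by simp
  have "int (3 * l' * (m - 1)) = int (p - 1)" using n(1) m_ge p0 by (simp add: of_nat_diff)
  then have 1: "3 * l' * (m - 1) = p - 1" by (simp only: of_nat_eq_iff)
  have "int c = int (3 * l' * nat n)" using n(3) n' by simp
  then have 2: "c = 3 * l' * nat n" by (simp only: of_nat_eq_iff)
  have "int (3 * (nat n)\<^sup>2) = int (p\<^sup>2 + p + 1)" using n(4) n' by simp
  then have 3: "3 * (nat n)\<^sup>2 = p\<^sup>2 + p + 1" by (simp only: of_nat_eq_iff)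
  have "3 * 1 \<le> m * l'" using m_ge l'0 by (intro mult_mono) auto
  then have "p > 3" using ml by simp
  then show ?thesis using l' l'0 1 n(2) c 2 3 ml by (intro exI[of _ l'] exI[of _ "nat n"]) simp
qed

end

section \<open>The structure of the group\<close>

lemma prime_root_power_eq:
  fixes y :: complex
  assumes p: "prime p" and y: "y ^ p = 1" "y \<noteq> 1" and eq: "y ^ a = y ^ b" and ab: "a < p" "b < p"
  shows "a = b"
proof -
  have y0: "y \<noteq> 0" using y(1) prime_gt_0_nat[OF p] by (auto simp: power_0_left)
  have *: "a = b" if "y ^ a = y ^ b" "a \<le> b" "b < p" for a b
  proof (rule ccontr)
    assume "a \<noteq> b"
    then have d: "0 < b - a" "b - a < p" using that by auto
    have "y ^ a * y ^ (b - a) = y ^ b" using that(2) by (simp flip: power_add)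
    then have "y ^ a * y ^ (b - a) = y ^ a" using that(1) by simp
    then have "y ^ (b - a) = 1" using y0 by simp
    moreover have "\<not> p dvd b - a" using d by (auto dest: dvd_imp_le)
    from prime_imp_coprime[OF p this] have "coprime (b - a) p" by (subst coprime_commute)
    ultimately show False using root_of_unity_coprime_power[OF _ y(1)] y(2) by blast
  qed
  show ?thesis
  proof (cases "a \<le> b")
    case True
    then show ?thesis using *[OF eq] ab by simp
  next
    case False
    then show ?thesis using *[OF eq[symmetric]] ab by simp
  qed
qed

context finite_comm_group
begin

text \<open>The powers of \<open>h\<close> lie in distinct cosets of the kernel of
  \<open>\<chi>\<close>, so all products differ. The inequality will bound a kernel, and the case of
  equality will parametrize the group.\<close>

lemma card_times_le:
  assumes \<chi>: "\<chi> \<in> chars" and h: "h \<in> carrier G" and L: "L \<subseteq> carrier G" "\<And>x. x \<in> L \<Longrightarrow> \<chi> x = 1"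
    and inj: "inj_on (\<lambda>a. \<chi> h ^ a) {..<n}" and B: "finite B"
    and sub: "\<And>a x. a < n \<Longrightarrow> x \<in> L \<Longrightarrow> h [^] a \<otimes> x \<in> B"
  shows "n * card L \<le> card B" and "n * card L = card B \<Longrightarrow> B = (\<lambda>(a, x). h [^] a \<otimes> x) ` ({..<n} \<times> L)"
proof -
  define f where "f = (\<lambda>(a::nat, x). h [^] a \<otimes> x)"
  have f_inj: "inj_on f ({..<n} \<times> L)"
  proof (rule inj_onI)
    fix u v assume uv: "u \<in> {..<n} \<times> L" "v \<in> {..<n} \<times> L" "f u = f v"
    obtain a x b y where e: "u = (a, x)" "v = (b, y)" by (metis surj_pair)
    have xy: "x \<in> carrier G" "y \<in> carrier G" "\<chi> x = 1" "\<chi> y = 1" using uv e L by auto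
    have eq: "h [^] a \<otimes> x = h [^] b \<otimes> y" using uv(3) by (simp add: f_def e)
    from arg_cong[OF this, of \<chi>] have "\<chi> h ^ a = \<chi> h ^ b"
      using xy h \<chi> by (simp add: char_mult char_nat_pow)
    then have "a = b" using inj uv e by (auto dest: inj_onD)
    moreover have "x = y" using eq xy h \<open>a = b\<close> by simp
    ultimately show "u = v" by (simp add: e)
  qed
  have f_sub: "f ` ({..<n} \<times> L) \<subseteq> B" using sub by (auto simp: f_def)
  have c: "card (f ` ({..<n} \<times> L)) = n * card L" using f_inj by (simp add: card_image card_cartesian_product)
  show "n * card L \<le> card B" using card_mono[OF B f_sub] c by simp
  show "B = (\<lambda>(a, x). h [^] a \<otimes> x) ` ({..<n} \<times> L)" if "n * card L = card B"
    using card_subset_eq[OF B f_sub] c that by (simp add: f_def)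
qed

text \<open>Multiplication by \<open>\<kappa>\<close> permutes \<open>S\<close> and multiplies the
  sum by a number other than 1.\<close>

lemma char_sum_invariant_zero:
  assumes S: "S \<subseteq> carrier G" and \<theta>: "\<theta> \<in> chars" and \<kappa>: "\<kappa> \<in> carrier G" "\<theta> \<kappa> \<noteq> 1"
    and inv: "\<And>x. x \<in> S \<Longrightarrow> x \<otimes> \<kappa> \<in> S"
  shows "char_sum \<theta> S = 0"
proof -
  have fin: "finite S" using S finite_carrier finite_subset by blast
  have inj: "inj_on (\<lambda>x. x \<otimes> \<kappa>) S" using S \<kappa>(1) by (auto simp: inj_on_def subset_eq)
  then have "(\<lambda>x. x \<otimes> \<kappa>) ` S = S" using inv fin by (intro endo_inj_surj) auto
  then have "char_sum \<theta> S = (\<Sum>x\<in>(\<lambda>x. x \<otimes> \<kappa>) ` S. \<theta> x)" by (simp add: char_sum_def)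
  also have "\<dots> = (\<Sum>x\<in>S. \<theta> (x \<otimes> \<kappa>))" by (simp only: sum.reindex[OF inj] o_def)
  also have "\<dots> = (\<Sum>x\<in>S. \<theta> x * \<theta> \<kappa>)" using S \<theta> \<kappa>(1) by (intro sum.cong) (auto simp: char_mult)
  also have "\<dots> = char_sum \<theta> S * \<theta> \<kappa>" by (simp add: char_sum_def sum_distrib_right)
  finally show ?thesis using \<kappa>(2) by simp
qed

definition kernel_of :: "('a \<Rightarrow> complex) \<Rightarrow> 'a set" where "kernel_of \<chi> = {x \<in> carrier G. \<chi> x = 1}"

lemma kernel_of_subgroup: "\<chi> \<in> chars \<Longrightarrow> subgroup (kernel_of \<chi>) G"
  by (rule subgroupI) (auto simp: kernel_of_def char_mult char_inv)

lemma subgroup_pow_card: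
  assumes "subgroup H G" "x \<in> H"
  shows "x [^] card H = \<one>"
proof -
  interpret H: comm_group "G\<lparr>carrier := H\<rparr>"
  proof (rule group.group_comm_groupI)
    show "group (G\<lparr>carrier := H\<rparr>)" using assms(1) is_group by (rule subgroup.subgroup_is_group)
    show "a \<otimes>\<^bsub>G\<lparr>carrier := H\<rparr>\<^esub> b = b \<otimes>\<^bsub>G\<lparr>carrier := H\<rparr>\<^esub> a"
      if "a \<in> carrier (G\<lparr>carrier := H\<rparr>)" "b \<in> carrier (G\<lparr>carrier := H\<rparr>)" for a b
      using that subgroup.subset[OF assms(1)] by (auto intro: m_comm)
  qed
  have "finite H" using assms(1) finite_carrier subgroup.subset finite_subset by blast
  then show ?thesis using H.power_order_eq_one[of x] assms(2) by (simp add: nat_pow_consistent[symmetric])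
qed

lemma card_fibre:
  assumes \<chi>: "\<chi> \<in> chars" and y: "y \<in> carrier G"
  shows "card {x \<in> carrier G. \<chi> x = \<chi> y} = card (kernel_of \<chi>)"
proof -
  have "bij_betw (\<lambda>x. y \<otimes> x) (kernel_of \<chi>) {x \<in> carrier G. \<chi> x = \<chi> y}"
  proof (rule bij_betwI[where g = "\<lambda>x. inv y \<otimes> x"])
    show "(\<lambda>x. y \<otimes> x) \<in> kernel_of \<chi> \<rightarrow> {x \<in> carrier G. \<chi> x = \<chi> y}"
      using \<chi> y by (auto simp: kernel_of_def char_mult)
    show "(\<lambda>x. inv y \<otimes> x) \<in> {x \<in> carrier G. \<chi> x = \<chi> y} \<rightarrow> kernel_of \<chi>"
      using \<chi> y char_cnj[OF \<chi> y] by (auto simp: kernel_of_def char_mult char_inv mult.commute)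
  qed (use y in \<open>auto simp: kernel_of_def m_assoc[symmetric]\<close>)
  then show ?thesis by (rule bij_betw_same_card[THEN sym])
qed

text \<open>If every character trivial at z were trivial at x, then summing all characters over the
  elements x z^j would give \<open>p\<close> times the number of characters trivial at z.
  Orthogonality makes this sum 0.\<close>

lemma ex_char_trivial_on:
  fixes p :: nat
  assumes p: "prime p" and z: "z \<in> carrier G" "z [^] p = \<one>" and x: "x \<in> carrier G"
    and ne: "\<And>j. j < p \<Longrightarrow> x \<otimes> z [^] j \<noteq> \<one>"
  shows "\<exists>\<psi>\<in>chars. \<psi> z = 1 \<and> \<psi> x \<noteq> 1"
proof (rule ccontr)
  assume contra: "\<not> ?thesis"
  have "(\<Sum>j<p. \<Sum>\<psi>\<in>chars. \<psi> (x \<otimes> z [^] j)) = 0"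
    using x z ne by (intro sum.neutral ballI sum_chars_nonidentity) auto
  moreover have "(\<Sum>j<p. \<Sum>\<psi>\<in>chars. \<psi> (x \<otimes> z [^] j)) = (\<Sum>\<psi>\<in>chars. if \<psi> z = 1 then of_nat p else 0)"
    unfolding sum.swap[of _ chars]
  proof (rule sum.cong[OF refl])
    fix \<psi> assume \<psi>: "\<psi> \<in> chars"
    have "(\<Sum>j<p. \<psi> (x \<otimes> z [^] j)) = \<psi> x * (\<Sum>j<p. \<psi> z ^ j)"
      using \<psi> x z by (simp add: char_mult char_nat_pow sum_distrib_left)
    also have "\<dots> = (if \<psi> z = 1 then of_nat p else 0)"
    proof (cases "\<psi> z = 1")
      case True
      then have "\<psi> x = 1" using contra \<psi> by blast
      then show ?thesis using True by simp
    next
      case False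
      have "\<psi> z ^ p = 1" using char_nat_pow[OF \<psi> z(1), of p] z(2) \<psi> by simp
      then have "(1 - \<psi> z) * (\<Sum>j<p. \<psi> z ^ j) = 0" by (simp add: one_diff_power_eq[symmetric])
      then show ?thesis using False by simp
    qed
    finally show "(\<Sum>j<p. \<psi> (x \<otimes> z [^] j)) = (if \<psi> z = 1 then of_nat p else 0)" .
  qed
  moreover have "(\<Sum>\<psi>\<in>chars. if \<psi> z = 1 then of_nat p else (0::complex)) = of_nat (card {\<psi>\<in>chars. \<psi> z = 1} * p)"
    using finite_chars by (simp add: sum.If_cases Int_def)
  ultimately have "of_nat (card {\<psi>\<in>chars. \<psi> z = 1} * p) = (0 :: complex)" by (simp only:)
  then have "card {\<psi>\<in>chars. \<psi> z = 1} * p = 0" by (simp only: of_nat_eq_0_iff)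
  moreover have "trivial_char \<in> {\<psi>\<in>chars. \<psi> z = 1}" using z by (simp add: trivial_char_def[symmetric]) (simp add: trivial_char_def)
  ultimately show False using finite_chars prime_gt_0_nat[OF p] by auto
qed

end

context finite_abelian_p_group
begin

text \<open>
  Divisibility of \<open>\<chi>(A)\<close> by \<open>p\<close> makes the numbers of elements of \<open>A\<close> in the cosets of \<open>ker \<chi>\<close>
  congruent modulo \<open>p\<close> along each coset of the \<open>p\<close>-th roots of unity; as \<open>|ker \<chi>| \<le> p\<close>,
  they are all equal there (and contribute \<open>0\<close>) or they are all \<open>0\<close> or \<open>p\<close>.
\<close>
lemma kernel_invariant_part:
  assumes s: "s = 2" and A: "A \<subseteq> carrier G"
    and h: "h \<in> carrier G" and zp: "(h [^] p) [^] p = \<one>"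
    and \<chi>: "\<chi> \<in> chars" and \<chi>z: "\<chi> (h [^] p) \<noteq> 1"
    and norm: "char_sum \<chi> A * cnj (char_sum \<chi> A) = of_int (int p ^ 2 * n)" and nz: "char_sum \<chi> A \<noteq> 0"
  shows "card (kernel_of \<chi>) = p \<and>
    (\<exists>c. char_sum \<chi> {x\<in>A. \<chi> x ^ p = c} \<noteq> 0 \<and>
      (\<forall>x\<in>A. \<chi> x ^ p = c \<longrightarrow> (\<forall>\<kappa>\<in>kernel_of \<chi>. x \<otimes> \<kappa> \<in> A))) \<and>
    carrier G = (\<lambda>(a, x). h [^] a \<otimes> x) ` ({..<p\<^sup>2} \<times> kernel_of \<chi>)"
proof -
  define \<omega> where "\<omega> = \<chi> h ^ p"
  have \<omega>: "\<omega> ^ p = 1" "\<omega> \<noteq> 1"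
  proof -
    have "\<chi> ((h [^] p) [^] p) = 1" using zp \<chi> by simp
    then show "\<omega> ^ p = 1" using char_nat_pow[OF \<chi>] h by (simp add: \<omega>_def)
    show "\<omega> \<noteq> 1" using \<chi>z char_nat_pow[OF \<chi> h] by (simp add: \<omega>_def)
  qed
  have p0: "p > 0" using p_ge2 by simp
  \<comment> \<open>\<open>\<chi> h\<close> has order exactly p^2, because its p-th power
    \<open>\<omega>\<close> has order \<open>p\<close>.\<close>
  have inj: "inj_on (\<lambda>a. \<chi> h ^ a) {..<p\<^sup>2}"
  proof (rule linorder_inj_onI')
    fix a b assume ab: "a \<in> {..<p\<^sup>2}" "b \<in> {..<p\<^sup>2}" "a < b"
    show "\<chi> h ^ a \<noteq> \<chi> h ^ b"
    proof
      assume eq: "\<chi> h ^ a = \<chi> h ^ b"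
      have "\<chi> h ^ a * \<chi> h ^ (b - a) = \<chi> h ^ b" using ab by (simp flip: power_add)
      then have "\<chi> h ^ a * \<chi> h ^ (b - a) = \<chi> h ^ a * 1" using eq by simp
      then have 1: "\<chi> h ^ (b - a) = 1" using char_nonzero[OF \<chi> h] by simp
      have 2: "\<chi> h ^ (p * p) = 1" using \<omega>(1) by (simp add: \<omega>_def power_mult)
      show False
      proof (cases "p dvd b - a")
        case True
        then obtain e where e: "b - a = p * e" by (auto elim: dvdE)
        have "p * e < p * p" using ab e by (metis diff_le_self lessThan_iff order.strict_trans1 power2_eq_square)
        then have "e < p" by simp
        moreover have "\<omega> ^ e = \<omega> ^ 0" using 1 by (simp add: e \<omega>_def power_mult)
        ultimately have "e = 0" using prime_root_power_eq[OF prime_p \<omega>] p0 by blast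
        then show False using e ab by simp
      next
        case False
        from prime_imp_coprime[OF prime_p this] have "coprime (p * p) (b - a)" by simp
        then have "coprime (b - a) (p * p)" by (subst coprime_commute)
        then have "\<chi> h = 1" using root_of_unity_coprime_power[OF 1 2] by blast
        then show False using \<omega> by (simp add: \<omega>_def)
      qed
    qed
  qed
  have K: "kernel_of \<chi> \<subseteq> carrier G" "\<And>x. x \<in> kernel_of \<chi> \<Longrightarrow> \<chi> x = 1" by (auto simp: kernel_of_def)
  have memb: "h [^] a \<otimes> x \<in> carrier G" if "x \<in> kernel_of \<chi>" for a :: nat and x
    using that K h by auto
  have cG: "card (carrier G) = p\<^sup>2 * p"
    using order_G by (simp add: Coset.order_def s power2_eq_square eval_nat_numeral)
  have "p\<^sup>2 * card (kernel_of \<chi>) \<le> p\<^sup>2 * p"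
    using card_times_le(1)[OF \<chi> h K inj finite_carrier memb] cG by simp
  then have K_le: "card (kernel_of \<chi>) \<le> p" using p0 by simp
  have finA: "finite A" using A finite_carrier finite_subset by blast
  define n where "n v = card {x\<in>A. \<chi> x = v}" for v
  have n_le: "n v \<le> p" for v
  proof (cases "\<exists>y\<in>A. \<chi> y = v")
    case True
    then obtain y where y: "y \<in> A" "\<chi> y = v" by blast
    have "n v \<le> card {x\<in>carrier G. \<chi> x = \<chi> y}"
      unfolding n_def using A y finite_carrier by (intro card_mono) auto
    also have "\<dots> \<le> p" using card_fibre[OF \<chi>] y A K_le by auto
    finally show ?thesis .
  next
    case False
    then have "{x\<in>A. \<chi> x = v} = {}" by blast
    then have "n v = card ({} :: 'a set)" unfolding n_def by (rule arg_cong)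
    then show ?thesis by simp
  qed
  have n_cong: "int p dvd int (n v) - int (n (v * \<eta>))" if "\<eta> ^ p = 1" for v \<eta>
    unfolding n_def by (rule fibre_cong_of_norm_dvd[OF \<chi> A norm that])
  \<comment> \<open>Elements are grouped by the p-th power of their value, that is, by cosets of the
    p-th roots of unity; some group has a nonzero sum.\<close>
  have "char_sum \<chi> A = (\<Sum>c\<in>(\<lambda>x. \<chi> x ^ p) ` A. char_sum \<chi> {x\<in>A. \<chi> x ^ p = c})"
    unfolding char_sum_def using finA by (rule sum.image_gen)
  then obtain c where c: "char_sum \<chi> {x\<in>A. \<chi> x ^ p = c} \<noteq> 0"
    using nz by (metis (no_types, lifting) sum.neutral)
  define V where "V = {v. v ^ p = c}"
  have finV: "finite V" using finite_nth_roots[OF p0] by (simp add: V_def)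
  have S: "char_sum \<chi> {x\<in>A. \<chi> x ^ p = c} = (\<Sum>v\<in>V. of_nat (n v) * v)"
  proof -
    have "char_sum \<chi> {x\<in>A. \<chi> x ^ p = c} = (\<Sum>v\<in>V. \<Sum>x\<in>{x\<in>{x\<in>A. \<chi> x ^ p = c}. \<chi> x = v}. \<chi> x)"
      unfolding char_sum_def using finA finV by (intro sum.group[symmetric]) (auto simp: V_def)
    also have "\<dots> = (\<Sum>v\<in>V. of_nat (n v) * v)"
    proof (rule sum.cong[OF refl])
      fix v assume "v \<in> V"
      then have "{x\<in>{x\<in>A. \<chi> x ^ p = c}. \<chi> x = v} = {x\<in>A. \<chi> x = v}" by (auto simp: V_def)
      then show "(\<Sum>x\<in>{x\<in>{x\<in>A. \<chi> x ^ p = c}. \<chi> x = v}. \<chi> x) = of_nat (n v) * v" by (simp add: n_def)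
    qed
    finally show ?thesis .
  qed
  \<comment> \<open>Otherwise replacing v by its multiple with \<open>\<omega>\<close> would show
    that the sum equals itself times \<open>\<omega>\<close>.\<close>
  have "\<exists>v\<in>V. n v \<noteq> n (v * \<omega>)"
  proof (rule ccontr)
    assume "\<not> ?thesis"
    then have eq: "n v = n (v * \<omega>)" if "v \<in> V" for v using that by blast
    have \<omega>0: "\<omega> \<noteq> 0" using \<omega>(1) p0 by (auto simp: power_0_left)
    have inj\<omega>: "inj_on (\<lambda>v. v * \<omega>) V" using \<omega>0 by (auto simp: inj_on_def)
    have "(\<lambda>v. v * \<omega>) ` V = V"
      using finV inj\<omega> \<omega>(1) by (intro endo_inj_surj) (auto simp: V_def power_mult_distrib)
    then have "(\<Sum>v\<in>V. of_nat (n v) * v) = (\<Sum>v\<in>(\<lambda>v. v * \<omega>) ` V. of_nat (n v) * v)" by simp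
    also have "\<dots> = (\<Sum>v\<in>V. of_nat (n (v * \<omega>)) * (v * \<omega>))" by (simp only: sum.reindex[OF inj\<omega>] o_def)
    also have "\<dots> = (\<Sum>v\<in>V. (of_nat (n v) * v) * \<omega>)"
      by (intro sum.cong refl) (simp only: eq[symmetric] mult.assoc)
    also have "\<dots> = (\<Sum>v\<in>V. of_nat (n v) * v) * \<omega>" by (rule sum_distrib_right[symmetric])
    finally have "(\<Sum>v\<in>V. of_nat (n v) * v) = 0" using \<omega>(2) by simp
    then show False using c S by simp
  qed
  then obtain v where v: "v \<in> V" "n v \<noteq> n (v * \<omega>)" by blast
  have zero_or_p: "i = 0 \<or> i = p" if "p dvd i" "i \<le> p" for i using that by (auto dest: dvd_imp_le)
  \<comment> \<open>Different numbers from 0 to \<open>p\<close> that are congruent modulo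
    \<open>p\<close> must be 0 and \<open>p\<close>. The fibre of size \<open>p\<close> shows that
    the kernel has \<open>p\<close> elements.\<close>
  have np: "(n v = 0 \<and> n (v * \<omega>) = p) \<or> (n v = p \<and> n (v * \<omega>) = 0)"
  proof (cases "n v \<le> n (v * \<omega>)")
    case True
    have "int p dvd int (n (v * \<omega>)) - int (n v)" using n_cong[OF \<omega>(1), of v] by (simp only: dvd_diff_commute)
    then have "p dvd n (v * \<omega>) - n v" using True by (metis int_dvd_int_iff of_nat_diff)
    then have "n (v * \<omega>) - n v = p" using v(2) True n_le[of "v * \<omega>"] zero_or_p[of "n (v * \<omega>) - n v"] by linarith
    then show ?thesis using n_le[of "v * \<omega>"] p0 by arith
  next
    case False
    then have "p dvd n v - n (v * \<omega>)" using n_cong[OF \<omega>(1), of v] by (metis int_dvd_int_iff nat_le_linear of_nat_diff)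
    then have "n v - n (v * \<omega>) = p" using v(2) False n_le[of v] zero_or_p[of "n v - n (v * \<omega>)"] by linarith
    then show ?thesis using n_le[of v] p0 by arith
  qed
  then obtain u where u: "n u = p" by blast
  then have "{x\<in>A. \<chi> x = u} \<noteq> {}" using p0 unfolding n_def by (metis card.empty less_imp_neq)
  then obtain y where y: "y \<in> A" "\<chi> y = u" by blast
  have yG: "y \<in> carrier G" using y A by blast
  have "n u \<le> card {x\<in>carrier G. \<chi> x = \<chi> y}"
    unfolding n_def using A y finite_carrier by (intro card_mono) auto
  then have cardK: "card (kernel_of \<chi>) = p" using u card_fibre[OF \<chi> yG] K_le by simp
  have v0: "v \<noteq> 0"
  proof
    assume "v = 0"
    then have "v = v * \<omega>" by simp
    then show False using v(2) by metis
  qed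
  have c0: "c \<noteq> 0" using v v0 by (auto simp: V_def)
  \<comment> \<open>A nonempty fibre in the chosen group has \<open>p\<close> elements and is
    therefore a full coset of the kernel.\<close>
  have inv: "x \<otimes> \<kappa> \<in> A" if x: "x \<in> A" "\<chi> x ^ p = c" and \<kappa>: "\<kappa> \<in> kernel_of \<chi>" for x \<kappa>
  proof -
    have xG: "x \<in> carrier G" using x A by blast
    have "(\<chi> x / v) ^ p = 1" using x v c0 by (simp add: V_def power_divide)
    from n_cong[OF this, of v] have "int p dvd int (n v) - int (n (\<chi> x))" using v0 by simp
    moreover have "int p dvd int (n v)" using np by auto
    ultimately have "int p dvd int (n v) - (int (n v) - int (n (\<chi> x)))" by (rule dvd_diff[rotated])
    then have "p dvd n (\<chi> x)" by simp
    then have "n (\<chi> x) = 0 \<or> n (\<chi> x) = p" using n_le by (rule zero_or_p)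
    moreover have "n (\<chi> x) \<noteq> 0" using x finA by (auto simp: n_def)
    ultimately have "n (\<chi> x) = p" by blast
    then have "{w\<in>A. \<chi> w = \<chi> x} = {w\<in>carrier G. \<chi> w = \<chi> x}"
      using A finite_carrier card_fibre[OF \<chi> xG] cardK unfolding n_def by (intro card_subset_eq) auto
    moreover have "x \<otimes> \<kappa> \<in> {w\<in>carrier G. \<chi> w = \<chi> x}" using xG \<kappa> \<chi> by (auto simp: kernel_of_def char_mult)
    ultimately show ?thesis by blast
  qed
  have "carrier G = (\<lambda>(a, x). h [^] a \<otimes> x) ` ({..<p\<^sup>2} \<times> kernel_of \<chi>)"
    using card_times_le(2)[OF \<chi> h K inj finite_carrier memb] cG cardK by simp
  then show ?thesis using cardK c inv by blast
qed

text \<open>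
  Suppose \<open>z = h\<^sup>p\<close> has order \<open>p\<close>. Then \<open>x \<mapsto> x\<^sup>p\<close> has at most \<open>p\<close> fibres. The characters
  \<open>\<chi>\<^sub>0 \<psi>\<^sup>j\<close> with \<open>j < p\<close> are nontrivial on \<open>z\<close>, so each of them picks a fibre on which \<open>A\<close> is
  invariant under its kernel. These fibres are distinct, hence exhaust \<open>G\<close>, and \<open>\<psi>\<close>, being
  nontrivial on all these kernels, vanishes on \<open>A\<close>.
\<close>
lemma exponent_p_of_norm_dvd:
  assumes s: "s = 2" and A: "A \<subseteq> carrier G"
    and norm: "\<And>\<chi>. \<chi> \<in> chars \<Longrightarrow> \<chi> \<noteq> trivial_char \<Longrightarrow>
      \<exists>n. char_sum \<chi> A * cnj (char_sum \<chi> A) = of_int (int p ^ 2 * n)"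
    and nz: "\<And>\<chi>. \<chi> \<in> chars \<Longrightarrow> \<chi> \<noteq> trivial_char \<Longrightarrow> char_sum \<chi> A \<noteq> 0"
    and g: "g \<in> carrier G"
  shows "g [^] p = \<one>"
proof (rule ccontr)
  assume gp: "g [^] p \<noteq> \<one>"
  have p0: "p > 0" and p1: "p > 1" using p_ge2 by auto
  have gN: "((g [^] p) [^] p) [^] p = \<one>"
    using pow_order_eq_1[OF g] g unfolding order_G s by (simp add: nat_pow_pow eval_nat_numeral mult.assoc)
  \<comment> \<open>The order of g divides p^3, so g or its p-th power has order p^2 and serves as
    \<open>h\<close>.\<close>
  obtain h where h: "h \<in> carrier G" and z1: "h [^] p \<noteq> \<one>" and zp: "(h [^] p) [^] p = \<one>"
  proof (cases "(g [^] p) [^] p = \<one>")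
    case True
    then show ?thesis using that g gp by blast
  next
    case False
    then show ?thesis using that[of "g [^] p"] g gN by simp
  qed
  define z where "z = h [^] p"
  have z: "z \<in> carrier G" "z [^] p = \<one>" "z \<noteq> \<one>" using h z1 zp by (simp_all add: z_def)
  have nontriv: "\<chi> \<noteq> trivial_char" if "\<chi> z \<noteq> 1" for \<chi> using that z by (auto simp: trivial_char_def)
  have good: "card (kernel_of \<chi>) = p \<and>
      (\<exists>c. char_sum \<chi> {x\<in>A. \<chi> x ^ p = c} \<noteq> 0 \<and>
        (\<forall>x\<in>A. \<chi> x ^ p = c \<longrightarrow> (\<forall>\<kappa>\<in>kernel_of \<chi>. x \<otimes> \<kappa> \<in> A))) \<and>
      carrier G = (\<lambda>(a, x). h [^] a \<otimes> x) ` ({..<p\<^sup>2} \<times> kernel_of \<chi>)"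
    if \<chi>: "\<chi> \<in> chars" "\<chi> z \<noteq> 1" for \<chi>
  proof -
    have nt: "\<chi> \<noteq> trivial_char" using nontriv \<chi>(2) by blast
    obtain n where n: "char_sum \<chi> A * cnj (char_sum \<chi> A) = of_int (int p ^ 2 * n)"
      using norm[OF \<chi>(1) nt] by blast
    have "\<chi> (h [^] p) \<noteq> 1" using \<chi>(2) by (simp add: z_def)
    then show ?thesis by (rule kernel_invariant_part[OF s A h zp \<chi>(1) _ n nz[OF \<chi>(1) nt]])
  qed
  have card_kernel: "card (kernel_of \<chi>) = p" if "\<chi> \<in> chars" "\<chi> z \<noteq> 1" for \<chi>
    using good[OF that] by blast
  have kernel_pow: "\<kappa> \<in> carrier G \<and> \<kappa> [^] p = \<one>" if "\<chi> \<in> chars" "\<chi> z \<noteq> 1" "\<kappa> \<in> kernel_of \<chi>" for \<chi> \<kappa>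
  proof
    show "\<kappa> \<in> carrier G" using that(3) by (simp add: kernel_of_def)
    show "\<kappa> [^] p = \<one>"
      using subgroup_pow_card[OF kernel_of_subgroup[OF that(1)] that(3)] unfolding card_kernel[OF that(1,2)] .
  qed
  obtain \<chi>0 where \<chi>0: "\<chi>0 \<in> chars" "\<chi>0 z \<noteq> 1" using separating_char[OF z(1,3)] by blast
  define \<omega> where "\<omega> = \<chi>0 z"
  have \<omega>: "\<omega> ^ p = 1" "\<omega> \<noteq> 1"
    using char_nat_pow[OF \<chi>0(1) z(1), of p] z(2) \<chi>0 by (simp_all add: \<omega>_def)
  \<comment> \<open>The kernel of \<open>\<chi>0\<close> has exponent \<open>p\<close>, so the p-th
    power of an element depends only on its exponent of \<open>h\<close>.\<close>
  have pow_p: "\<exists>r<p. x [^] p = z [^] r" if x: "x \<in> carrier G" for x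
  proof -
    have "x \<in> (\<lambda>(a, x). h [^] a \<otimes> x) ` ({..<p\<^sup>2} \<times> kernel_of \<chi>0)" using good[OF \<chi>0] x by blast
    then obtain a :: nat and \<kappa> where a: "x = h [^] a \<otimes> \<kappa>" "\<kappa> \<in> kernel_of \<chi>0" by auto
    have \<kappa>: "\<kappa> \<in> carrier G" "\<kappa> [^] p = \<one>" using kernel_pow[OF \<chi>0 a(2)] by auto
    have "x [^] p = (h [^] a) [^] p \<otimes> \<kappa> [^] p" using a \<kappa> h by (simp add: nat_pow_distrib)
    also have "\<dots> = z [^] (p * (a div p) + a mod p)" using \<kappa> h by (simp add: z_def nat_pow_pow mult.commute)
    also have "\<dots> = (z [^] p) [^] (a div p) \<otimes> z [^] (a mod p)"
      by (simp only: nat_pow_pow[OF z(1)] nat_pow_mult[OF z(1)])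
    also have "\<dots> = z [^] (a mod p)" using z by simp
    finally show ?thesis using p0 by (intro exI[of _ "a mod p"]) simp
  qed
  have z_inj: "i = j" if "z [^] i = z [^] j" "i < p" "j < p" for i j :: nat
  proof -
    have "\<omega> ^ i = \<omega> ^ j" using arg_cong[OF that(1), of \<chi>0] char_nat_pow[OF \<chi>0(1) z(1)] by (simp add: \<omega>_def)
    then show ?thesis using prime_root_power_eq[OF prime_p \<omega>] that by blast
  qed
  have "\<exists>\<kappa>\<in>kernel_of \<chi>0. \<kappa> \<noteq> \<one>"
  proof (rule ccontr)
    assume "\<not> ?thesis"
    then have "kernel_of \<chi>0 \<subseteq> {\<one>}" by blast
    then have "card (kernel_of \<chi>0) \<le> card {\<one>}" by (intro card_mono) auto
    then show False using card_kernel[OF \<chi>0] p1 by simp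
  qed
  then obtain \<kappa>0 where \<kappa>0: "\<kappa>0 \<in> kernel_of \<chi>0" "\<kappa>0 \<noteq> \<one>" by blast
  have \<kappa>0': "\<kappa>0 \<in> carrier G" "\<chi>0 \<kappa>0 = 1" using \<kappa>0 by (auto simp: kernel_of_def)
  have "\<exists>\<psi>\<in>chars. \<psi> z = 1 \<and> \<psi> \<kappa>0 \<noteq> 1"
  proof (rule ex_char_trivial_on[OF prime_p z(1,2) \<kappa>0'(1)])
    fix j assume j: "j < p"
    show "\<kappa>0 \<otimes> z [^] j \<noteq> \<one>"
    proof
      assume eq: "\<kappa>0 \<otimes> z [^] j = \<one>"
      from arg_cong[OF eq, of \<chi>0] have "\<omega> ^ j = \<omega> ^ 0"
        using \<chi>0 \<kappa>0' z by (simp add: char_mult char_nat_pow \<omega>_def)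
      then have "j = 0" using prime_root_power_eq[OF prime_p \<omega>] j p0 by blast
      then show False using eq \<kappa>0 \<kappa>0' by simp
    qed
  qed
  then obtain \<psi> where \<psi>: "\<psi> \<in> chars" "\<psi> z = 1" "\<psi> \<kappa>0 \<noteq> 1" by blast
  have \<psi>p: "\<psi> x ^ p = 1" if x: "x \<in> carrier G" for x
  proof -
    obtain r :: nat where "x [^] p = z [^] r" using pow_p[OF x] by blast
    then have "\<psi> (x [^] p) = \<psi> (z [^] r)" by simp
    then show ?thesis using char_nat_pow[OF \<psi>(1)] x z(1) \<psi>(2) by simp
  qed
  \<comment> \<open>\<open>\<psi>\<close> takes \<open>p\<close> different values on the kernel of
    \<open>\<chi>0\<close>, which has only \<open>p\<close> elements, so it is injective
    there.\<close>
  have sep: "x = \<one>" if x: "x \<in> carrier G" "\<chi>0 x = 1" "\<psi> x = 1" for x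
  proof -
    define L where "L = kernel_of \<chi>0 \<inter> kernel_of \<psi>"
    have L: "L \<subseteq> carrier G" "\<And>x. x \<in> L \<Longrightarrow> \<psi> x = 1" by (auto simp: L_def kernel_of_def)
    have inj: "inj_on (\<lambda>a. \<psi> \<kappa>0 ^ a) {..<p}"
      using prime_root_power_eq[OF prime_p \<psi>p[OF \<kappa>0'(1)] \<psi>(3)] by (auto intro: inj_onI)
    have fin: "finite (kernel_of \<chi>0)" using finite_carrier by (simp add: kernel_of_def)
    have "\<kappa>0 [^] a \<otimes> y \<in> kernel_of \<chi>0" if "y \<in> L" for a :: nat and y
      using that \<kappa>0' \<chi>0 by (auto simp: L_def kernel_of_def char_mult char_nat_pow)
    then have "p * card L \<le> p"
      using card_times_le(1)[OF \<psi>(1) \<kappa>0'(1) L inj fin] card_kernel[OF \<chi>0] by simp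
    then have "card L \<le> 1" using p0 by simp
    moreover have "finite L" using L(1) finite_carrier finite_subset by blast
    moreover have "x \<in> L" "\<one> \<in> L" using x \<chi>0(1) \<psi>(1) by (auto simp: L_def kernel_of_def)
    ultimately show ?thesis using card_le_Suc0_iff_eq[of L] by auto
  qed
  define \<chi> where "\<chi> j = char_times \<chi>0 (char_pow \<psi> j)" for j
  have \<chi>_val: "\<chi> j x = \<chi>0 x * \<psi> x ^ j" if "x \<in> carrier G" for j x
    using that by (simp add: \<chi>_def char_times_def char_pow_def)
  have \<chi>: "\<chi> j \<in> chars" "\<chi> j z \<noteq> 1" for j
    using \<chi>0 \<psi> z by (simp_all add: \<chi>_val) (simp add: \<chi>_def)
  have cross: "\<kappa> = \<one>" if \<kappa>: "\<kappa> \<in> kernel_of (\<chi> i)" "\<chi> j \<kappa> = 1" "i < p" "j < p" "i \<noteq> j" for i j \<kappa>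
  proof -
    have c: "\<kappa> \<in> carrier G" "\<chi> i \<kappa> = 1" using \<kappa> by (auto simp: kernel_of_def)
    have "\<chi>0 \<kappa> * \<psi> \<kappa> ^ i = \<chi>0 \<kappa> * \<psi> \<kappa> ^ j" using c \<kappa> by (simp add: \<chi>_val)
    then have "\<psi> \<kappa> ^ i = \<psi> \<kappa> ^ j" using char_nonzero[OF \<chi>0(1) c(1)] by simp
    then have "\<psi> \<kappa> = 1" using prime_root_power_eq[OF prime_p \<psi>p[OF c(1)]] \<kappa> by blast
    moreover from this have "\<chi>0 \<kappa> = 1" using c by (simp add: \<chi>_val)
    ultimately show ?thesis using sep c by blast
  qed
  have cross_psi: "\<kappa> = \<one>" if \<kappa>: "\<kappa> \<in> kernel_of (\<chi> i)" "\<psi> \<kappa> = 1" for i \<kappa>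
  proof -
    have c: "\<kappa> \<in> carrier G" "\<chi> i \<kappa> = 1" using \<kappa> by (auto simp: kernel_of_def)
    then have "\<chi>0 \<kappa> = 1" using \<kappa> by (simp add: \<chi>_val)
    then show ?thesis using sep c \<kappa> by blast
  qed
  have ker_ne: "\<exists>\<kappa>\<in>kernel_of (\<chi> i). \<kappa> \<noteq> \<one>" for i
  proof (rule ccontr)
    assume "\<not> ?thesis"
    then have "kernel_of (\<chi> i) \<subseteq> {\<one>}" by blast
    then have "card (kernel_of (\<chi> i)) \<le> card {\<one>}" by (intro card_mono) auto
    then show False using card_kernel[OF \<chi>] p1 by simp
  qed
  define F where "F r = {x\<in>A. x [^] p = z [^] r}" for r :: nat
  have F_sub: "F r \<subseteq> carrier G" for r using A by (auto simp: F_def)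
  have "\<exists>r<p. char_sum (\<chi> j) (F r) \<noteq> 0 \<and> (\<forall>x\<in>F r. \<forall>\<kappa>\<in>kernel_of (\<chi> j). x \<otimes> \<kappa> \<in> F r)" for j
  proof -
    obtain c where c: "char_sum (\<chi> j) {x\<in>A. \<chi> j x ^ p = c} \<noteq> 0"
      and inv: "\<And>x \<kappa>. x \<in> A \<Longrightarrow> \<chi> j x ^ p = c \<Longrightarrow> \<kappa> \<in> kernel_of (\<chi> j) \<Longrightarrow> x \<otimes> \<kappa> \<in> A"
      using good[OF \<chi>, of j] by blast
    have "{x\<in>A. \<chi> j x ^ p = c} \<noteq> {}"
    proof
      assume empty: "{x\<in>A. \<chi> j x ^ p = c} = {}"
      show False using c unfolding empty by (simp add: char_sum_def)
    qed
    then obtain y where y: "y \<in> A" "\<chi> j y ^ p = c" by blast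
    have yG: "y \<in> carrier G" using y A by blast
    obtain r where r: "r < p" "y [^] p = z [^] r" using pow_p[OF yG] by blast
    define \<omega>' where "\<omega>' = \<chi> j z"
    have \<omega>': "\<omega>' ^ p = 1" "\<omega>' \<noteq> 1"
      using char_nat_pow[OF \<chi>(1)[of j] z(1), of p] z(2) \<chi>[of j] by (simp_all add: \<omega>'_def)
    have pw: "\<chi> j x ^ p = \<omega>' ^ i" if "x \<in> carrier G" "x [^] p = z [^] i" for x and i :: nat
      using arg_cong[OF that(2), of "\<chi> j"] char_nat_pow[OF \<chi>(1)[of j]] that(1) z(1) by (simp add: \<omega>'_def)
    have c_eq: "c = \<omega>' ^ r" using pw[OF yG r(2)] y by simp
    \<comment> \<open>The value c determines one exponent \<open>r\<close>, since
      \<open>\<chi> j\<close> is injective on the powers of z.\<close>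
    have eq: "{x\<in>A. \<chi> j x ^ p = c} = F r"
    proof -
      have "\<chi> j x ^ p = c \<longleftrightarrow> x [^] p = z [^] r" if x: "x \<in> A" for x
      proof
        have xG: "x \<in> carrier G" using x A by blast
        obtain i where i: "i < p" "x [^] p = z [^] i" using pow_p[OF xG] by blast
        assume "\<chi> j x ^ p = c"
        then have "\<omega>' ^ i = \<omega>' ^ r" using pw[OF xG i(2)] c_eq by simp
        then have "i = r" using prime_root_power_eq[OF prime_p \<omega>'] i r by blast
        then show "x [^] p = z [^] r" using i by simp
      next
        assume "x [^] p = z [^] r"
        then show "\<chi> j x ^ p = c" using pw x A c_eq by blast
      qed
      then show ?thesis unfolding F_def by blast
    qed
    have "x \<otimes> \<kappa> \<in> F r" if x: "x \<in> F r" and \<kappa>: "\<kappa> \<in> kernel_of (\<chi> j)" for x \<kappa>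
    proof -
      have xG: "x \<in> carrier G" using x F_sub by blast
      have \<kappa>G: "\<kappa> \<in> carrier G" "\<kappa> [^] p = \<one>" using kernel_pow[OF \<chi> \<kappa>] by auto
      have "x \<otimes> \<kappa> \<in> A" using x \<kappa> unfolding eq[symmetric] by (auto intro: inv)
      moreover have "(x \<otimes> \<kappa>) [^] p = z [^] r" using x xG \<kappa>G z(1) by (simp add: nat_pow_distrib F_def)
      ultimately show ?thesis by (simp add: F_def)
    qed
    then show ?thesis using c r(1) unfolding eq by blast
  qed
  then obtain r where r: "\<And>j. r j < p" "\<And>j. char_sum (\<chi> j) (F (r j)) \<noteq> 0"
    "\<And>j x \<kappa>. x \<in> F (r j) \<Longrightarrow> \<kappa> \<in> kernel_of (\<chi> j) \<Longrightarrow> x \<otimes> \<kappa> \<in> F (r j)" by metis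
  \<comment> \<open>If two indices shared a fibre, its invariance under the kernel for the first
    would make the sum for the second vanish.\<close>
  have "inj_on r {..<p}"
  proof (rule inj_onI, rule ccontr)
    fix i j assume ij: "i \<in> {..<p}" "j \<in> {..<p}" "r i = r j" "i \<noteq> j"
    obtain \<kappa> where \<kappa>: "\<kappa> \<in> kernel_of (\<chi> i)" "\<kappa> \<noteq> \<one>" using ker_ne by blast
    have ne: "\<chi> j \<kappa> \<noteq> 1" using cross[OF \<kappa>(1)] ij \<kappa>(2) by blast
    have \<kappa>G: "\<kappa> \<in> carrier G" using \<kappa> by (simp add: kernel_of_def)
    have "char_sum (\<chi> j) (F (r i)) = 0"
      by (rule char_sum_invariant_zero[OF F_sub \<chi>(1) \<kappa>G ne]) (rule r(3)[OF _ \<kappa>(1)])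
    then show False using r(2)[of j] ij by simp
  qed
  then have r_surj: "r ` {..<p} = {..<p}" using r(1) by (intro endo_inj_surj) auto
  have finA: "finite A" using A finite_carrier finite_subset by blast
  have "A = (\<Union>i<p. F i)"
  proof
    show "A \<subseteq> (\<Union>i<p. F i)"
    proof
      fix x assume x: "x \<in> A"
      then obtain i where "i < p" "x [^] p = z [^] i" using A pow_p by blast
      then show "x \<in> (\<Union>i<p. F i)" using x by (auto simp: F_def)
    qed
    show "(\<Union>i<p. F i) \<subseteq> A" by (auto simp: F_def)
  qed
  then have "char_sum \<psi> A = char_sum \<psi> (\<Union>i<p. F i)" by simp
  also have "\<dots> = (\<Sum>i<p. char_sum \<psi> (F i))"
    unfolding char_sum_def
  proof (rule sum.UNION_disjoint)
    show "\<forall>i\<in>{..<p}. finite (F i)" using finA by (simp add: F_def)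
    show "\<forall>i\<in>{..<p}. \<forall>j\<in>{..<p}. i \<noteq> j \<longrightarrow> F i \<inter> F j = {}"
    proof (intro ballI impI)
      fix i j assume ij: "i \<in> {..<p}" "j \<in> {..<p}" "i \<noteq> j"
      then have "z [^] i \<noteq> z [^] j" using z_inj[of i j] by auto
      then show "F i \<inter> F j = {}" by (auto simp: F_def)
    qed
  qed simp
  \<comment> \<open>Every fibre now has the form \<open>F (r j)\<close> and is invariant under a
    kernel on which \<open>\<psi>\<close> is nontrivial.\<close>
  also have "\<dots> = 0"
  proof (rule sum.neutral, rule ballI)
    fix i assume "i \<in> {..<p}"
    then obtain j where j: "i = r j" using r_surj by blast
    obtain \<kappa> where \<kappa>: "\<kappa> \<in> kernel_of (\<chi> j)" "\<kappa> \<noteq> \<one>" using ker_ne by blast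
    have ne: "\<psi> \<kappa> \<noteq> 1" using cross_psi[OF \<kappa>(1)] \<kappa>(2) by blast
    have \<kappa>G: "\<kappa> \<in> carrier G" using \<kappa> by (simp add: kernel_of_def)
    show "char_sum \<psi> (F i) = 0"
      unfolding j by (rule char_sum_invariant_zero[OF F_sub \<psi>(1) \<kappa>G ne]) (rule r(3)[OF _ \<kappa>(1)])
  qed
  finally have "char_sum \<psi> A = 0" .
  moreover have "\<psi> \<noteq> trivial_char" using \<psi>(3) \<kappa>0'(1) by (auto simp: trivial_char_def)
  ultimately show False using nz \<psi>(1) by blast
qed

end

section \<open>Elementary abelian groups of order p^3\<close>

lemma (in comm_group) pow_in_closed_imp_dvd:
  fixes p :: nat and d :: int
  assumes p: "prime p" and x: "x \<in> carrier G" "x [^] p = \<one>" and nx: "x \<notin> H"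
    and H: "H \<subseteq> carrier G" "\<And>y (u::int). y \<in> H \<Longrightarrow> y [^] u \<in> H" and d: "x [^] d \<in> H"
  shows "int p dvd d"
proof (rule ccontr)
  assume "\<not> int p dvd d"
  then have "coprime (int p) d" using p by (intro prime_imp_coprime) auto
  then obtain u v where uv: "u * int p + v * d = 1" using bezout_int[of "int p" d] by auto
  have "x = x [^] (int p * u + d * v)" using uv x by (simp add: mult.commute)
  also have "\<dots> = (x [^] int p) [^] u \<otimes> (x [^] d) [^] v" using x by (simp only: int_pow_mult int_pow_pow)
  also have "\<dots> = (x [^] d) [^] v" using x by (simp add: int_pow_int)
  finally have "x \<in> H" using H(2)[OF d, of v] by simp
  with nx show False by simp
qed

text \<open>Three generators are chosen greedily, each outside the span of the previous ones, which
  has fewer than p^3 elements. A relation between them is resolved from the last generator back to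
  the first, so the exponent map is injective, and bijective by counting.\<close>

lemma (in comm_group) elementary_abelian_cube_iso:
  fixes p :: nat
  assumes p: "prime p" and card: "card (carrier G) = p ^ 3"
    and exponent: "\<And>x. x \<in> carrier G \<Longrightarrow> x [^] p = \<one>"
  shows "G \<cong> product_group {..<3::nat} (\<lambda>_. integer_mod_group p)"
proof -
  have p1: "p > 1" using p prime_gt_1_nat by blast
  have fin: "finite (carrier G)" using card p1 by (intro card_ge_0_finite) simp
  have pow_mod: "x [^] (i mod int p) = x [^] i" if x: "x \<in> carrier G" for x and i :: int
  proof -
    have "x [^] i = x [^] (int p * (i div int p) + i mod int p)" by simp
    also have "\<dots> = (x [^] int p) [^] (i div int p) \<otimes> x [^] (i mod int p)"
      using x by (simp only: int_pow_mult int_pow_pow)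
    also have "\<dots> = x [^] (i mod int p)" using x exponent by (simp add: int_pow_int)
    finally show ?thesis by simp
  qed
  define H1 where "H1 g = range (\<lambda>a::int. g [^] a)" for g
  define H2 where "H2 g h = (\<lambda>(a, b). g [^] a \<otimes> h [^] b) ` (UNIV :: (int \<times> int) set)" for g h
  have card_H1: "card (H1 g) \<le> p" if g: "g \<in> carrier G" for g
  proof -
    have "H1 g \<subseteq> (\<lambda>a. g [^] a) ` {0..<int p}"
    proof
      fix y assume "y \<in> H1 g"
      then obtain a :: int where "y = g [^] (a mod int p)" using pow_mod[OF g] by (auto simp: H1_def)
      then show "y \<in> (\<lambda>a. g [^] a) ` {0..<int p}" using p1 by auto
    qed
    then have "card (H1 g) \<le> card {0..<int p}" by (intro surj_card_le) auto
    then show ?thesis by simp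
  qed
  have card_H2: "card (H2 g h) \<le> p\<^sup>2" if g: "g \<in> carrier G" and h: "h \<in> carrier G" for g h
  proof -
    have "H2 g h \<subseteq> (\<lambda>(a, b). g [^] a \<otimes> h [^] b) ` ({0..<int p} \<times> {0..<int p})"
    proof
      fix y assume "y \<in> H2 g h"
      then obtain a b :: int where "y = g [^] (a mod int p) \<otimes> h [^] (b mod int p)"
        using pow_mod[OF g] pow_mod[OF h] by (auto simp: H2_def)
      then show "y \<in> (\<lambda>(a, b). g [^] a \<otimes> h [^] b) ` ({0..<int p} \<times> {0..<int p})"
        using p1 by (intro image_eqI[of _ _ "(a mod int p, b mod int p)"]) auto
    qed
    then have "card (H2 g h) \<le> card ({0..<int p} \<times> {0..<int p})" by (intro surj_card_le) auto
    then show ?thesis by (simp add: power2_eq_square)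
  qed
  have ex_notin: "\<exists>x\<in>carrier G. x \<notin> H" if "card H < p ^ 3" "finite H" for H
  proof (rule ccontr)
    assume "\<not> ?thesis"
    then have "carrier G \<subseteq> H" by blast
    then have "card (carrier G) \<le> card H" using that(2) by (intro card_mono)
    then show False using that(1) card by simp
  qed
  have p3: "1 < p ^ 3" "p < p ^ 3" "p\<^sup>2 < p ^ 3"
    using p1 power_strict_increasing[of 0 3 p] power_strict_increasing[of 1 3 p]
      power_strict_increasing[of 2 3 p] by simp_all
  have H1_sub: "H1 g \<subseteq> carrier G" if "g \<in> carrier G" for g using that by (auto simp: H1_def)
  have H2_sub: "H2 g h \<subseteq> carrier G" if "g \<in> carrier G" "h \<in> carrier G" for g h using that by (auto simp: H2_def)
  obtain g1 where g1: "g1 \<in> carrier G" "g1 \<notin> {\<one>}" using ex_notin[of "{\<one>}"] p3 by auto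
  obtain g2 where g2: "g2 \<in> carrier G" "g2 \<notin> H1 g1"
    using ex_notin[of "H1 g1"] card_H1[OF g1(1)] p3 finite_subset[OF H1_sub[OF g1(1)] fin] by force
  obtain g3 where g3: "g3 \<in> carrier G" "g3 \<notin> H2 g1 g2"
    using ex_notin[of "H2 g1 g2"] card_H2[OF g1(1) g2(1)] p3 finite_subset[OF H2_sub[OF g1(1) g2(1)] fin] by force
  have H1_closed: "y [^] u \<in> H1 g1" if "y \<in> H1 g1" for y and u :: int
    using that g1 by (auto simp: H1_def int_pow_pow)
  have H2_closed: "y [^] u \<in> H2 g1 g2" if y: "y \<in> H2 g1 g2" for y and u :: int
  proof -
    obtain a b :: int where "y = g1 [^] a \<otimes> g2 [^] b" using y by (auto simp: H2_def)
    then have "y [^] u = g1 [^] (a * u) \<otimes> g2 [^] (b * u)" using g1 g2 by (simp add: int_pow_distrib int_pow_pow)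
    then show ?thesis by (auto simp: H2_def)
  qed
  define \<Psi> where "\<Psi> a b c = g1 [^] a \<otimes> (g2 [^] b \<otimes> g3 [^] c)" for a b c :: int
  have \<Psi>_closed: "\<Psi> a b c \<in> carrier G" for a b c using g1 g2 g3 by (simp add: \<Psi>_def)
  have \<Psi>_add: "\<Psi> (a + a') (b + b') (c + c') = \<Psi> a b c \<otimes> \<Psi> a' b' c'" for a b c a' b' c'
    using g1(1) g2(1) g3(1) by (simp add: \<Psi>_def int_pow_mult m_ac)
  have small: "d = 0" if "int p dvd d" "\<bar>d\<bar> < int p" for d
  proof (rule ccontr)
    assume "d \<noteq> 0"
    then have "\<bar>int p\<bar> \<le> \<bar>d\<bar>" using that(1) by (rule dvd_imp_le_int)
    then show False using that(2) by simp
  qed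
  have \<Psi>_one: "a = 0 \<and> b = 0 \<and> c = 0"
    if one: "\<Psi> a b c = \<one>" and bounds: "\<bar>a\<bar> < int p" "\<bar>b\<bar> < int p" "\<bar>c\<bar> < int p" for a b c
  proof -
    have "g3 [^] c \<otimes> (g1 [^] a \<otimes> g2 [^] b) = \<one>" using one g1(1) g2(1) g3(1) by (simp add: \<Psi>_def m_ac)
    then have "g3 [^] c = inv (g1 [^] a \<otimes> g2 [^] b)" using g1 g2 g3 by (intro inv_equality[symmetric]) auto
    also have "\<dots> = (g1 [^] a \<otimes> g2 [^] b) [^] (- 1 :: int)" using g1 g2 by (simp add: int_pow_neg)
    also have "\<dots> \<in> H2 g1 g2" by (rule H2_closed) (auto simp: H2_def)
    finally have "int p dvd c"
      by (intro pow_in_closed_imp_dvd[OF p g3(1) exponent[OF g3(1)] g3(2) H2_sub[OF g1(1) g2(1)] H2_closed])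
    then have c: "c = 0" using small bounds by blast
    have "g2 [^] b \<otimes> g1 [^] a = \<one>" using one g1(1) g2(1) c by (simp add: \<Psi>_def m_ac)
    then have "g2 [^] b = inv (g1 [^] a)" using g1 g2 by (intro inv_equality[symmetric]) auto
    also have "\<dots> = g1 [^] (- a)" using g1 by (simp add: int_pow_neg)
    also have "\<dots> \<in> H1 g1" by (simp add: H1_def)
    finally have "int p dvd b"
      by (intro pow_in_closed_imp_dvd[OF p g2(1) exponent[OF g2(1)] g2(2) H1_sub[OF g1(1)] H1_closed])
    then have b: "b = 0" using small bounds by blast
    have "g1 [^] a \<in> {\<one>}" using one g1(1) b c by (simp add: \<Psi>_def)
    then have "int p dvd a"
      by (intro pow_in_closed_imp_dvd[OF p g1(1) exponent[OF g1(1)] g1(2)]) auto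
    then show ?thesis using small bounds b c by blast
  qed
  define P where "P = product_group {..<3::nat} (\<lambda>_. integer_mod_group p)"
  define \<Phi> where "\<Phi> f = \<Psi> (f 0) (f 1) (f 2)" for f :: "nat \<Rightarrow> int"
  have carrier_P: "carrier P = (\<Pi>\<^sub>E i\<in>{..<3::nat}. {0..<int p})"
    using p1 by (simp add: P_def carrier_integer_mod_group)
  have inj: "inj_on \<Phi> (carrier P)"
  proof (rule inj_onI)
    fix f f' assume f: "f \<in> carrier P" "f' \<in> carrier P" "\<Phi> f = \<Phi> f'"
    have range: "0 \<le> f i \<and> f i < int p \<and> 0 \<le> f' i \<and> f' i < int p" if "i < 3" for i
      using f that by (auto simp: carrier_P PiE_iff)
    have "\<Psi> (f 0 - f' 0) (f 1 - f' 1) (f 2 - f' 2) \<otimes> \<Phi> f' = \<Phi> f"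
      unfolding \<Phi>_def \<Psi>_add[symmetric] by simp
    then have "\<Psi> (f 0 - f' 0) (f 1 - f' 1) (f 2 - f' 2) \<otimes> \<Phi> f' = \<one> \<otimes> \<Phi> f'"
      using f \<Psi>_closed by (simp add: \<Phi>_def)
    then have "\<Psi> (f 0 - f' 0) (f 1 - f' 1) (f 2 - f' 2) = \<one>"
      unfolding \<Phi>_def by (subst (asm) right_cancel) (use \<Psi>_closed in simp_all)
    then have "f 0 - f' 0 = 0 \<and> f 1 - f' 1 = 0 \<and> f 2 - f' 2 = 0"
      using range[of 0] range[of 1] range[of 2] by (intro \<Psi>_one) auto
    then have "f i = f' i" if "i < 3" for i using that by (auto simp: less_Suc_eq numeral_3_eq_3 numeral_2_eq_2)
    then show "f = f'" using f unfolding carrier_P by (intro PiE_ext) auto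
  qed
  have hom: "\<Phi> \<in> hom P G"
  proof (rule homI)
    show "\<Phi> f \<in> carrier G" for f using \<Psi>_closed by (simp add: \<Phi>_def)
    fix f f' assume "f \<in> carrier P" "f' \<in> carrier P"
    have "\<Phi> (f \<otimes>\<^bsub>P\<^esub> f') = \<Psi> ((f 0 + f' 0) mod int p) ((f 1 + f' 1) mod int p) ((f 2 + f' 2) mod int p)"
      by (simp add: \<Phi>_def P_def)
    also have "\<dots> = \<Psi> (f 0 + f' 0) (f 1 + f' 1) (f 2 + f' 2)"
      using g1 g2 g3 by (simp add: \<Psi>_def pow_mod)
    finally show "\<Phi> (f \<otimes>\<^bsub>P\<^esub> f') = \<Phi> f \<otimes> \<Phi> f'" by (simp add: \<Phi>_def \<Psi>_add)
  qed
  have "card (carrier P) = p ^ 3" unfolding carrier_P by (simp add: card_PiE)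
  then have "card (\<Phi> ` carrier P) = card (carrier G)" using card_image[OF inj] card by simp
  moreover have "\<Phi> ` carrier P \<subseteq> carrier G" using \<Psi>_closed by (auto simp: \<Phi>_def)
  ultimately have "\<Phi> ` carrier P = carrier G" using fin by (intro card_subset_eq)
  then have "\<Phi> \<in> iso P G" using hom inj by (simp add: iso_def bij_betw_def)
  then have "P \<cong> G" by (rule is_isoI)
  moreover have "group P" unfolding P_def by simp
  ultimately show ?thesis using group.iso_sym unfolding P_def by blast
qed

section \<open>SEDFs in groups of order \<open>p\<^sup>3\<close>\<close>

context sedf_cube
begin

text \<open>As q + q' <= m < p, the prime \<open>p\<close> divides neither q nor q'. Since p^2
  divides l = q q' w, it divides w and with it every squared norm.\<close>

lemma norm_dvd_p2:
  assumes \<chi>: "\<chi> \<in> chars" "\<chi> \<noteq> trivial_char" and i: "i \<in> {1..m}"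
  shows "\<exists>a. X \<chi> i * cnj (X \<chi> i) = of_int (int p ^ 2 * a)" and "X \<chi> i \<noteq> 0"
proof -
  obtain l' where l': "l = p\<^sup>2 * l'" "0 < l'" "m * l' < p" using parameters by blast
  have "(\<exists>a. X \<chi> i * cnj (X \<chi> i) = of_int (int p ^ 2 * a)) \<and> X \<chi> i * cnj (X \<chi> i) \<noteq> 0"
  proof (cases "T \<chi> = 0")
    case True
    then have "X \<chi> i * cnj (X \<chi> i) = of_nat l" using type_zero[OF \<chi> _ i] by blast
    moreover have "(of_nat l :: complex) = of_int (int p ^ 2 * int l')" using l' by simp
    ultimately show ?thesis using l_pos by (metis of_nat_eq_0_iff not_one_le_zero)
  next
    case False
    then obtain q q' h w where type: "nonzero_type \<chi> q q' h w" using ex_nonzero_type[OF \<chi>] by blast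
    then have q: "0 < q" "q < q'" "0 < h" "0 < w" and l: "l = q * q' * w" and m: "m = 2 + h * (q + q')"
      by (auto simp: nonzero_type_def)
    have "q + q' \<le> h * (q + q')" using q by simp
    also have "\<dots> \<le> m" by (subst m) simp
    also have "m \<le> m * l'" using l'(2) by simp
    also have "\<dots> < p" by (rule l'(3))
    finally have "q + q' < p" .
    then have "\<not> p dvd q" "\<not> p dvd q'" using q by (auto dest: dvd_imp_le)
    then have "coprime p q" "coprime p q'" using prime_imp_coprime[OF prime_p] by blast+
    then have "coprime (p\<^sup>2) (q * q')" by simp
    moreover have "p\<^sup>2 dvd (q * q') * w" using l l' by (metis dvd_triv_left)
    ultimately have "p\<^sup>2 dvd w" by (simp add: coprime_dvd_mult_right_iff)
    then obtain w' where w': "w = p\<^sup>2 * w'" by (auto elim: dvdE)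
    have "X \<chi> i * cnj (X \<chi> i) \<in> {of_nat (q'\<^sup>2 * w), of_nat (q\<^sup>2 * w), - of_nat l}"
      using nonzero_type_products[OF type i i] .
    moreover have "(of_nat (q'\<^sup>2 * w) :: complex) = of_int (int p ^ 2 * int (q'\<^sup>2 * w'))"
      "(of_nat (q\<^sup>2 * w) :: complex) = of_int (int p ^ 2 * int (q\<^sup>2 * w'))"
      "(- of_nat l :: complex) = of_int (int p ^ 2 * (- int l'))"
      by (simp_all add: w' l')
    moreover have "(of_nat (q'\<^sup>2 * w) :: complex) \<noteq> 0" "(of_nat (q\<^sup>2 * w) :: complex) \<noteq> 0" "(- of_nat l :: complex) \<noteq> 0"
      using q l_pos by auto
    ultimately show ?thesis by (metis empty_iff insert_iff)
  qed
  then show "\<exists>a. X \<chi> i * cnj (X \<chi> i) = of_int (int p ^ 2 * a)" "X \<chi> i \<noteq> 0" by auto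
qed

lemma iso_C_p_cubed: "G \<cong> product_group {..<3::nat} (\<lambda>_. integer_mod_group p)"
proof (rule elementary_abelian_cube_iso[OF prime_p])
  have 1: "1 \<in> {1..m}" using m_ge by simp
  show "card (carrier G) = p ^ 3" using order_G cube by (simp add: Coset.order_def)
  show "x [^] p = \<one>" if "x \<in> carrier G" for x
    using exponent_p_of_norm_dvd[OF refl D_subset[OF 1] norm_dvd_p2(1)[OF _ _ 1] norm_dvd_p2(2)[OF _ _ 1] that] .
qed

lemma ex_extremal: "\<exists>\<chi>\<in>chars. \<chi> \<noteq> trivial_char \<and> (\<exists>w. nonzero_type \<chi> 1 (m - 3) 1 w)"
proof (rule ex_extremal_char)
  obtain l' n where *: "3 * l' * (m - 1) = p - 1" "0 < n" "k = p * (3 * l' * n)" "3 * n\<^sup>2 = p\<^sup>2 + p + 1" "p > 3"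
    using parameters by blast
  have "int (3 * l' * (m - 1)) = int (p - 1)" using *(1) by simp
  then have "3 * int l' * (int m - 1) = int p - 1" using m_ge *(5) by (simp add: of_nat_diff)
  moreover have "int (3 * n\<^sup>2) = int (p\<^sup>2 + p + 1)" using *(4) by simp
  then have "3 * (int n)\<^sup>2 = (int p)\<^sup>2 + int p + 1" by simp
  ultimately have "3 * (int p * (3 * int l' * int n)) * (int m - 1) < 2 * int p ^ 3"
    using *(2,5) by (intro parameters_bound) auto
  then show "3 * int k * (int m - 1) < 2 * int p ^ Suc 2" using *(3) by (simp add: eval_nat_numeral)
qed

lemma norm_sq_eq: "X \<chi> i * cnj (X \<chi> i) = of_nat a \<Longrightarrow> (cmod (X \<chi> i))\<^sup>2 = real a"
  by (metis complex_norm_square of_real_eq_iff of_real_of_nat_eq)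

text \<open>In a nonzero type the least squared norm is l q / q', and q' <= m - 3 because m = 2 + h
  (q + q'). So it is at least l / (m - 3) = w, which the given character attains. If T vanishes the
  squared norm is l, and the trivial character has k^2 > l.\<close>

lemma a_min_eq:
  assumes \<chi>0: "\<chi>0 \<in> chars" and type0: "nonzero_type \<chi>0 1 (m - 3) 1 w"
  shows "a_min G m D = real w"
proof -
  have l: "l = (m - 3) * w" and m5: "m \<ge> 5" using type0 by (auto simp: nonzero_type_def)
  have ge: "real w \<le> (cmod (X \<chi> i))\<^sup>2" if \<chi>: "\<chi> \<in> chars" and i: "i \<in> {1..m}" for \<chi> i
  proof -
    have "1 * w \<le> (m - 3) * w" using m5 by (intro mult_le_mono1) linarith
    then have wl: "w \<le> l" by (simp only: l mult_1)
    consider "\<chi> = trivial_char" | "\<chi> \<noteq> trivial_char" "T \<chi> = 0" | "\<chi> \<noteq> trivial_char" "T \<chi> \<noteq> 0" by blast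
    then show ?thesis
    proof cases
      case 1
      have "X \<chi> i = of_nat k" unfolding 1 char_sum_trivial[OF D_subset[OF i]] card_D[OF i] ..
      then have "(cmod (X \<chi> i))\<^sup>2 = real (k * k)" by (simp add: power2_eq_square)
      moreover have "w \<le> k * k" using wl l_less_k by (meson le_square less_imp_le_nat order_trans)
      ultimately show ?thesis by (metis of_nat_le_iff)
    next
      case 2
      have "X \<chi> i * cnj (X \<chi> i) = of_nat l" using type_zero[OF \<chi> 2(1,2) i] .
      then have "(cmod (X \<chi> i))\<^sup>2 = real l" by (rule norm_sq_eq)
      then show ?thesis using wl by simp
    next
      case 3
      then obtain q q' h v where type: "nonzero_type \<chi> q q' h v" using ex_nonzero_type[OF \<chi>] by blast
      then have q: "0 < q" "q < q'" "0 < h" "0 < v" and lv: "l = q * q' * v" and m: "m = 2 + h * (q + q')"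
        by (auto simp: nonzero_type_def)
      have "q + q' \<le> h * (q + q')" using q by simp
      then have "q + q' + 2 \<le> m" by (subst m) simp
      then have "q' \<le> m - 3" using q by linarith
      also have "\<dots> \<le> q * (m - 3)" using q by simp
      finally have le: "q' \<le> q * (m - 3)" .
      have "(m - 3) * w = q * v * q'" using l lv by (simp add: mult_ac)
      also have "\<dots> \<le> q * v * (q * (m - 3))" using le by (rule mult_le_mono2)
      also have "\<dots> = (m - 3) * (q\<^sup>2 * v)" by (simp only: power2_eq_square mult_ac)
      finally have "(m - 3) * w \<le> (m - 3) * (q\<^sup>2 * v)" .
      then have wq: "w \<le> q\<^sup>2 * v" using m5 by simp
      also have "q\<^sup>2 * v \<le> q'\<^sup>2 * v" using q by (intro mult_right_mono power_mono) auto
      finally have wq': "w \<le> q'\<^sup>2 * v" .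
      have ne: "X \<chi> i * cnj (X \<chi> i) \<noteq> - of_nat l"
      proof
        assume "X \<chi> i * cnj (X \<chi> i) = - of_nat l"
        then have "of_real ((cmod (X \<chi> i))\<^sup>2) = (of_real (- real l) :: complex)"
          unfolding complex_norm_square by simp
        then have "(cmod (X \<chi> i))\<^sup>2 = - real l" by (simp only: of_real_eq_iff)
        then show False using l_pos by (metis neg_0_le_iff_le not_one_le_zero of_nat_le_0_iff zero_le_power2)
      qed
      have "X \<chi> i * cnj (X \<chi> i) \<in> {of_nat (q'\<^sup>2 * v), of_nat (q\<^sup>2 * v), - of_nat l}"
        using nonzero_type_products[OF type i i] .
      then have "X \<chi> i * cnj (X \<chi> i) = of_nat (q'\<^sup>2 * v) \<or> X \<chi> i * cnj (X \<chi> i) = of_nat (q\<^sup>2 * v)"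
        using ne by blast
      then have "(cmod (X \<chi> i))\<^sup>2 = real (q'\<^sup>2 * v) \<or> (cmod (X \<chi> i))\<^sup>2 = real (q\<^sup>2 * v)"
        using norm_sq_eq by blast
      then show ?thesis using wq wq' by (metis of_nat_le_iff)
    qed
  qed
  have m1: "{1..m} \<noteq> {}" using m5 by simp
  have a_ge: "real w \<le> a_char m D \<chi>" if "\<chi> \<in> chars" for \<chi>
    unfolding a_char_def using ge[OF that] m1 by (subst Min_ge_iff) auto
  obtain i where i: "i \<in> {1..m}" "X \<chi>0 i * cnj (X \<chi>0 i) = of_nat (1\<^sup>2 * w)"
    using nonzero_type_attained(1)[OF type0] by blast
  have "(cmod (X \<chi>0 i))\<^sup>2 = real w" using norm_sq_eq[OF i(2)] by simp
  then have "a_char m D \<chi>0 \<le> real w"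
    unfolding a_char_def using i(1) by (intro Min_le) (auto intro: image_eqI[of _ _ i])
  then have a0: "a_char m D \<chi>0 = real w" using a_ge[OF \<chi>0] by simp
  show ?thesis unfolding a_min_def
  proof (rule Min_eqI)
    show "finite (a_char m D ` chars)" using finite_chars by simp
    show "real w \<le> y" if "y \<in> a_char m D ` chars" for y using that a_ge by auto
    show "real w \<in> a_char m D ` chars" using \<chi>0 a0 by (metis imageI)
  qed
qed

end

theorem theorem34:
  fixes G :: "('a, 'b) monoid_scheme" and p m k l :: nat and D :: "nat \<Rightarrow> 'a set"
  assumes "prime p"
    and "SEDF G (p ^ 3) m k l D"
    and "k > 1"
    and "m > 2"
  shows "G \<cong> product_group {..<3::nat} (\<lambda>_. integer_mod_group p) \<and>
    (real l = real p ^ 2 * (real p - 1) / (3 * (real m - 1)) \<and>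
     real k = real p * (real p - 1) / (real m - 1) * sqrt ((real p ^ 2 + real p + 1) / 3) \<and>
     \<not> (p - 1) dvd k \<and>
     (\<exists>n::nat. (real p ^ 2 + real p + 1) / 3 = real (n ^ 2)) \<and>
     [p = 1] (mod 12)) \<and>
    (a_min G m D = real p ^ 2 * (real p - 1) / (3 * (real m - 1) * (real m - 3)) \<and>
     (\<exists>c::int. a_min G m D = of_int c \<and> c dvd int l) \<and>
     3 * (int m - 1) * (int m - 3) dvd int p - 1)"
proof -
  have cube': "p ^ Suc 2 = p ^ 3" by (simp add: eval_nat_numeral)
  have "comm_group G" "finite (carrier G)" "Coset.order G = p ^ Suc 2" "SEDF G (p ^ Suc 2) m k l D"
    using assms(2) unfolding cube' by (simp_all add: SEDF_def)
  then interpret sedf_cube G p m k l D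
    using assms by (simp add: sedf_cube_def sedf_def sedf_axioms_def finite_abelian_p_group_def
        finite_abelian_p_group_axioms_def finite_comm_group_def finite_comm_group_axioms_def)
  obtain l' n where l': "l = p\<^sup>2 * l'" "0 < l'" and mp: "3 * l' * (m - 1) = p - 1" and n0: "0 < n"
    and k_eq: "k = p * (3 * l' * n)" and n2: "3 * n\<^sup>2 = p\<^sup>2 + p + 1" and ml: "m * l' < p" and p3: "p > 3"
    using parameters by blast
  obtain \<chi> w where \<chi>: "\<chi> \<in> chars" "nonzero_type \<chi> 1 (m - 3) 1 w" using ex_extremal by blast
  have lw: "l = (m - 3) * w" and m5: "m \<ge> 5" using \<chi>(2) by (auto simp: nonzero_type_def)
  have a_eq: "a_min G m D = real w" using \<chi> by (rule a_min_eq)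
  have mpi: "3 * int l' * (int m - 1) = int p - 1"
  proof -
    have "int (3 * l' * (m - 1)) = int (p - 1)" using mp by simp
    then show ?thesis using m5 p3 by (simp add: of_nat_diff)
  qed
  have mpr: "3 * real l' * (real m - 1) = real p - 1"
    using arg_cong[OF mpi, of real_of_int] by simp
  have n2i: "3 * (int n)\<^sup>2 = (int p)\<^sup>2 + int p + 1"
    using arg_cong[OF n2, of int] by simp
  have n2r: "(real p)\<^sup>2 + real p + 1 = 3 * (real n)\<^sup>2"
    using arg_cong[OF n2i, of real_of_int] by simp
  have conc: "\<not> (int p - 1) dvd int p * (3 * int l' * int n)" "int p mod 12 = 1"
    using parameters_conclusions[of "int p" "int m" "int l'" "int n"] p3 m5 l'(2) prime_p mpi n2i by auto
  have m1: "real m - 1 > 0" "real m - 3 > 0" using m5 by auto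
  have A1: "real l = real p ^ 2 * (real p - 1) / (3 * (real m - 1))"
  proof -
    have "real l * (3 * (real m - 1)) = real p ^ 2 * (real p - 1)"
      unfolding mpr[symmetric] by (simp add: l')
    then show ?thesis using m1 by (simp add: eq_divide_eq)
  qed
  have A2: "real k = real p * (real p - 1) / (real m - 1) * sqrt ((real p ^ 2 + real p + 1) / 3)"
    unfolding n2r using m1 by (simp add: k_eq flip: mpr)
  have A3: "\<not> (p - 1) dvd k"
  proof
    assume "(p - 1) dvd k"
    then have "int (p - 1) dvd int k" by (simp only: int_dvd_int_iff)
    then show False using conc(1) p3 by (simp add: k_eq of_nat_diff)
  qed
  have A4: "\<exists>n::nat. (real p ^ 2 + real p + 1) / 3 = real (n ^ 2)"
    unfolding n2r by (intro exI[of _ n]) simp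
  have "int (p mod 12) = int 1" using conc(2) by (simp add: zmod_int)
  then have A5: "[p = 1] (mod 12)" by (simp add: cong_def)
  have lwr: "real l = (real m - 3) * real w" using lw m5 by (simp add: of_nat_diff)
  then have "real w = real l / (real m - 3)" using m1 by simp
  then have B1: "a_min G m D = real p ^ 2 * (real p - 1) / (3 * (real m - 1) * (real m - 3))"
    unfolding a_eq A1 by simp
  have B2: "\<exists>c::int. a_min G m D = of_int c \<and> c dvd int l"
    using lw by (intro exI[of _ "int w"]) (simp add: a_eq)
  \<comment> \<open>m - 3 is positive and below p, hence prime to p, so it divides \<open>l'\<close>
    and not only \<open>l\<close>. Multiplication by 3 (m - 1) then gives a divisor of p -
    1.\<close>
  have "m \<le> m * l'" using l'(2) by simp
  then have "m < p" using ml by (rule le_less_trans)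
  then have "\<not> p dvd m - 3" using m5 by (auto dest: dvd_imp_le)
  then have "coprime p (m - 3)" using prime_imp_coprime[OF prime_p] by blast
  then have "coprime (m - 3) (p\<^sup>2)" by (simp add: coprime_commute)
  moreover have "m - 3 dvd p\<^sup>2 * l'" using lw l' by (metis dvd_triv_left)
  ultimately have "m - 3 dvd l'" by (simp add: coprime_dvd_mult_right_iff)
  then have "int (m - 3) dvd int l'" by (simp only: int_dvd_int_iff)
  then have "int m - 3 dvd int l'" using m5 by (simp add: of_nat_diff)
  then have "3 * (int m - 1) * (int m - 3) dvd 3 * (int m - 1) * int l'" by (rule mult_dvd_mono[OF dvd_refl])
  then have B3: "3 * (int m - 1) * (int m - 3) dvd int p - 1" by (simp add: mult_ac flip: mpi)
  show ?thesis using iso_C_p_cubed A1 A2 A3 A4 A5 B1 B2 B3 by blast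
qed

end
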